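(* Let $K$ be an algebraically closed field of characteristic $\neq 2$. (i) Every skew-Brauer graph algebra $B_{\Gamma^\times}$ over $K$ (with arbitrary multiplicity function) is a symmetric finite-dimensional $K$-algebra. (ii) The class of trivial extensions of skew-gentle algebras coincides with the class of skew-Brauer graph algebras with multiplicity function identically equal to one. That is: for every skew-gentle algebra $A=A(Q,I,\mathrm{Sp})$ with admissible presentation $A^{\mathrm{sg}}$ there is a skew-Brauer graph $\Gamma^\times$ with multiplicity function identically $1$ such that $T(A^{\mathrm{sg}})\cong B_{\Gamma^\times}$; and for every skew-Brauer graph $\Gamma^\times$ with multiplicity function identically $1$ there is a (not necessarily unique) skew-gentle algebra $A=A(Q,I,\mathrm{Sp})$ such that $T(A^{\mathrm{sg}})\cong B_{\Gamma^\times}$.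
   Context: Quivers $Q=(Q_0,Q_1)$ are finite; $s(\alpha),t(\alpha)$ are the start and end of an arrow; paths are written left to right ($\alpha_1\cdots\alpha_l$ with $t(\alpha_i)=s(\alpha_{i+1})$). SKEW-BRAUER GRAPHS. A Brauer graph $\Gamma=(\Gamma_0,\Gamma_1,\mathfrak m,\mathfrak o)$ is a finite unoriented graph with vertices $\Gamma_0$ and edges $\Gamma_1$ (loops and multiple edges allowed), a multiplicity function $\mathfrak m:\Gamma_0\to\mathbb Z_{>0}$, and for every vertex $v$ a cyclic ordering $\mathfrak o(v)=(x_1,\dots,x_t)$ of the edges attached to $v$, where $t=\mathrm{val}(v)$ is the valency (a loop is counted twice). If $\mathrm{val}(v)=1$ with edge $x$, then $\mathfrak o(v)=(x)$ if $\mathfrak m(v)=1$, and $\mathfrak o(v)=(x,x)$ if $\mathfrak m(v)>1$, so that in the latter case the successor of $x$ is $x$. A skew-Brauer graph is a tuple $\Gamma^\times=(\Gamma_0',\Gamma_0^\times,\Gamma_1,\mathfrak m,\mathfrak o)$ such that $\Gamma=(\Gamma_0'\sqcup\Gamma_0^\times,\Gamma_1,\mathfrak m,\mathfrak o)$ is a Brauer graph (the auxiliary Brauer graph) and every $v\in\Gamma_0^\times$ (special vertex) satisfies $\mathfrak m(v)=1$, $\mathfrak o(v)=(x_v)$, and is adjacent to a single vertex $w\in\Gamma'_0$. Edges attached to special vertices are called special edges. ($\Gamma_0^\times=\emptyset$ is allowed and gives ordinary Brauer graphs.) QUIVERS. $Q_\Gamma$ has vertices the edges of $\Gamma$, and an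 arrow $x\to y$ each time $x,y$ are edges incident to a vertex $v$ and $y$ is the immediate successor of $x$ in $\mathfrak o(v)$ (no arrow for $v$ if $\mathfrak m(v)\mathrm{val}(v)=1$). Each $v$ with $\mathfrak m(v)\mathrm{val}(v)\ge2$ gives an oriented cycle $C_v$ in $Q_\Gamma$ (up to cyclic permutation), the special cycle at $v$. The vertices of $Q_\Gamma$ given by special edges are called special. The quiver $Q^{\mathrm{sg}}_{\Gamma^\times}$ is obtained from $Q_\Gamma$ by replacing every special vertex $x$ by two vertices $x^+,x^-$ (a non-special vertex $x$ is kept and also written $x^{\emptyset}$), and every arrow $\alpha:x\to y$ by arrows ${}^{\varepsilon}\alpha^{\varepsilon'}:x^{\varepsilon}\to y^{\varepsilon'}$ for all possible $\varepsilon,\varepsilon'\in\{+,-,\emptyset\}$. Each $C_v$ induces $2^r$ cycles $C_{v,1},\dots,C_{v,2^r}$ in $Q^{\mathrm{sg}}_{\Gamma^\times}$ (choose a sign at each special vertex on the cycle; $r$ is the number of special edges at $v$), called sg-special cycles at $v$, considered up to cyclic permutation. ALGEBRA. $B_{\Gamma^\times}=KQ^{\mathrm{sg}}_{\Gamma^\times}/I_{\Gamma^\times}$, where $I_{\Gamma^\times}$ is generated by: Type 0: $({}^{\varepsilon}\alpha^+)({}^+\beta^{\varepsilon'})-({}^{\varepsilon}\alpha^-)({}^-\beta^{\varepsilon'})$, for all possible $\varepsilon,\varepsilon'$ (with $t(\alpha)=s(\beta)$ special). Type I: $C_{v,l}^{\mathfrak m(v)}-C_{v',l'}^{\mathfrak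 m(v')}$ for sg-special cycles starting at the same vertex of $Q^{\mathrm{sg}}_{\Gamma^\times}$, with $\mathfrak m(v)\mathrm{val}(v)\ne1\ne\mathfrak m(v')\mathrm{val}(v')$. Type IIa: $C_{v,l}^{\mathfrak m(v)}\alpha$, with $\alpha$ the first arrow of $C_{v,l}$. Type IIb: $C_{v,l}^{\mathfrak m(v)-1}({}^{\varepsilon_1}\alpha_1^{\varepsilon_2})\cdots({}^{\varepsilon_r}\alpha_r^{\varepsilon_{r+1}})$ for each special cycle $C_v=\alpha_1\cdots\alpha_r$ of $Q_\Gamma$ with $s(\alpha_1)$ special, for all possible $\varepsilon_k$ with $\varepsilon_1\ne\varepsilon_{r+1}$. Type III: paths $\alpha\beta$ of length two that are not a sub-path of any sg-special cycle, except when $\alpha=\beta$ is a loop induced by a vertex $v$ with $\mathrm{val}(v)=1$ and $\mathfrak m(v)>1$. SKEW-GENTLE ALGEBRAS. A pair $(Q,I)$ with $I$ generated by a set of paths of length two is gentle if at most two arrows start and at most two end at each vertex; for every arrow $\alpha$ there is at most one arrow $\beta$ with $t(\alpha)=s(\beta)$, $\alpha\beta\in I$, and at most one $\beta'$ with $t(\alpha)=s(\beta')$, $\alpha\beta'\notin I$; dually for arrows ending at $s(\alpha)$; and $KQ/I$ is finite dimensional. A triple $(Q,I,\mathrm{Sp})$ with $I$ generated by a set $\rho$ of paths of length two and $\mathrm{Sp}$ a set of loops (special loops) is skew-gentle if $(Q,\langle I\cup\{f^2: f\in\mathrm{Sp}\}\rangle)$ is gentle; then $A(Q,I,\mathrm{Sp})=KQ/\langle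 I\cup\{f^2-f: f\in \mathrm{Sp}\}\rangle$, and algebras Morita equivalent to such are called skew-gentle. $Q_0^\times$ is the set of vertices carrying a special loop. The auxiliary gentle algebra is $A'=KQ'/I'$ with $Q'=Q\setminus\mathrm{Sp}$ and $I'=\langle\rho\setminus\{\alpha\beta: t(\alpha)=s(\beta)\in Q_0^\times\}\rangle$. The admissible presentation is $A^{\mathrm{sg}}=KQ^{\mathrm{sg}}/I^{\mathrm{sg}}$, where $Q^{\mathrm{sg}}$ is obtained from $Q'$ by replacing each $x\in Q_0^\times$ by two vertices $x^+,x^-$ (a vertex $x\notin Q_0^\times$ is kept and also written $x^{\emptyset}$) and every arrow $\alpha:x\to y$ of $Q'$ by arrows ${}^{\varepsilon}\alpha^{\varepsilon'}:x^{\varepsilon}\to y^{\varepsilon'}$ for all possible $\varepsilon,\varepsilon'\in\{+,-,\emptyset\}$, and $I^{\mathrm{sg}}$ is generated by $({}^{\varepsilon}\alpha^+)({}^+\beta^{\varepsilon'})-({}^{\varepsilon}\alpha^-)({}^-\beta^{\varepsilon'})$ for paths $\alpha\beta$ of $Q'$ with $t(\alpha)\in Q_0^\times$, and $({}^{\varepsilon}\alpha)(\beta^{\varepsilon'})$ for the generators $\alpha\beta$ of $I'$ (all possible $\varepsilon,\varepsilon'$). TRIVIAL EXTENSION. $T(A)=A\oplus DA$, $D=\operatorname{Hom}_K(-,K)$, with product $(a,f)(b,g)=(ab,ag+fb)$.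
   Formalization: An edge whose two ends both have m·val = 1 keeps a loop at each end, giving K[X]/(X²) (two copies if special); with no arrows there, (ii) fails for A = K. Type III's "sub-path" is read cyclically and independently of signs. *)

theory Defs
  imports
    "HOL-Algebra.Algebra"
    "HOL-Algebra.Algebraic_Closure_Type"
    "HOL-Library.Poly_Mapping"
    "HOL-Library.Multiset"
    "Graph_Theory.Arc_Walk"
begin

section \<open>Algebras over a field\<close>

text \<open>
  The ground field is a type \<open>'k\<close>. An algebra is a record of type \<open>('k, 'b) module\<close>; it need not
  be commutative, unlike in the locale \<^locale>\<open>algebra\<close>.
\<close>

definition K_algebra :: "('k::field, 'b) module \<Rightarrow> bool" where
  "K_algebra A \<longleftrightarrow>
     ring A \<and> module (ring_of_type_algebra :: 'k ring) A \<and>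
     (\<forall>c. \<forall>x \<in> carrier A. \<forall>y \<in> carrier A.
        (c \<odot>\<^bsub>A\<^esub> x) \<otimes>\<^bsub>A\<^esub> y = c \<odot>\<^bsub>A\<^esub> (x \<otimes>\<^bsub>A\<^esub> y) \<and>
        x \<otimes>\<^bsub>A\<^esub> (c \<odot>\<^bsub>A\<^esub> y) = c \<odot>\<^bsub>A\<^esub> (x \<otimes>\<^bsub>A\<^esub> y))"

definition fin_dim :: "('k::field, 'b) module \<Rightarrow> bool" where
  "fin_dim A \<longleftrightarrow>
     (\<exists>S. finite S \<and> S \<subseteq> carrier A \<and>
        (\<forall>x \<in> carrier A. \<exists>c. x = (\<Oplus>\<^bsub>A\<^esub>s\<in>S. c s \<odot>\<^bsub>A\<^esub> s)))"

definition algebra_iso :: "('k::field, 'b) module \<Rightarrow> ('k, 'c) module \<Rightarrow> bool" where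
  "algebra_iso A B \<longleftrightarrow>
     (\<exists>\<phi> \<in> ring_iso A B. \<forall>c. \<forall>x \<in> carrier A. \<phi> (c \<odot>\<^bsub>A\<^esub> x) = c \<odot>\<^bsub>B\<^esub> \<phi> x)"

definition quotient_algebra :: "('k::field, 'b) module \<Rightarrow> 'b set \<Rightarrow> ('k, 'b set) module" where
  "quotient_algebra A I =
     ring.extend (A Quot I) (module.fields (\<lambda>c Y. \<Union>x\<in>Y. I +>\<^bsub>A\<^esub> (c \<odot>\<^bsub>A\<^esub> x)))"

subsection \<open>The dual bimodule\<close>

text \<open>Functionals are functions on the carrier, normalised outside of it by \<^const>\<open>extensional\<close>.\<close>

definition dual :: "('k::field, 'b) module \<Rightarrow> ('b \<Rightarrow> 'k) set" where
  "dual A = {f \<in> extensional (carrier A).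
     (\<forall>x \<in> carrier A. \<forall>y \<in> carrier A. f (x \<oplus>\<^bsub>A\<^esub> y) = f x + f y) \<and>
     (\<forall>c. \<forall>x \<in> carrier A. f (c \<odot>\<^bsub>A\<^esub> x) = c * f x)}"

definition dual_add :: "('k::field, 'b) module \<Rightarrow> ('b \<Rightarrow> 'k) \<Rightarrow> ('b \<Rightarrow> 'k) \<Rightarrow> 'b \<Rightarrow> 'k" where
  "dual_add A f g = (\<lambda>x \<in> carrier A. f x + g x)"

definition dual_smult :: "('k::field, 'b) module \<Rightarrow> 'k \<Rightarrow> ('b \<Rightarrow> 'k) \<Rightarrow> 'b \<Rightarrow> 'k" where
  "dual_smult A c f = (\<lambda>x \<in> carrier A. c * f x)"

definition dual_left :: "('k::field, 'b) module \<Rightarrow> 'b \<Rightarrow> ('b \<Rightarrow> 'k) \<Rightarrow> 'b \<Rightarrow> 'k" where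
  "dual_left A a f = (\<lambda>x \<in> carrier A. f (x \<otimes>\<^bsub>A\<^esub> a))"

definition dual_right :: "('k::field, 'b) module \<Rightarrow> ('b \<Rightarrow> 'k) \<Rightarrow> 'b \<Rightarrow> 'b \<Rightarrow> 'k" where
  "dual_right A f a = (\<lambda>x \<in> carrier A. f (a \<otimes>\<^bsub>A\<^esub> x))"

text \<open>\<open>A\<close> is symmetric if \<open>A\<close> and \<open>D A\<close> are isomorphic as \<open>A\<close>-\<open>A\<close>-bimodules.\<close>

definition symmetric_algebra :: "('k::field, 'b) module \<Rightarrow> bool" where
  "symmetric_algebra A \<longleftrightarrow>
     (\<exists>\<phi>. bij_betw \<phi> (carrier A) (dual A) \<and>
        (\<forall>x \<in> carrier A. \<forall>y \<in> carrier A. \<phi> (x \<oplus>\<^bsub>A\<^esub> y) = dual_add A (\<phi> x) (\<phi> y)) \<and>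
        (\<forall>c. \<forall>x \<in> carrier A. \<phi> (c \<odot>\<^bsub>A\<^esub> x) = dual_smult A c (\<phi> x)) \<and>
        (\<forall>a \<in> carrier A. \<forall>x \<in> carrier A. \<phi> (a \<otimes>\<^bsub>A\<^esub> x) = dual_left A a (\<phi> x)) \<and>
        (\<forall>x \<in> carrier A. \<forall>a \<in> carrier A. \<phi> (x \<otimes>\<^bsub>A\<^esub> a) = dual_right A (\<phi> x) a))"

definition trivial_extension :: "('k::field, 'b) module \<Rightarrow> ('k, 'b \<times> ('b \<Rightarrow> 'k)) module" where
  "trivial_extension A =
     \<lparr>carrier = carrier A \<times> dual A,
      monoid.mult = (\<lambda>(a, f) (b, g). (a \<otimes>\<^bsub>A\<^esub> b, dual_add A (dual_left A a g) (dual_right A f b))),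
      monoid.one = (\<one>\<^bsub>A\<^esub>, \<lambda>x \<in> carrier A. 0),
      ring.zero = (\<zero>\<^bsub>A\<^esub>, \<lambda>x \<in> carrier A. 0),
      ring.add = (\<lambda>(a, f) (b, g). (a \<oplus>\<^bsub>A\<^esub> b, dual_add A f g)),
      module.smult = (\<lambda>c (a, f). (c \<odot>\<^bsub>A\<^esub> a, dual_smult A c f))\<rparr>"

section \<open>Path algebras\<close>

text \<open>
  A finite quiver is an \<^locale>\<open>fin_digraph\<close>. A path is a pair of its start and its list of arrows, so
  that \<open>(u, [])\<close> is the trivial path at \<open>u\<close>; paths are composed from left to right.
\<close>

type_synonym ('v, 'a) path = "'v \<times> 'a list"

definition quiver_paths :: "('v, 'a) pre_digraph \<Rightarrow> ('v, 'a) path set" where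
  "quiver_paths Q = {(u, p). \<exists>w. pre_digraph.awalk Q u p w}"

definition path_mult ::
  "('v, 'a) pre_digraph \<Rightarrow> (('v, 'a) path \<Rightarrow>\<^sub>0 'k::field) \<Rightarrow> (('v, 'a) path \<Rightarrow>\<^sub>0 'k) \<Rightarrow> (('v, 'a) path \<Rightarrow>\<^sub>0 'k)"
  where
  "path_mult Q f g =
     (\<Sum>p \<in> Poly_Mapping.keys f. \<Sum>q \<in> Poly_Mapping.keys g.
        if pre_digraph.awalk Q (fst p) (snd p) (fst q)
        then Poly_Mapping.single (fst p, snd p @ snd q) (Poly_Mapping.lookup f p * Poly_Mapping.lookup g q)
        else 0)"

definition path_algebra ::
  "('v, 'a) pre_digraph \<Rightarrow> ('k::field, ('v, 'a) path \<Rightarrow>\<^sub>0 'k) module" where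
  "path_algebra Q =
     \<lparr>carrier = {f. Poly_Mapping.keys f \<subseteq> quiver_paths Q},
      monoid.mult = path_mult Q,
      monoid.one = (\<Sum>u \<in> verts Q. Poly_Mapping.single (u, []) 1),
      ring.zero = 0,
      ring.add = (+),
      module.smult = (\<lambda>c. Poly_Mapping.map ((*) c))\<rparr>"

definition path_elem :: "'v \<Rightarrow> 'a list \<Rightarrow> (('v, 'a) path \<Rightarrow>\<^sub>0 'k::field)" where
  "path_elem u p = Poly_Mapping.single (u, p) 1"

definition bound_quiver_algebra ::
  "('v, 'a) pre_digraph \<Rightarrow> (('v, 'a) path \<Rightarrow>\<^sub>0 'k::field) set \<Rightarrow> ('k, (('v, 'a) path \<Rightarrow>\<^sub>0 'k) set) module"
  where
  "bound_quiver_algebra Q R =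
     quotient_algebra (path_algebra Q) (genideal (path_algebra Q) R)"

section \<open>Splitting vertices of a quiver\<close>

text \<open>
  Given a quiver \<open>Q\<close> and a set \<open>S\<close> of vertices, every vertex \<open>x \<in> S\<close> is replaced by \<open>(x, SPos)\<close> and
  \<open>(x, SNeg)\<close>, every other vertex becomes \<open>(x, SEmpty)\<close>, and the arrows are multiplied accordingly.
\<close>

datatype sign = SPos | SNeg | SEmpty

definition signs :: "'v set \<Rightarrow> 'v \<Rightarrow> sign set" where
  "signs S x = (if x \<in> S then {SPos, SNeg} else {SEmpty})"

type_synonym 'a signed_arrow = "sign \<times> 'a \<times> sign"

definition underlying :: "'a signed_arrow \<Rightarrow> 'a" where
  "underlying a = fst (snd a)"

definition sg_quiver ::
  "('v, 'a) pre_digraph \<Rightarrow> 'v set \<Rightarrow> ('v \<times> sign, 'a signed_arrow) pre_digraph" where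
  "sg_quiver Q S =
     \<lparr>verts = {(x, e). x \<in> verts Q \<and> e \<in> signs S x},
      arcs = {(e, a, e'). a \<in> arcs Q \<and> e \<in> signs S (tail Q a) \<and> e' \<in> signs S (head Q a)},
      tail = (\<lambda>(e, a, e'). (tail Q a, e)),
      head = (\<lambda>(e, a, e'). (head Q a, e'))\<rparr>"

definition composable_pairs :: "('v, 'a) pre_digraph \<Rightarrow> ('a \<times> 'a) set" where
  "composable_pairs Q = {(a, b). a \<in> arcs Q \<and> b \<in> arcs Q \<and> head Q a = tail Q b}"

definition commutativity_relations ::
  "('v, 'a) pre_digraph \<Rightarrow> 'v set \<Rightarrow> (('v \<times> sign, 'a signed_arrow) path \<Rightarrow>\<^sub>0 'k::field) set" where
  "commutativity_relations Q S =
     {path_elem (tail Q a, e) [(e, a, SPos), (SPos, b, e')] -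
      path_elem (tail Q a, e) [(e, a, SNeg), (SNeg, b, e')] | a b e e'.
        (a, b) \<in> composable_pairs Q \<and> head Q a \<in> S \<and>
        e \<in> signs S (tail Q a) \<and> e' \<in> signs S (head Q b)}"

definition lifted_zero_relations ::
  "('v, 'a) pre_digraph \<Rightarrow> 'v set \<Rightarrow> ('a \<times> 'a) set \<Rightarrow> (('v \<times> sign, 'a signed_arrow) path \<Rightarrow>\<^sub>0 'k::field) set"
  where
  "lifted_zero_relations Q S P =
     {path_elem u [a, b] | u a b.
        (\<exists>w. pre_digraph.awalk (sg_quiver Q S) u [a, b] w) \<and> (underlying a, underlying b) \<in> P}"

section \<open>Skew-gentle algebras\<close>

text \<open>
  A set \<open>\<rho>\<close> of paths of length two is given as a set of pairs of arrows. The field \<open>'k\<close> enters only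
  through the ideal generated by \<open>\<rho>\<close> in the path algebra.
\<close>

definition zero_ideal ::
  "'k::field itself \<Rightarrow> ('v, 'a) pre_digraph \<Rightarrow> ('a \<times> 'a) set \<Rightarrow> (('v, 'a) path \<Rightarrow>\<^sub>0 'k) set" where
  "zero_ideal _ Q \<rho> =
     genideal (path_algebra Q) {path_elem (tail Q a) [a, b] | a b. (a, b) \<in> \<rho>}"

definition gentle ::
  "'k::field itself \<Rightarrow> ('v, 'a) pre_digraph \<Rightarrow> ('a \<times> 'a) set \<Rightarrow> bool" where
  "gentle K Q \<rho> \<longleftrightarrow>
     fin_digraph Q \<and> \<rho> \<subseteq> composable_pairs Q \<and>
     (\<forall>x \<in> verts Q. card {a \<in> arcs Q. tail Q a = x} \<le> 2 \<and> card {a \<in> arcs Q. head Q a = x} \<le> 2) \<and>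
     (\<forall>a \<in> arcs Q.
        card {b \<in> arcs Q. head Q a = tail Q b \<and> path_elem (tail Q a) [a, b] \<in> zero_ideal K Q \<rho>} \<le> 1 \<and>
        card {b \<in> arcs Q. head Q a = tail Q b \<and> path_elem (tail Q a) [a, b] \<notin> zero_ideal K Q \<rho>} \<le> 1 \<and>
        card {b \<in> arcs Q. head Q b = tail Q a \<and> path_elem (tail Q b) [b, a] \<in> zero_ideal K Q \<rho>} \<le> 1 \<and>
        card {b \<in> arcs Q. head Q b = tail Q a \<and> path_elem (tail Q b) [b, a] \<notin> zero_ideal K Q \<rho>} \<le> 1) \<and>
     fin_dim (quotient_algebra (path_algebra Q) (zero_ideal K Q \<rho>))"

definition skew_gentle ::
  "'k::field itself \<Rightarrow> ('v, 'a) pre_digraph \<Rightarrow> ('a \<times> 'a) set \<Rightarrow> 'a set \<Rightarrow> bool" where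
  "skew_gentle K Q \<rho> Sp \<longleftrightarrow>
     \<rho> \<subseteq> composable_pairs Q \<and>
     Sp \<subseteq> {f \<in> arcs Q. tail Q f = head Q f} \<and>
     gentle K Q (\<rho> \<union> {(f, f) | f. f \<in> Sp})"

text \<open>
  \<open>skew_gentle_algebra Q \<rho> Sp\<close> is \<open>A(Q, I, Sp)\<close>; \<open>admissible_presentation Q \<rho> Sp\<close> is the algebra
  \<open>A\<^sup>s\<^sup>g\<close>, which is built from the auxiliary gentle pair \<open>(Q', I')\<close>.
\<close>

definition skew_gentle_algebra ::
  "('v, 'a) pre_digraph \<Rightarrow> ('a \<times> 'a) set \<Rightarrow> 'a set \<Rightarrow> ('k::field, (('v, 'a) path \<Rightarrow>\<^sub>0 'k) set) module"
  where
  "skew_gentle_algebra Q \<rho> Sp =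
     bound_quiver_algebra Q
       ({path_elem (tail Q a) [a, b] | a b. (a, b) \<in> \<rho>} \<union>
        {path_elem (tail Q f) [f, f] - path_elem (tail Q f) [f] | f. f \<in> Sp})"

definition special_verts :: "('v, 'a) pre_digraph \<Rightarrow> 'a set \<Rightarrow> 'v set" where
  "special_verts Q Sp = tail Q ` Sp"

definition aux_quiver :: "('v, 'a) pre_digraph \<Rightarrow> 'a set \<Rightarrow> ('v, 'a) pre_digraph" where
  "aux_quiver Q Sp = Q\<lparr>arcs := arcs Q - Sp\<rparr>"

definition aux_relations ::
  "('v, 'a) pre_digraph \<Rightarrow> ('a \<times> 'a) set \<Rightarrow> 'a set \<Rightarrow> ('a \<times> 'a) set" where
  "aux_relations Q \<rho> Sp = {(a, b) \<in> \<rho>. head Q a \<notin> special_verts Q Sp}"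

definition admissible_presentation ::
  "('v, 'a) pre_digraph \<Rightarrow> ('a \<times> 'a) set \<Rightarrow> 'a set \<Rightarrow>
   ('k::field, (('v \<times> sign, 'a signed_arrow) path \<Rightarrow>\<^sub>0 'k) set) module" where
  "admissible_presentation Q \<rho> Sp =
     (let Q' = aux_quiver Q Sp; S = special_verts Q Sp in
      bound_quiver_algebra (sg_quiver Q' S)
        (commutativity_relations Q' S \<union> lifted_zero_relations Q' S (aux_relations Q \<rho> Sp)))"

section \<open>Skew-Brauer graphs\<close>

text \<open>
  \<open>ends x\<close> is the multiset of the two end points of the edge \<open>x\<close>, equal ones for a loop. The list
  \<open>cyc v\<close>, read cyclically, is the cyclic ordering at \<open>v\<close>; a loop at \<open>v\<close> occurs in it twice. For
  \<open>val v = 1\<close> the list is always \<open>[x]\<close>: the cyclic successor of \<open>x\<close> is then \<open>x\<close>, which is what the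
  notation \<open>(x, x)\<close> in the case \<open>mlt v > 1\<close> expresses.
\<close>

record ('v, 'e) brauer_graph =
  vertices :: "'v set"
  edges :: "'e set"
  ends :: "'e \<Rightarrow> 'v multiset"
  mlt :: "'v \<Rightarrow> nat"
  cyc :: "'v \<Rightarrow> 'e list"

record ('v, 'e) skew_brauer_graph = "('v, 'e) brauer_graph" +
  special :: "'v set"

locale brauer_graph =
  fixes \<Gamma> :: "('v, 'e, 'm) brauer_graph_scheme"
  assumes finite_vertices: "finite (vertices \<Gamma>)"
    and finite_edges: "finite (edges \<Gamma>)"
    and ends: "x \<in> edges \<Gamma> \<Longrightarrow> size (ends \<Gamma> x) = 2 \<and> set_mset (ends \<Gamma> x) \<subseteq> vertices \<Gamma>"
    and mlt_pos: "v \<in> vertices \<Gamma> \<Longrightarrow> 0 < mlt \<Gamma> v"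
    and cyc_edges: "v \<in> vertices \<Gamma> \<Longrightarrow> set (cyc \<Gamma> v) \<subseteq> edges \<Gamma>"
    and cyc_count: "v \<in> vertices \<Gamma> \<Longrightarrow> x \<in> edges \<Gamma> \<Longrightarrow> count_list (cyc \<Gamma> v) x = count (ends \<Gamma> x) v"

text \<open>The vertices of \<open>\<Gamma>\<close> are those of the auxiliary Brauer graph, special ones included.\<close>

locale skew_brauer_graph =
  brauer_graph \<Gamma> for \<Gamma> :: "('v, 'e) skew_brauer_graph" +
  assumes special_subset: "special \<Gamma> \<subseteq> vertices \<Gamma>"
    and special_vertex: "v \<in> special \<Gamma> \<Longrightarrow>
      mlt \<Gamma> v = 1 \<and>
      (\<exists>x \<in> edges \<Gamma>. cyc \<Gamma> v = [x] \<and> (\<exists>w \<in> vertices \<Gamma> - special \<Gamma>. ends \<Gamma> x = {#v, w#}))"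

definition multiplicity_one :: "('v, 'e) skew_brauer_graph \<Rightarrow> bool" where
  "multiplicity_one \<Gamma> \<longleftrightarrow> (\<forall>v \<in> vertices \<Gamma>. mlt \<Gamma> v = 1)"

definition val :: "('v, 'e, 'm) brauer_graph_scheme \<Rightarrow> 'v \<Rightarrow> nat" where
  "val \<Gamma> v = (\<Sum>x \<in> edges \<Gamma>. count (ends \<Gamma> x) v)"

definition special_edges :: "('v, 'e) skew_brauer_graph \<Rightarrow> 'e set" where
  "special_edges \<Gamma> = {x \<in> edges \<Gamma>. \<exists>v \<in> special \<Gamma>. v \<in># ends \<Gamma> x}"

text \<open>
  Vertices with \<open>mlt v * val v = 1\<close> carry no arrows, with the usual exception of an edge both of
  whose ends are of this kind (which is then a connected component): the algebra of a single such edge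
  is \<open>K[X]/(X\<^sup>2)\<close>, as for Brauer trees, and \<open>K[X]/(X\<^sup>2) \<times> K[X]/(X\<^sup>2)\<close> if the edge is special. We obtain
  this by keeping the loops at both ends, as degenerate special cycles of length one. The relations
  of type I identify the two loops, those of types IIa and III make all products of loops
  vanish, and those of type IIb remove the arrows between \<open>x\<^sup>+\<close> and \<open>x\<^sup>-\<close>. Without this convention the
  algebra would be \<open>K\<close> or \<open>K \<times> K\<close>; neither is a trivial extension of a skew-gentle algebra, while
  \<open>T(K) = K[X]/(X\<^sup>2)\<close> would not be a skew-Brauer graph algebra.
\<close>

definition truncated :: "('v, 'e, 'm) brauer_graph_scheme \<Rightarrow> 'v \<Rightarrow> bool" where
  "truncated \<Gamma> v \<longleftrightarrow> mlt \<Gamma> v * val \<Gamma> v = 1"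

definition carries_arrows :: "('v, 'e, 'm) brauer_graph_scheme \<Rightarrow> 'v \<Rightarrow> bool" where
  "carries_arrows \<Gamma> v \<longleftrightarrow>
     v \<in> vertices \<Gamma> \<and>
     (\<not> truncated \<Gamma> v \<or> (\<exists>x \<in> edges \<Gamma>. v \<in># ends \<Gamma> x \<and> (\<forall>w \<in># ends \<Gamma> x. truncated \<Gamma> w)))"

text \<open>The arrow \<open>(v, i)\<close> goes from the edge in position \<open>i\<close> of \<open>cyc v\<close> to its immediate successor.\<close>

definition next_arrow :: "('v, 'e, 'm) brauer_graph_scheme \<Rightarrow> 'v \<times> nat \<Rightarrow> 'v \<times> nat" where
  "next_arrow \<Gamma> = (\<lambda>(v, i). (v, Suc i mod val \<Gamma> v))"

definition brauer_quiver :: "('v, 'e, 'm) brauer_graph_scheme \<Rightarrow> ('e, 'v \<times> nat) pre_digraph" where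
  "brauer_quiver \<Gamma> =
     \<lparr>verts = edges \<Gamma>,
      arcs = {(v, i). carries_arrows \<Gamma> v \<and> i < val \<Gamma> v},
      tail = (\<lambda>(v, i). cyc \<Gamma> v ! i),
      head = (\<lambda>(v, i). cyc \<Gamma> v ! (Suc i mod val \<Gamma> v))\<rparr>"

text \<open>The special cycle at \<open>v\<close> that starts with the arrow \<open>(v, i)\<close>.\<close>

definition special_cycle :: "('v, 'e, 'm) brauer_graph_scheme \<Rightarrow> 'v \<Rightarrow> nat \<Rightarrow> ('v \<times> nat) list" where
  "special_cycle \<Gamma> v i = map (\<lambda>j. (v, (i + j) mod val \<Gamma> v)) [0..<val \<Gamma> v]"

type_synonym 'e sg_vertex = "'e \<times> sign"
type_synonym 'v sg_arrow = "('v \<times> nat) signed_arrow"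

definition skew_brauer_quiver ::
  "('v, 'e) skew_brauer_graph \<Rightarrow> ('e sg_vertex, 'v sg_arrow) pre_digraph" where
  "skew_brauer_quiver \<Gamma> = sg_quiver (brauer_quiver \<Gamma>) (special_edges \<Gamma>)"

text \<open>
  Since a special edge occurs exactly once in the cyclic ordering at its non-special end, choosing
  a sign at each special vertex of a special cycle amounts to lifting the cycle to a closed walk.
\<close>

definition lifts_cycle ::
  "('v, 'e) skew_brauer_graph \<Rightarrow> 'v \<Rightarrow> nat \<Rightarrow> 'e sg_vertex \<Rightarrow> 'v sg_arrow list \<Rightarrow> 'e sg_vertex \<Rightarrow> bool"
  where
  "lifts_cycle \<Gamma> v i u c w \<longleftrightarrow>
     carries_arrows \<Gamma> v \<and> i < val \<Gamma> v \<and> map underlying c = special_cycle \<Gamma> v i \<and>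
     pre_digraph.awalk (skew_brauer_quiver \<Gamma>) u c w"

definition sg_special_cycle ::
  "('v, 'e) skew_brauer_graph \<Rightarrow> 'v \<Rightarrow> 'e sg_vertex \<Rightarrow> 'v sg_arrow list \<Rightarrow> bool" where
  "sg_special_cycle \<Gamma> v u c \<longleftrightarrow> (\<exists>i. lifts_cycle \<Gamma> v i u c u)"

definition power :: "'a list \<Rightarrow> nat \<Rightarrow> 'a list" where
  "power p n = concat (replicate n p)"

definition type_I_relations ::
  "('v, 'e) skew_brauer_graph \<Rightarrow> (('e sg_vertex, 'v sg_arrow) path \<Rightarrow>\<^sub>0 'k::field) set" where
  "type_I_relations \<Gamma> =
     {path_elem u (power c (mlt \<Gamma> v)) - path_elem u (power c' (mlt \<Gamma> v')) | u v c v' c'.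
        sg_special_cycle \<Gamma> v u c \<and> sg_special_cycle \<Gamma> v' u c'}"

definition type_IIa_relations ::
  "('v, 'e) skew_brauer_graph \<Rightarrow> (('e sg_vertex, 'v sg_arrow) path \<Rightarrow>\<^sub>0 'k::field) set" where
  "type_IIa_relations \<Gamma> =
     {path_elem u (power c (mlt \<Gamma> v) @ [hd c]) | u v c. sg_special_cycle \<Gamma> v u c}"

text \<open>
  The last factor \<open>d\<close> is a lift of the special cycle whose end points are the two different
  vertices over the same special edge.
\<close>

definition type_IIb_relations ::
  "('v, 'e) skew_brauer_graph \<Rightarrow> (('e sg_vertex, 'v sg_arrow) path \<Rightarrow>\<^sub>0 'k::field) set" where
  "type_IIb_relations \<Gamma> =
     {path_elem (x, e) (power c (mlt \<Gamma> v - 1) @ d) | x e e' v i c d.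
        x \<in> special_edges \<Gamma> \<and> e \<noteq> e' \<and>
        lifts_cycle \<Gamma> v i (x, e) c (x, e) \<and> lifts_cycle \<Gamma> v i (x, e) d (x, e')}"

text \<open>
  Paths of length two whose underlying path runs along no special cycle. Being a sub-path is
  understood cyclically and independently of the signs. In particular, for \<open>val v = 1\<close> and
  \<open>mlt v > 1\<close> the square of the loop at \<open>v\<close> is no relation, since \<open>next_arrow \<Gamma> (v, 0) = (v, 0)\<close>.
\<close>

definition type_III_relations ::
  "('v, 'e) skew_brauer_graph \<Rightarrow> (('e sg_vertex, 'v sg_arrow) path \<Rightarrow>\<^sub>0 'k::field) set" where
  "type_III_relations \<Gamma> =
     lifted_zero_relations (brauer_quiver \<Gamma>) (special_edges \<Gamma>) {(a, b). b \<noteq> next_arrow \<Gamma> a}"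

definition skew_brauer_graph_algebra ::
  "('v, 'e) skew_brauer_graph \<Rightarrow> ('k::field, (('e sg_vertex, 'v sg_arrow) path \<Rightarrow>\<^sub>0 'k) set) module"
  where
  "skew_brauer_graph_algebra \<Gamma> =
     bound_quiver_algebra (skew_brauer_quiver \<Gamma>)
       (commutativity_relations (brauer_quiver \<Gamma>) (special_edges \<Gamma>) \<union> type_I_relations \<Gamma> \<union>
        type_IIa_relations \<Gamma> \<union> type_IIb_relations \<Gamma> \<union> type_III_relations \<Gamma>)"

end

theory Submission
  imports Defs
begin

text \<open>
  All relations identify paths with each other or with zero, so the algebras have monomial bases of
  path classes. For \<open>B\<close> of a skew-Brauer graph these are the trivial paths, the proper arcs of special
  cycles (with a sign at either end) and the socle elements. Passing from an arc to the complementary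
  arc of its special cycle is an involution compatible with cyclic rotation of products, and it
  yields the symmetrising form.

  With multiplicity one, give degree one to one arrow of every special cycle and degree zero to the
  others. The degree zero part is the admissible presentation of a skew-gentle algebra and the
  involution exchanges the degrees, so \<open>B\<close> is the trivial extension of its degree zero part.
  Conversely, in a gentle quiver every vertex is made of two half-edges, and the arrows link the
  half-edges into chains, because the finite dimension of the algebra excludes cycles. These chains
  are the vertices of the graph; the half-edges left isolated by special loops are its special
  vertices.
\<close>

section \<open>Path algebras\<close>

text \<open>The relations of types 0 and I identify different paths, so the independence of the path
  classes cannot be read off from the ideal. It comes from a candidate basis instead:
  \<open>nf\<close> sends a path to a label or to zero, and as soon as the label of a product
  depends only on the labels of its factors, the elements whose coefficients sum to zero over each
  label form an ideal. It contains the relations, and reducing every path to a representative of its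
  label shows that it is no larger. Both algebras, B and the admissible presentation, use the same
  labels and the same product \<open>label_mul\<close>; the second quiver merely offers fewer
  arrows. The degree zero part of B is therefore recognised without comparing multiplication tables.
  A trivial extension has structure constants that are rotations of those of the algebra, so cyclic
  invariance of \<open>label_mul\<close> determines the rest of B. Any arrow of a special cycle
  could be given degree one. Taking the last position of \<open>cyc v\<close> has the advantage that
  arcs of degree zero are those whose positions do not wrap round, so that the degree is an integer
  quotient.\<close>

lemma (in comm_ring_1) ring_of_type_algebra_simps [simp]:
  "carrier (ring_of_type_algebra :: 'a ring) = UNIV"
  "x \<otimes>\<^bsub>(ring_of_type_algebra :: 'a ring)\<^esub> y = x * y"
  "x \<oplus>\<^bsub>(ring_of_type_algebra :: 'a ring)\<^esub> y = x + y"
  "\<one>\<^bsub>(ring_of_type_algebra :: 'a ring)\<^esub> = 1"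
  "\<zero>\<^bsub>(ring_of_type_algebra :: 'a ring)\<^esub> = 0"
  by (simp_all add: ring_of_type_algebra_def)

lemma poly_mapping_expand:
  "finite A \<Longrightarrow> Poly_Mapping.keys f \<subseteq> A \<Longrightarrow>
   f = (\<Sum>p\<in>A. Poly_Mapping.single p (Poly_Mapping.lookup f p))"
  by (rule poly_mapping_eqI)
     (auto simp: lookup_sum lookup_single when_def in_keys_iff sum.delta' split: if_splits)

lemma lookup_smult:
  "Poly_Mapping.lookup (Poly_Mapping.map ((*) c) f) p = (c :: 'k::field) * Poly_Mapping.lookup f p"
  by (simp add: map.rep_eq when_def)

lemma keys_smult_subset: "Poly_Mapping.keys (Poly_Mapping.map ((*) (c :: 'k::field)) f) \<subseteq> Poly_Mapping.keys f"
  by (auto simp: in_keys_iff lookup_smult)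

text \<open>Carrying the coefficient as an argument makes the product of two paths additive in it
  and zero at \<open>0\<close>; the double sum in \<open>path_mult\<close> can then be extended to
  any finite sets containing the supports.\<close>

definition path_prod :: "('v, 'a) pre_digraph \<Rightarrow> ('v, 'a) path \<Rightarrow> ('v, 'a) path \<Rightarrow> 'k::field \<Rightarrow> (('v, 'a) path \<Rightarrow>\<^sub>0 'k)"
  where "path_prod Q p q c =
    (if pre_digraph.awalk Q (fst p) (snd p) (fst q) then Poly_Mapping.single (fst p, snd p @ snd q) c else 0)"

lemma path_prod_zero [simp]: "path_prod Q p q 0 = 0"
  by (simp add: path_prod_def)

lemma path_prod_add: "path_prod Q p q (c + d) = path_prod Q p q c + path_prod Q p q d"
  by (simp add: path_prod_def single_add)

text \<open>Supports change under addition and scaling, so sums over supports cannot be compared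
  directly. Both are rewritten over a common finite index set, where the added terms have
  coefficient zero; bilinearity of the product rests on this.\<close>

lemma path_mult_superset:
  assumes "finite A" "Poly_Mapping.keys f \<subseteq> A" "finite B" "Poly_Mapping.keys g \<subseteq> B"
  shows "path_mult Q f g =
    (\<Sum>p\<in>A. \<Sum>q\<in>B. path_prod Q p q (Poly_Mapping.lookup f p * Poly_Mapping.lookup g q))"
proof -
  have "path_mult Q f g = (\<Sum>p\<in>Poly_Mapping.keys f. \<Sum>q\<in>Poly_Mapping.keys g.
      path_prod Q p q (Poly_Mapping.lookup f p * Poly_Mapping.lookup g q))"
    by (simp add: path_mult_def path_prod_def)
  also have "\<dots> = (\<Sum>p\<in>A. \<Sum>q\<in>Poly_Mapping.keys g.
      path_prod Q p q (Poly_Mapping.lookup f p * Poly_Mapping.lookup g q))"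
    using assms by (intro sum.mono_neutral_left) (auto simp: in_keys_iff)
  also have "\<dots> = (\<Sum>p\<in>A. \<Sum>q\<in>B.
      path_prod Q p q (Poly_Mapping.lookup f p * Poly_Mapping.lookup g q))"
    using assms by (intro sum.cong sum.mono_neutral_left) (auto simp: in_keys_iff)
  finally show ?thesis .
qed

lemma path_mult_add_left: "path_mult Q (f + f') g = path_mult Q f g + path_mult Q f' g"
proof -
  let ?A = "Poly_Mapping.keys f \<union> Poly_Mapping.keys f'" and ?B = "Poly_Mapping.keys g"
  have "Poly_Mapping.keys (f + f') \<subseteq> ?A" by (rule keys_add)
  then show ?thesis
    by (simp add: path_mult_superset[of ?A _ ?B] lookup_add ring_distribs path_prod_add sum.distrib)
qed

lemma path_mult_add_right: "path_mult Q f (g + g') = path_mult Q f g + path_mult Q f g'"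
proof -
  let ?A = "Poly_Mapping.keys g \<union> Poly_Mapping.keys g'" and ?B = "Poly_Mapping.keys f"
  have "Poly_Mapping.keys (g + g') \<subseteq> ?A" by (rule keys_add)
  then show ?thesis
    by (simp add: path_mult_superset[of ?B _ ?A] lookup_add ring_distribs path_prod_add sum.distrib)
qed

lemma path_mult_zero [simp]: "path_mult Q 0 g = 0" "path_mult Q f 0 = 0"
  by (simp_all add: path_mult_def)

lemma path_mult_sum_left: "path_mult Q (\<Sum>i\<in>A. F i) g = (\<Sum>i\<in>A. path_mult Q (F i) g)"
  by (induction A rule: infinite_finite_induct) (simp_all add: path_mult_add_left)

lemma path_mult_sum_right: "path_mult Q f (\<Sum>i\<in>A. G i) = (\<Sum>i\<in>A. path_mult Q f (G i))"
  by (induction A rule: infinite_finite_induct) (simp_all add: path_mult_add_right)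

lemma path_mult_single:
  "path_mult Q (Poly_Mapping.single p c) (Poly_Mapping.single q d) = path_prod Q p q (c * d)"
  by (subst path_mult_superset[of "{p}" _ "{q}"]) auto

lemma smult_path_prod: "Poly_Mapping.map ((*) d) (path_prod Q p q c) = path_prod Q p q (d * c)"
  by (rule poly_mapping_eqI) (simp add: path_prod_def lookup_smult lookup_single when_def)

lemma smult_sum: "Poly_Mapping.map ((*) (c :: 'k::field)) (\<Sum>i\<in>A. F i) = (\<Sum>i\<in>A. Poly_Mapping.map ((*) c) (F i))"
  by (rule poly_mapping_eqI) (simp add: lookup_smult lookup_sum sum_distrib_left)

lemma path_mult_smult_left: "path_mult Q (Poly_Mapping.map ((*) c) f) g = Poly_Mapping.map ((*) c) (path_mult Q f g)"
  by (simp add: path_mult_superset[of "Poly_Mapping.keys f" _ "Poly_Mapping.keys g"]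
      keys_smult_subset lookup_smult smult_sum smult_path_prod mult.assoc)

lemma path_mult_smult_right: "path_mult Q f (Poly_Mapping.map ((*) c) g) = Poly_Mapping.map ((*) c) (path_mult Q f g)"
  by (simp add: path_mult_superset[of "Poly_Mapping.keys f" _ "Poly_Mapping.keys g"]
      keys_smult_subset lookup_smult smult_sum smult_path_prod mult.left_commute)

lemma path_algebra_simps [simp]:
  "carrier (path_algebra Q) = {f. Poly_Mapping.keys f \<subseteq> quiver_paths Q}"
  "x \<otimes>\<^bsub>path_algebra Q\<^esub> y = path_mult Q x y"
  "\<one>\<^bsub>path_algebra Q\<^esub> = (\<Sum>u\<in>verts Q. Poly_Mapping.single (u, []) 1)"
  "\<zero>\<^bsub>path_algebra Q\<^esub> = 0"
  "x \<oplus>\<^bsub>path_algebra Q\<^esub> y = x + y"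
  "c \<odot>\<^bsub>path_algebra Q\<^esub> x = Poly_Mapping.map ((*) c) x"
  by (simp_all add: path_algebra_def)

section \<open>The path algebra as an associative unital algebra\<close>

context fin_digraph
begin

lemma awalk_unique_end: "awalk u p v \<Longrightarrow> awalk u p w \<Longrightarrow> v = w"
  by (metis awalk_def awlast_if_cas)

lemma awalk_append_conv: "awalk u p v \<Longrightarrow> awalk u (p @ q) w \<longleftrightarrow> awalk v q w"
  by (metis awalk_append_iff awalk_def awlast_if_cas)

lemma path_prod_carrier:
  assumes "q \<in> quiver_paths G"
  shows "Poly_Mapping.keys (path_prod G p q c) \<subseteq> quiver_paths G"
  using assms by (auto simp: path_prod_def quiver_paths_def awalk_append_conv split: if_splits)

lemma keys_sum_subset:
  "(\<And>i. i \<in> A \<Longrightarrow> Poly_Mapping.keys (F i) \<subseteq> B) \<Longrightarrow> Poly_Mapping.keys (\<Sum>i\<in>A. F i) \<subseteq> B"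
proof (induction A rule: infinite_finite_induct)
  case (insert x F')
  then show ?case using keys_add[of "F x" "sum F F'"] by auto
qed auto

lemma path_mult_carrier:
  "Poly_Mapping.keys f \<subseteq> quiver_paths G \<Longrightarrow> Poly_Mapping.keys g \<subseteq> quiver_paths G \<Longrightarrow>
   Poly_Mapping.keys (path_mult G f g) \<subseteq> quiver_paths G"
  unfolding path_mult_superset[OF finite_keys subset_refl finite_keys subset_refl, of G f g]
  by (intro keys_sum_subset path_prod_carrier) blast

text \<open>Both bracketings ask that \<open>p\<close> ends where \<open>q\<close> starts and
  \<open>q\<close> ends where \<open>r\<close> starts, since a concatenation ends where its last
  factor does.\<close>

lemma path_mult_single_assoc:
  assumes "p \<in> quiver_paths G" "q \<in> quiver_paths G" "r \<in> quiver_paths G"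
  shows "path_mult G (path_mult G (Poly_Mapping.single p a) (Poly_Mapping.single q b)) (Poly_Mapping.single r c) =
         path_mult G (Poly_Mapping.single p a) (path_mult G (Poly_Mapping.single q b) (Poly_Mapping.single r (c::'k::field)))"
proof -
  have "awalk (fst p) (snd p) (fst q) \<Longrightarrow>
      awalk (fst p) (snd p @ snd q) (fst r) \<longleftrightarrow> awalk (fst q) (snd q) (fst r)"
    by (rule awalk_append_conv)
  then show ?thesis
    by (auto simp: path_mult_single path_prod_def mult.assoc)
qed

lemma path_mult_assoc:
  assumes "Poly_Mapping.keys f \<subseteq> quiver_paths G" "Poly_Mapping.keys g \<subseteq> quiver_paths G"
    "Poly_Mapping.keys h \<subseteq> quiver_paths G"
  shows "path_mult G (path_mult G f g) h = path_mult G f (path_mult G g (h :: _ \<Rightarrow>\<^sub>0 'k::field))"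
proof -
  let ?e = "\<lambda>f. \<Sum>p\<in>Poly_Mapping.keys f. Poly_Mapping.single p (Poly_Mapping.lookup f p)"
  have "path_mult G (path_mult G (?e f) (?e g)) (?e h) = path_mult G (?e f) (path_mult G (?e g) (?e h))"
    unfolding path_mult_sum_left path_mult_sum_right using assms
    by (intro sum.cong refl path_mult_single_assoc) auto
  then show ?thesis
    by (simp flip: poly_mapping_expand)
qed

lemma trivial_path_in_quiver_paths [simp]: "(u, []) \<in> quiver_paths G \<longleftrightarrow> u \<in> verts G"
  by (auto simp: quiver_paths_def awalk_def)

lemma path_mult_one_left:
  assumes "Poly_Mapping.keys f \<subseteq> quiver_paths G"
  shows "path_mult G (\<Sum>u\<in>verts G. Poly_Mapping.single (u, []) 1) f = (f :: _ \<Rightarrow>\<^sub>0 'k::field)"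
proof -
  let ?e = "\<Sum>p\<in>Poly_Mapping.keys f. Poly_Mapping.single p (Poly_Mapping.lookup f p)"
  have "path_mult G (\<Sum>u\<in>verts G. Poly_Mapping.single (u, []) 1) ?e = ?e"
    unfolding path_mult_sum_right path_mult_sum_left
  proof (intro sum.cong refl)
    fix p assume "p \<in> Poly_Mapping.keys f"
    then have "fst p \<in> verts G" using assms by (auto simp: quiver_paths_def awalk_def)
    then show "(\<Sum>u\<in>verts G. path_mult G (Poly_Mapping.single (u, []) 1)
        (Poly_Mapping.single p (Poly_Mapping.lookup f p))) = Poly_Mapping.single p (Poly_Mapping.lookup f p)"
      by (simp add: path_mult_single path_prod_def awalk_def)
  qed
  then show ?thesis by (simp flip: poly_mapping_expand)
qed

lemma path_mult_one_right:
  assumes "Poly_Mapping.keys f \<subseteq> quiver_paths G"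
  shows "path_mult G f (\<Sum>u\<in>verts G. Poly_Mapping.single (u, []) 1) = (f :: _ \<Rightarrow>\<^sub>0 'k::field)"
proof -
  let ?e = "\<Sum>p\<in>Poly_Mapping.keys f. Poly_Mapping.single p (Poly_Mapping.lookup f p)"
  have "path_mult G ?e (\<Sum>u\<in>verts G. Poly_Mapping.single (u, []) 1) = ?e"
  proof (subst path_mult_sum_left, unfold path_mult_sum_right, intro sum.cong refl)
    fix p assume "p \<in> Poly_Mapping.keys f"
    then obtain w where w: "awalk (fst p) (snd p) w" using assms by (auto simp: quiver_paths_def)
    \<comment> \<open>A path has only one end, so a single summand of the unit survives.\<close>
    then have "awalk (fst p) (snd p) u \<longleftrightarrow> u = w" for u using awalk_unique_end by blast
    moreover have "w \<in> verts G" using w by (rule awalk_last_in_verts)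
    ultimately show "(\<Sum>u\<in>verts G. path_mult G (Poly_Mapping.single p (Poly_Mapping.lookup f p))
        (Poly_Mapping.single (u, []) 1)) = Poly_Mapping.single p (Poly_Mapping.lookup f p)"
      by (simp add: path_mult_single path_prod_def sum.delta)
  qed
  then show ?thesis by (simp flip: poly_mapping_expand)
qed

lemma ring_path_algebra: "ring (path_algebra G :: ('k::field, _) module)"
proof (rule ringI)
  show "abelian_group (path_algebra G :: ('k, _) module)"
  proof (rule abelian_groupI)
    fix x :: "_ \<Rightarrow>\<^sub>0 'k" assume "x \<in> carrier (path_algebra G)"
    then show "\<exists>y\<in>carrier (path_algebra G). y \<oplus>\<^bsub>path_algebra G\<^esub> x = \<zero>\<^bsub>path_algebra G\<^esub>"
      by (intro bexI[of _ "- x"]) (auto simp: in_keys_iff)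
  next
    fix x y :: "_ \<Rightarrow>\<^sub>0 'k" assume "x \<in> carrier (path_algebra G)" "y \<in> carrier (path_algebra G)"
    then show "x \<oplus>\<^bsub>path_algebra G\<^esub> y \<in> carrier (path_algebra G)"
      using keys_add[of x y] by auto
  qed (auto simp: add.assoc add.commute)
next
  show "Group.monoid (path_algebra G :: ('k, _) module)"
    by (rule monoidI) (simp_all add: path_mult_assoc path_mult_one_left path_mult_one_right
        path_mult_carrier keys_sum_subset)
qed (auto simp: path_mult_add_left path_mult_add_right)

lemma K_algebra_path_algebra: "K_algebra (path_algebra G :: ('k::field, _) module)"
proof -
  interpret ring "path_algebra G :: ('k, _) module" by (rule ring_path_algebra)
  have "module (ring_of_type_algebra :: 'k ring) (path_algebra G :: ('k, _) module)"
    using keys_smult_subset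
    by (intro moduleI cring_from_type_algebra is_abelian_group)
       (auto intro!: poly_mapping_eqI simp: lookup_smult lookup_add ring_distribs in_keys_iff)
  then show ?thesis
    by (simp add: K_algebra_def ring_path_algebra path_mult_smult_left path_mult_smult_right)
qed

end

section \<open>Quotients\<close>

lemma quotient_algebra_simps [simp]:
  "carrier (quotient_algebra A I) = a_rcosets\<^bsub>A\<^esub> I"
  "Z \<otimes>\<^bsub>quotient_algebra A I\<^esub> Y = Z \<otimes>\<^bsub>A Quot I\<^esub> Y"
  "\<one>\<^bsub>quotient_algebra A I\<^esub> = I +>\<^bsub>A\<^esub> \<one>\<^bsub>A\<^esub>"
  "\<zero>\<^bsub>quotient_algebra A I\<^esub> = I"
  "Z \<oplus>\<^bsub>quotient_algebra A I\<^esub> Y = Z \<oplus>\<^bsub>A Quot I\<^esub> Y"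
  "c \<odot>\<^bsub>quotient_algebra A I\<^esub> Z = (\<Union>x\<in>Z. I +>\<^bsub>A\<^esub> (c \<odot>\<^bsub>A\<^esub> x))"
  by (simp_all add: quotient_algebra_def FactRing_def ring.defs module.defs)

locale K_algebra_ideal = ideal I A for I and A :: "('k::field, 'b) module" +
  assumes K_algebra: "K_algebra A"
begin

sublocale Mod: module "ring_of_type_algebra :: 'k ring" A
  using K_algebra by (simp add: K_algebra_def)

lemma smult_mult:
  "x \<in> carrier A \<Longrightarrow> y \<in> carrier A \<Longrightarrow> (c \<odot>\<^bsub>A\<^esub> x) \<otimes>\<^bsub>A\<^esub> y = c \<odot>\<^bsub>A\<^esub> (x \<otimes>\<^bsub>A\<^esub> y)"
  "x \<in> carrier A \<Longrightarrow> y \<in> carrier A \<Longrightarrow> x \<otimes>\<^bsub>A\<^esub> (c \<odot>\<^bsub>A\<^esub> y) = c \<odot>\<^bsub>A\<^esub> (x \<otimes>\<^bsub>A\<^esub> y)"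
  using K_algebra by (simp_all add: K_algebra_def)

text \<open>\<open>c x\<close> equals \<open>(c 1) x\<close>, so a two-sided ring ideal is
  automatically a subspace.\<close>

lemma smult_in_ideal: "x \<in> I \<Longrightarrow> c \<odot>\<^bsub>A\<^esub> x \<in> I"
  using I_l_closed[of x "c \<odot>\<^bsub>A\<^esub> \<one>\<^bsub>A\<^esub>"] Icarr[of x] Mod.smult_closed[of c] smult_mult(1)[of "\<one>\<^bsub>A\<^esub>" x c] by simp

lemma quotient_add [simp]:
  "x \<in> carrier A \<Longrightarrow> y \<in> carrier A \<Longrightarrow> (I +>\<^bsub>A\<^esub> x) \<oplus>\<^bsub>quotient_algebra A I\<^esub> (I +>\<^bsub>A\<^esub> y) = I +>\<^bsub>A\<^esub> (x \<oplus>\<^bsub>A\<^esub> y)"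
  by (simp add: FactRing_def a_rcos_sum)

lemma quotient_mult [simp]:
  "x \<in> carrier A \<Longrightarrow> y \<in> carrier A \<Longrightarrow> (I +>\<^bsub>A\<^esub> x) \<otimes>\<^bsub>quotient_algebra A I\<^esub> (I +>\<^bsub>A\<^esub> y) = I +>\<^bsub>A\<^esub> (x \<otimes>\<^bsub>A\<^esub> y)"
  by (simp add: FactRing_def rcoset_mult_add)

lemma coset_eq_iff:
  "x \<in> carrier A \<Longrightarrow> y \<in> carrier A \<Longrightarrow> I +>\<^bsub>A\<^esub> x = I +>\<^bsub>A\<^esub> y \<longleftrightarrow> x \<ominus>\<^bsub>A\<^esub> y \<in> I"
  using quotient_eq_iff_same_a_r_cos ideal_axioms by blast

text \<open>The scalar action on cosets is defined as a union over all representatives. Two of them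
  differ by an element of \<open>I\<close>, which scaling keeps in \<open>I\<close>, so all the
  cosets in the union are equal.\<close>

lemma quotient_smult [simp]:
  assumes "x \<in> carrier A" shows "c \<odot>\<^bsub>quotient_algebra A I\<^esub> (I +>\<^bsub>A\<^esub> x) = I +>\<^bsub>A\<^esub> (c \<odot>\<^bsub>A\<^esub> x)"
proof -
  have "I +>\<^bsub>A\<^esub> (c \<odot>\<^bsub>A\<^esub> y) = I +>\<^bsub>A\<^esub> (c \<odot>\<^bsub>A\<^esub> x)" if "y \<in> I +>\<^bsub>A\<^esub> x" for y
  proof -
    have y: "y \<in> carrier A" using that assms a_r_coset_subset_G[OF a_subset] by blast
    have "y \<ominus>\<^bsub>A\<^esub> x \<in> I" 
      using a_repr_independence'[OF that assms] y assms coset_eq_iff by metis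
    then have "c \<odot>\<^bsub>A\<^esub> (y \<ominus>\<^bsub>A\<^esub> x) \<in> I" by (rule smult_in_ideal)
    moreover have "c \<odot>\<^bsub>A\<^esub> (y \<ominus>\<^bsub>A\<^esub> x) = (c \<odot>\<^bsub>A\<^esub> y) \<ominus>\<^bsub>A\<^esub> (c \<odot>\<^bsub>A\<^esub> x)"
      using y assms by (simp add: a_minus_def Mod.smult_r_distr Mod.smult_r_minus)
    ultimately show ?thesis using y assms by (simp add: coset_eq_iff)
  qed
  moreover have "x \<in> I +>\<^bsub>A\<^esub> x" using assms by (rule a_rcos_self)
  ultimately show ?thesis unfolding quotient_algebra_simps by blast
qed

lemma coset_cases:
  assumes "Z \<in> carrier (quotient_algebra A I)"
  obtains x where "x \<in> carrier A" "Z = I +>\<^bsub>A\<^esub> x"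
  using assms by (auto simp: A_RCOSETS_def' )

lemma coset_in_carrier [simp]:
  "x \<in> carrier A \<Longrightarrow> I +>\<^bsub>A\<^esub> x \<in> carrier (quotient_algebra A I)"
  by (auto simp: A_RCOSETS_def')

lemma ring_quotient_algebra: "ring (quotient_algebra A I)"
proof -
  interpret Q: ring "A Quot I" by (rule quotient_is_ring)
  have eqs: "carrier (quotient_algebra A I) = carrier (A Quot I)"
    "\<zero>\<^bsub>quotient_algebra A I\<^esub> = \<zero>\<^bsub>A Quot I\<^esub>" "\<one>\<^bsub>quotient_algebra A I\<^esub> = \<one>\<^bsub>A Quot I\<^esub>"
    "Z \<otimes>\<^bsub>quotient_algebra A I\<^esub> Y = Z \<otimes>\<^bsub>A Quot I\<^esub> Y"
    "Z \<oplus>\<^bsub>quotient_algebra A I\<^esub> Y = Z \<oplus>\<^bsub>A Quot I\<^esub> Y" for Z Y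
    by (simp_all add: FactRing_def)
  show ?thesis
    by (intro ringI abelian_groupI monoidI; unfold eqs)
       (auto simp: Q.a_ac Q.m_assoc Q.l_distr Q.r_distr
         intro: bexI[of _ "\<ominus>\<^bsub>A Quot I\<^esub> _"] Q.l_neg)
qed

lemma K_algebra_quotient: "K_algebra (quotient_algebra A I)"
proof -
  interpret Q: ring "quotient_algebra A I" by (rule ring_quotient_algebra)
  have "module (ring_of_type_algebra :: 'k ring) (quotient_algebra A I)"
    by (intro moduleI cring_from_type_algebra Q.is_abelian_group; elim coset_cases)
       (simp_all add: Mod.smult_l_distr[simplified] Mod.smult_r_distr Mod.smult_assoc1[simplified] Mod.smult_one[simplified]
         del: quotient_algebra_simps)
  then show ?thesis
    unfolding K_algebra_def using ring_quotient_algebra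
    by (auto elim!: coset_cases simp: smult_mult simp del: quotient_algebra_simps)
qed

end

section \<open>Coordinates on an algebra\<close>

text \<open>Functions of finite support on a possibly infinite \<open>N\<close>, because a path
  algebra modulo paths of length two is given coordinates before its dimension is known to be
  finite.\<close>

definition finite_support :: "'b set \<Rightarrow> ('b \<Rightarrow> 'k::field) set" where
  "finite_support N = {f. finite {b. f b \<noteq> 0} \<and> {b. f b \<noteq> 0} \<subseteq> N}"

lemma finite_support_finite: "finite N \<Longrightarrow> finite_support N = {f. \<forall>b. b \<notin> N \<longrightarrow> f b = 0}"
  by (auto simp: finite_support_def intro: finite_subset)

text \<open>A basis of \<open>A\<close> indexed by \<open>N\<close>, given through its coordinate
  map instead of its vectors: equality and existence of elements become statements about
  functions.\<close>

locale coordinates =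
  fixes A :: "('k::field, 'c) module" and N :: "'b set" and \<kappa> :: "'c \<Rightarrow> 'b \<Rightarrow> 'k"
  assumes K_algebra: "K_algebra A"
    and bij: "bij_betw \<kappa> (carrier A) (finite_support N)"
    and coord_add: "x \<in> carrier A \<Longrightarrow> y \<in> carrier A \<Longrightarrow> \<kappa> (x \<oplus>\<^bsub>A\<^esub> y) = (\<lambda>b. \<kappa> x b + \<kappa> y b)"
    and coord_smult: "x \<in> carrier A \<Longrightarrow> \<kappa> (c \<odot>\<^bsub>A\<^esub> x) = (\<lambda>b. c * \<kappa> x b)"
begin

sublocale Alg: ring A
  using K_algebra by (simp add: K_algebra_def)

sublocale Mod: module "ring_of_type_algebra :: 'k ring" A
  using K_algebra by (simp add: K_algebra_def)

lemma smult_carrier [simp, intro]: "x \<in> carrier A \<Longrightarrow> c \<odot>\<^bsub>A\<^esub> x \<in> carrier A"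
  by (rule Mod.smult_closed) simp_all

lemma coord_eqI: "x \<in> carrier A \<Longrightarrow> y \<in> carrier A \<Longrightarrow> (\<And>b. b \<in> N \<Longrightarrow> \<kappa> x b = \<kappa> y b) \<Longrightarrow> x = y"
proof -
  assume *: "x \<in> carrier A" "y \<in> carrier A" "\<And>b. b \<in> N \<Longrightarrow> \<kappa> x b = \<kappa> y b"
  have "\<kappa> x \<in> finite_support N" "\<kappa> y \<in> finite_support N" using bij * by (auto simp: bij_betw_def)
  then have "\<kappa> x = \<kappa> y" using *(3) by (auto simp: finite_support_def fun_eq_iff subset_iff) metis
  then show "x = y" using bij * by (auto simp: bij_betw_def inj_on_def)
qed

lemma coord_outside: "x \<in> carrier A \<Longrightarrow> b \<notin> N \<Longrightarrow> \<kappa> x b = 0"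
  using bij by (auto simp: bij_betw_def finite_support_def)

lemma coord_finite_support: "x \<in> carrier A \<Longrightarrow> \<kappa> x \<in> finite_support N"
  using bij by (auto simp: bij_betw_def)

definition comb :: "('b \<Rightarrow> 'k) \<Rightarrow> 'c" where "comb = inv_into (carrier A) \<kappa>"

lemma comb_carrier [simp, intro]: "f \<in> finite_support N \<Longrightarrow> comb f \<in> carrier A"
  using bij by (auto simp: comb_def bij_betw_def intro: inv_into_into)

lemma coord_comb [simp]: "f \<in> finite_support N \<Longrightarrow> \<kappa> (comb f) = f"
  using bij by (auto simp: comb_def bij_betw_def intro: f_inv_into_f)

definition basis_elem :: "'b \<Rightarrow> 'c" where "basis_elem b = comb (\<lambda>n. if n = b then 1 else 0)"

lemma unit_vector_finite_support: "b \<in> N \<Longrightarrow> (\<lambda>n. if n = b then 1 else 0) \<in> finite_support N"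
  by (auto simp: finite_support_def)

lemma basis_elem_carrier [simp, intro]: "b \<in> N \<Longrightarrow> basis_elem b \<in> carrier A"
  by (simp add: basis_elem_def unit_vector_finite_support)

lemma coord_basis_elem [simp]: "b \<in> N \<Longrightarrow> \<kappa> (basis_elem b) n = (if n = b then 1 else 0)"
  by (simp add: basis_elem_def unit_vector_finite_support)

lemma coord_zero [simp]: "\<kappa> \<zero>\<^bsub>A\<^esub> b = 0"
proof -
  have "\<kappa> \<zero>\<^bsub>A\<^esub> b + \<kappa> \<zero>\<^bsub>A\<^esub> b = \<kappa> \<zero>\<^bsub>A\<^esub> b + 0"
    using fun_cong[OF coord_add[of "\<zero>\<^bsub>A\<^esub>" "\<zero>\<^bsub>A\<^esub>"], of b] by simp
  then show ?thesis by (rule add_left_imp_eq)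
qed

lemma coord_finsum:
  assumes "finite M" "g \<in> M \<rightarrow> carrier A"
  shows "\<kappa> (\<Oplus>\<^bsub>A\<^esub>b\<in>M. g b) n = (\<Sum>b\<in>M. \<kappa> (g b) n)"
  using assms
proof (induction M rule: finite_induct)
  case (insert b M)
  then have "(\<Oplus>\<^bsub>A\<^esub>b\<in>insert b M. g b) = g b \<oplus>\<^bsub>A\<^esub> (\<Oplus>\<^bsub>A\<^esub>b\<in>M. g b)"
    by (intro Alg.finsum_insert) auto
  moreover have "(\<Oplus>\<^bsub>A\<^esub>b\<in>M. g b) \<in> carrier A" using insert by (intro Alg.finsum_closed) auto
  ultimately show ?case using insert by (simp add: coord_add)
qed simp

text \<open>Finitely many generators have finitely many nonzero coordinates between them, and no
  combination of them produces a basis vector outside these.\<close>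

lemma finite_if_fin_dim:
  assumes "fin_dim A" shows "finite N"
proof -
  obtain S where S: "finite S" "S \<subseteq> carrier A"
    "\<And>x. x \<in> carrier A \<Longrightarrow> \<exists>c. x = (\<Oplus>\<^bsub>A\<^esub>s\<in>S. c s \<odot>\<^bsub>A\<^esub> s)"
    using assms unfolding fin_dim_def by blast
  define U where "U = (\<Union>s\<in>S. {b. \<kappa> s b \<noteq> 0})"
  have "finite U"
    using S coord_finite_support by (auto simp: U_def finite_support_def)
  moreover have "N \<subseteq> U"
  proof
    fix b assume b: "b \<in> N"
    obtain c where c: "basis_elem b = (\<Oplus>\<^bsub>A\<^esub>s\<in>S. c s \<odot>\<^bsub>A\<^esub> s)" using S(3) b by blast
    show "b \<in> U"
    proof (rule ccontr)
      assume "b \<notin> U"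
      then have "\<kappa> (basis_elem b) b = 0"
        unfolding c using S by (subst coord_finsum) (auto simp: U_def coord_smult subset_iff intro!: sum.neutral)
      then show False using b by simp
    qed
  qed
  ultimately show ?thesis by (rule finite_subset[rotated])
qed

lemma basis_expand:
  assumes "finite N" "x \<in> carrier A"
  shows "x = (\<Oplus>\<^bsub>A\<^esub>b\<in>N. \<kappa> x b \<odot>\<^bsub>A\<^esub> basis_elem b)"
  using assms
  by (intro coord_eqI Alg.finsum_closed) (auto simp: coord_finsum coord_smult sum.delta' if_distrib cong: if_cong)

lemma inj_on_basis_elem: "inj_on basis_elem N"
proof (rule inj_onI)
  fix b c assume "b \<in> N" "c \<in> N" "basis_elem b = basis_elem c"
  then have "\<kappa> (basis_elem b) b = \<kappa> (basis_elem c) b" by simp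
  then show "b = c" using \<open>b \<in> N\<close> \<open>c \<in> N\<close> by (simp split: if_splits)
qed

lemma fin_dim_if_finite:
  assumes "finite N" shows "fin_dim A"
  unfolding fin_dim_def
proof (intro exI[of _ "basis_elem ` N"] conjI ballI)
  fix x assume x: "x \<in> carrier A"
  define c where "c s = \<kappa> x (inv_into N basis_elem s)" for s
  have "x = (\<Oplus>\<^bsub>A\<^esub>b\<in>N. c (basis_elem b) \<odot>\<^bsub>A\<^esub> basis_elem b)"
    using basis_expand[OF assms x] inj_on_basis_elem
    by (auto simp: c_def inv_into_f_f intro!: Alg.finsum_cong' elim!: trans)
  also have "\<dots> = (\<Oplus>\<^bsub>A\<^esub>s\<in>basis_elem ` N. c s \<odot>\<^bsub>A\<^esub> s)"
    by (rule Alg.finsum_reindex[symmetric]) (auto simp: inj_on_basis_elem)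
  finally show "\<exists>c. x = (\<Oplus>\<^bsub>A\<^esub>s\<in>basis_elem ` N. c s \<odot>\<^bsub>A\<^esub> s)" by blast
qed (use assms in auto)

section \<open>Linear functionals in coordinates\<close>

lemma dual_finsum:
  assumes "f \<in> dual A" "finite M" "g \<in> M \<rightarrow> carrier A"
  shows "f (\<Oplus>\<^bsub>A\<^esub>b\<in>M. g b) = (\<Sum>b\<in>M. f (g b))"
  using assms(2,3)
proof (induction M rule: finite_induct)
  case empty
  have "f (\<zero>\<^bsub>A\<^esub> \<oplus>\<^bsub>A\<^esub> \<zero>\<^bsub>A\<^esub>) = f \<zero>\<^bsub>A\<^esub> + f \<zero>\<^bsub>A\<^esub>" using assms(1) unfolding dual_def by blast
  then have "f \<zero>\<^bsub>A\<^esub> + f \<zero>\<^bsub>A\<^esub> = f \<zero>\<^bsub>A\<^esub> + 0" by simp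
  then have "f \<zero>\<^bsub>A\<^esub> = 0" by (rule add_left_imp_eq)
  then show ?case by simp
next
  case (insert b M)
  then have "(\<Oplus>\<^bsub>A\<^esub>b\<in>insert b M. g b) = g b \<oplus>\<^bsub>A\<^esub> (\<Oplus>\<^bsub>A\<^esub>b\<in>M. g b)"
    by (intro Alg.finsum_insert) auto
  moreover have "(\<Oplus>\<^bsub>A\<^esub>b\<in>M. g b) \<in> carrier A" using insert by (intro Alg.finsum_closed) auto
  ultimately show ?case using insert assms(1) by (simp add: dual_def)
qed

lemma dual_expand:
  assumes "finite N" "f \<in> dual A" "x \<in> carrier A"
  shows "f x = (\<Sum>b\<in>N. \<kappa> x b * f (basis_elem b))"
proof -
  have "f x = f (\<Oplus>\<^bsub>A\<^esub>b\<in>N. \<kappa> x b \<odot>\<^bsub>A\<^esub> basis_elem b)"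
    using basis_expand[OF assms(1,3)] by simp
  also have "\<dots> = (\<Sum>b\<in>N. f (\<kappa> x b \<odot>\<^bsub>A\<^esub> basis_elem b))"
    using assms by (intro dual_finsum) auto
  also have "\<dots> = (\<Sum>b\<in>N. \<kappa> x b * f (basis_elem b))"
    using assms(2) by (intro sum.cong) (auto simp: dual_def)
  finally show ?thesis .
qed

lemma combination_in_dual:
  "(\<lambda>x\<in>carrier A. \<Sum>b\<in>N. \<kappa> x b * g b) \<in> dual A"
  by (auto simp: dual_def coord_add coord_smult ring_distribs sum.distrib sum_distrib_left mult.assoc)

end

text \<open>
  The structure constants of the algebra are zero or one, and \<open>R m n b\<close> says that the coefficient
  of \<open>b\<close> in the product of \<open>m\<close> and \<open>n\<close> is one.
\<close>

locale monomial_algebra = coordinates A N \<kappa>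
  for A :: "('k::field, 'c) module" and N :: "'b set" and \<kappa> +
  fixes R :: "'b \<Rightarrow> 'b \<Rightarrow> 'b \<Rightarrow> bool"
  assumes finite_N: "finite N"
    and coord_mult: "x \<in> carrier A \<Longrightarrow> y \<in> carrier A \<Longrightarrow> b \<in> N \<Longrightarrow>
      \<kappa> (x \<otimes>\<^bsub>A\<^esub> y) b = (\<Sum>m\<in>N. \<Sum>n\<in>N. if R m n b then \<kappa> x m * \<kappa> y n else 0)"
begin

lemma comb_restrict_finite_support: "(\<lambda>b. if b \<in> N then f b else 0) \<in> finite_support N"
  using finite_N by (auto simp: finite_support_def)

text \<open>Serves to rename the labels of a skew-Brauer graph algebra as two copies of those of
  degree zero, the index set on which a trivial extension has its natural coordinates.\<close>

lemma reindex:
  assumes "bij_betw h N' N" "\<And>m n b. m \<in> N' \<Longrightarrow> n \<in> N' \<Longrightarrow> b \<in> N' \<Longrightarrow> R' m n b \<longleftrightarrow> R (h m) (h n) (h b)"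
  shows "monomial_algebra A N' (\<lambda>x b. if b \<in> N' then \<kappa> x (h b) else 0) R'"
proof
  have finite_N': "finite N'" using assms(1) finite_N bij_betw_finite by blast
  show "finite N'" by fact
  show "K_algebra A" by (rule K_algebra)
  show "bij_betw (\<lambda>x b. if b \<in> N' then \<kappa> x (h b) else 0) (carrier A) (finite_support N')"
    unfolding bij_betw_def
  proof (intro conjI inj_onI subset_antisym subsetI)
    fix x y assume xy: "x \<in> carrier A" "y \<in> carrier A"
      "(\<lambda>b. if b \<in> N' then \<kappa> x (h b) else 0) = (\<lambda>b. if b \<in> N' then \<kappa> y (h b) else 0)"
    show "x = y"
    proof (rule coord_eqI)
      fix b assume "b \<in> N"
      then obtain b' where "b' \<in> N'" "b = h b'" using assms(1) by (auto simp: bij_betw_def)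
      then show "\<kappa> x b = \<kappa> y b" using fun_cong[OF xy(3), of b'] by simp
    qed fact+
  next
    fix f :: "_ \<Rightarrow> 'k" assume f: "f \<in> finite_support N'"
    define g where "g b = (if b \<in> N then f (inv_into N' h b) else 0)" for b
    have g: "g \<in> finite_support N" unfolding g_def by (rule comb_restrict_finite_support)
    have "f = (\<lambda>b. if b \<in> N' then \<kappa> (comb g) (h b) else 0)"
    proof
      fix b
      have "b \<in> N' \<Longrightarrow> h b \<in> N \<and> inv_into N' h (h b) = b"
        using assms(1) by (auto simp: bij_betw_def)
      then show "f b = (if b \<in> N' then \<kappa> (comb g) (h b) else 0)"
        using f g by (auto simp: g_def finite_support_def)
    qed
    then show "f \<in> (\<lambda>x b. if b \<in> N' then \<kappa> x (h b) else 0) ` carrier A"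
      using g by blast
  qed (auto simp: finite_support_finite[OF finite_N'])
next
  fix x y b assume xyb: "x \<in> carrier A" "y \<in> carrier A" "b \<in> N'"
  then have "h b \<in> N" using assms(1) by (auto simp: bij_betw_def)
  then have "\<kappa> (x \<otimes>\<^bsub>A\<^esub> y) (h b) = (\<Sum>m\<in>N. \<Sum>n\<in>N. if R m n (h b) then \<kappa> x m * \<kappa> y n else 0)"
    using xyb by (simp add: coord_mult)
  also have "\<dots> = (\<Sum>m\<in>N'. \<Sum>n\<in>N'. if R (h m) (h n) (h b) then \<kappa> x (h m) * \<kappa> y (h n) else 0)"
    by (simp flip: sum.reindex_bij_betw[OF assms(1)])
  also have "\<dots> = (\<Sum>m\<in>N'. \<Sum>n\<in>N'.
      if R' m n b then (if m \<in> N' then \<kappa> x (h m) else 0) * (if n \<in> N' then \<kappa> y (h n) else 0) else 0)"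
    using assms(2) xyb by (intro sum.cong refl) auto
  finally show "(if b \<in> N' then \<kappa> (x \<otimes>\<^bsub>A\<^esub> y) (h b) else 0) = (\<Sum>m\<in>N'. \<Sum>n\<in>N'.
      if R' m n b then (if m \<in> N' then \<kappa> x (h m) else 0) * (if n \<in> N' then \<kappa> y (h n) else 0) else 0)"
    using xyb(3) by simp
qed (auto simp: coord_add coord_smult fun_eq_iff)

end

text \<open>Of \<open>A\<close> only closure under the operations and a left unit are assumed; the
  ring laws hold in \<open>B\<close> and are carried over by the coordinates. Hence the trivial
  extension need not be shown to be a ring beforehand.\<close>

lemma algebra_isoI:
  fixes A :: "('k::field, 'c) module" and B :: "('k, 'd) module"
  assumes "monomial_algebra B N \<kappa>' R" "finite N"
    and bij: "bij_betw \<kappa> (carrier A) (finite_support N)"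
    and add: "\<And>x y. x \<in> carrier A \<Longrightarrow> y \<in> carrier A \<Longrightarrow>
      x \<oplus>\<^bsub>A\<^esub> y \<in> carrier A \<and> \<kappa> (x \<oplus>\<^bsub>A\<^esub> y) = (\<lambda>b. \<kappa> x b + \<kappa> y b)"
    and smult: "\<And>c x. x \<in> carrier A \<Longrightarrow> c \<odot>\<^bsub>A\<^esub> x \<in> carrier A \<and> \<kappa> (c \<odot>\<^bsub>A\<^esub> x) = (\<lambda>b. c * \<kappa> x b)"
    and mult: "\<And>x y. x \<in> carrier A \<Longrightarrow> y \<in> carrier A \<Longrightarrow> x \<otimes>\<^bsub>A\<^esub> y \<in> carrier A"
      "\<And>x y b. x \<in> carrier A \<Longrightarrow> y \<in> carrier A \<Longrightarrow> b \<in> N \<Longrightarrow>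
      \<kappa> (x \<otimes>\<^bsub>A\<^esub> y) b = (\<Sum>m\<in>N. \<Sum>n\<in>N. if R m n b then \<kappa> x m * \<kappa> y n else 0)"
    and one: "\<one>\<^bsub>A\<^esub> \<in> carrier A" "\<And>x. x \<in> carrier A \<Longrightarrow> \<one>\<^bsub>A\<^esub> \<otimes>\<^bsub>A\<^esub> x = x"
  shows "algebra_iso A B"
proof -
  interpret B: monomial_algebra B N \<kappa>' R by fact
  define \<phi> where "\<phi> x = B.comb (\<kappa> x)" for x
  have fs: "\<kappa> x \<in> finite_support N" if "x \<in> carrier A" for x
    using bij that by (auto simp: bij_betw_def)
  have \<phi>: "\<phi> x \<in> carrier B" "\<kappa>' (\<phi> x) = \<kappa> x" if "x \<in> carrier A" for x
    using fs[OF that] by (simp_all add: \<phi>_def)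
  have bij\<phi>: "bij_betw \<phi> (carrier A) (carrier B)"
    using bij_betw_trans[OF bij bij_betw_inv_into[OF B.bij]]
    by (simp add: \<phi>_def[abs_def] B.comb_def comp_def)
  have mult\<phi>: "\<phi> (x \<otimes>\<^bsub>A\<^esub> y) = \<phi> x \<otimes>\<^bsub>B\<^esub> \<phi> y" if "x \<in> carrier A" "y \<in> carrier A" for x y
    using that by (intro B.coord_eqI) (simp_all add: \<phi> mult B.coord_mult cong: if_cong)
  have "\<phi> \<one>\<^bsub>A\<^esub> = \<one>\<^bsub>B\<^esub>"
  proof -
    \<comment> \<open>By surjectivity the unit of \<open>B\<close> is an image, so the image of the
      left unit of \<open>A\<close> fixes it and must be the unit itself.\<close>
    obtain u where u: "u \<in> carrier A" "\<phi> u = \<one>\<^bsub>B\<^esub>"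
      using bij_betw_imp_surj_on[OF bij\<phi>] B.Alg.one_closed by (metis imageE)
    have "\<phi> \<one>\<^bsub>A\<^esub> \<otimes>\<^bsub>B\<^esub> \<phi> u = \<phi> u" using mult\<phi>[OF one(1) u(1)] one(2)[OF u(1)] by simp
    then show ?thesis using \<phi>(1)[OF one(1)] by (simp add: u)
  qed
  moreover have "\<phi> (x \<oplus>\<^bsub>A\<^esub> y) = \<phi> x \<oplus>\<^bsub>B\<^esub> \<phi> y" if "x \<in> carrier A" "y \<in> carrier A" for x y
    using that by (intro B.coord_eqI) (simp_all add: \<phi> add B.coord_add)
  ultimately have "\<phi> \<in> ring_iso A B"
    using mult\<phi> \<phi> bij\<phi> by (auto intro!: ring_iso_memI)
  moreover have "\<phi> (c \<odot>\<^bsub>A\<^esub> x) = c \<odot>\<^bsub>B\<^esub> \<phi> x" if "x \<in> carrier A" for c x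
    using that by (intro B.coord_eqI) (simp_all add: \<phi> smult B.coord_smult)
  ultimately show ?thesis unfolding algebra_iso_def by blast
qed

context monomial_algebra begin

text \<open>The bilinear form for which \<open>b\<close> and \<open>d b\<close> run through dual
  bases identifies \<open>A\<close> with \<open>dual A\<close>. In its terms \<open>R l m n\<close>
  says that the associated trilinear form is one on \<open>l\<close>, \<open>m\<close>,
  \<open>d n\<close>, and \<open>cyclic\<close> is its invariance under rotation; this is
  compatibility with both module structures.\<close>

lemma symmetric_algebraI:
  assumes d: "\<And>m. m \<in> N \<Longrightarrow> d m \<in> N" "\<And>m. m \<in> N \<Longrightarrow> d (d m) = m"
    and cyclic: "\<And>l m n. l \<in> N \<Longrightarrow> m \<in> N \<Longrightarrow> n \<in> N \<Longrightarrow> R l m n \<Longrightarrow> R (d n) l (d m)"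
  shows "symmetric_algebra A"
proof -
  have bij_d: "bij_betw d N N"
    by (rule bij_betw_byWitness[of _ d]) (auto simp: d)
  \<comment> \<open>Three rotations are the identity because \<open>d\<close> is an involution, so
    the implication is an equivalence.\<close>
  have cyclic1: "R l m n \<longleftrightarrow> R (d n) l (d m)" if "l \<in> N" "m \<in> N" "n \<in> N" for l m n
  proof
    assume "R (d n) l (d m)"
    then have "R m (d n) (d l)" using cyclic[of "d n" l "d m"] that d by simp
    then have "R (d (d l)) m (d (d n))" using cyclic[of m "d n" "d l"] that d by simp
    then show "R l m n" using that d by simp
  qed (use cyclic that in blast)
  have cyclic2: "R m l n \<longleftrightarrow> R l (d n) (d m)" if "l \<in> N" "m \<in> N" "n \<in> N" for l m n
    using cyclic1[of m l n] cyclic1[of "d n" m "d l"] that d by simp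
  define \<phi> where "\<phi> x = (\<lambda>y\<in>carrier A. \<Sum>b\<in>N. \<kappa> y b * \<kappa> x (d b))" for x
  have \<phi>_eq: "\<phi> x y = (\<Sum>b\<in>N. \<kappa> y (d b) * \<kappa> x b)" if "y \<in> carrier A" for x y
    using that by (subst sum.reindex_bij_betw[OF bij_d, symmetric]) (auto simp: \<phi>_def d intro!: sum.cong)
  have \<phi>_basis: "\<phi> x (basis_elem b) = \<kappa> x (d b)" if "b \<in> N" for x b
    using that finite_N by (simp add: \<phi>_def if_distrib[where f = "\<lambda>x. x * _"] sum.delta cong: if_cong)
  have "bij_betw \<phi> (carrier A) (dual A)"
    unfolding bij_betw_def
  proof (intro conjI inj_onI subset_antisym subsetI)
    fix x y assume xy: "x \<in> carrier A" "y \<in> carrier A" "\<phi> x = \<phi> y"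
    show "x = y"
    proof (rule coord_eqI[OF xy(1,2)])
      fix b assume "b \<in> N"
      then show "\<kappa> x b = \<kappa> y b" using \<phi>_basis[of "d b"] xy(3) d by metis
    qed
  next
    fix f assume f: "f \<in> dual A"
    \<comment> \<open>The coordinate of the preimage at \<open>m\<close> is the value of
      \<open>f\<close> at the basis vector paired with \<open>m\<close>.\<close>
    define x where "x = comb (\<lambda>m. if m \<in> N then f (basis_elem (d m)) else 0)"
    have "\<phi> x = f"
    proof
      fix y show "\<phi> x y = f y"
      proof (cases "y \<in> carrier A")
        case True
        then show ?thesis
          by (subst dual_expand[OF finite_N f True])
             (auto simp: \<phi>_def x_def comb_restrict_finite_support d intro!: sum.cong)
      qed (use f in \<open>auto simp: \<phi>_def dual_def extensional_def\<close>)
    qed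
    moreover have "x \<in> carrier A" unfolding x_def by (intro comb_carrier comb_restrict_finite_support)
    ultimately show "f \<in> \<phi> ` carrier A" by blast
  qed (auto simp: \<phi>_def combination_in_dual)
  moreover have "\<phi> (x \<oplus>\<^bsub>A\<^esub> y) = dual_add A (\<phi> x) (\<phi> y)" if "x \<in> carrier A" "y \<in> carrier A" for x y
    using that by (auto simp: \<phi>_def dual_add_def coord_add ring_distribs sum.distrib)
  moreover have "\<phi> (c \<odot>\<^bsub>A\<^esub> x) = dual_smult A c (\<phi> x)" if "x \<in> carrier A" for c x
    using that by (auto simp: \<phi>_def dual_smult_def coord_smult sum_distrib_left mult.left_commute)
  \<comment> \<open>For the form this is the identity (a x, y) = (x, y a); rotating the structure
    constants turns one triple sum into the other.\<close>
  moreover have "\<phi> (a \<otimes>\<^bsub>A\<^esub> x) = dual_left A a (\<phi> x)" if "a \<in> carrier A" "x \<in> carrier A" for a x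
  proof
    fix y show "\<phi> (a \<otimes>\<^bsub>A\<^esub> x) y = dual_left A a (\<phi> x) y"
    proof (cases "y \<in> carrier A")
      case True
      have "\<phi> (a \<otimes>\<^bsub>A\<^esub> x) y =
          (\<Sum>n\<in>N. \<Sum>l\<in>N. \<Sum>m\<in>N. if R l m n then \<kappa> y (d n) * (\<kappa> a l * \<kappa> x m) else 0)"
        using that True by (simp add: \<phi>_eq coord_mult sum_distrib_left if_distrib cong: if_cong)
      also have "\<dots> = (\<Sum>m\<in>N. \<Sum>n\<in>N. \<Sum>l\<in>N. if R l m n then \<kappa> y (d n) * (\<kappa> a l * \<kappa> x m) else 0)"
        by (rule trans[OF sum.cong[OF refl sum.swap] sum.swap])
      also have "\<dots> = (\<Sum>m\<in>N. \<Sum>n\<in>N. \<Sum>l\<in>N. if R (d n) l (d m) then (\<kappa> y (d n) * \<kappa> a l) * \<kappa> x m else 0)"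
        by (intro sum.cong refl) (simp add: cyclic1 mult.assoc)
      also have "\<dots> = (\<Sum>m\<in>N. \<Sum>n\<in>N. \<Sum>l\<in>N. if R n l (d m) then (\<kappa> y n * \<kappa> a l) * \<kappa> x m else 0)"
        by (rule sum.cong[OF refl]) (rule sum.reindex_bij_betw[OF bij_d])
      also have "\<dots> = \<phi> x (y \<otimes>\<^bsub>A\<^esub> a)"
        using that True
        by (simp add: \<phi>_eq coord_mult d sum_distrib_right if_distrib[where f = "\<lambda>u. u * _"] cong: if_cong)
      finally show ?thesis using True by (simp add: dual_left_def)
    qed (simp add: \<phi>_def dual_left_def)
  qed
  moreover have "\<phi> (x \<otimes>\<^bsub>A\<^esub> a) = dual_right A (\<phi> x) a" if "a \<in> carrier A" "x \<in> carrier A" for a x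
  proof
    fix y show "\<phi> (x \<otimes>\<^bsub>A\<^esub> a) y = dual_right A (\<phi> x) a y"
    proof (cases "y \<in> carrier A")
      case True
      have "\<phi> (x \<otimes>\<^bsub>A\<^esub> a) y =
          (\<Sum>n\<in>N. \<Sum>m\<in>N. \<Sum>l\<in>N. if R m l n then \<kappa> y (d n) * (\<kappa> x m * \<kappa> a l) else 0)"
        using that True by (simp add: \<phi>_eq coord_mult sum_distrib_left if_distrib cong: if_cong)
      also have "\<dots> = (\<Sum>m\<in>N. \<Sum>n\<in>N. \<Sum>l\<in>N. if R m l n then \<kappa> y (d n) * (\<kappa> x m * \<kappa> a l) else 0)"
        by (rule sum.swap)
      also have "\<dots> = (\<Sum>m\<in>N. \<Sum>n\<in>N. \<Sum>l\<in>N. if R l (d n) (d m) then (\<kappa> a l * \<kappa> y (d n)) * \<kappa> x m else 0)"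
        by (intro sum.cong refl) (simp add: cyclic2 ac_simps)
      also have "\<dots> = (\<Sum>m\<in>N. \<Sum>n\<in>N. \<Sum>l\<in>N. if R l n (d m) then (\<kappa> a l * \<kappa> y n) * \<kappa> x m else 0)"
        by (rule sum.cong[OF refl]) (rule sum.reindex_bij_betw[OF bij_d])
      also have "\<dots> = (\<Sum>m\<in>N. \<Sum>l\<in>N. \<Sum>n\<in>N. if R l n (d m) then (\<kappa> a l * \<kappa> y n) * \<kappa> x m else 0)"
        by (rule sum.cong[OF refl]) (rule sum.swap)
      also have "\<dots> = \<phi> x (a \<otimes>\<^bsub>A\<^esub> y)"
        using that True
        by (simp add: \<phi>_eq coord_mult d sum_distrib_right if_distrib[where f = "\<lambda>u. u * _"] cong: if_cong)
      finally show ?thesis using True by (simp add: dual_right_def)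
    qed (simp add: \<phi>_def dual_right_def)
  qed
  ultimately show ?thesis unfolding symmetric_algebra_def by (intro exI[of _ \<phi>]) auto
qed

end

section \<open>Trivial extensions\<close>

text \<open>\<open>Inl b\<close> stands for a basis element and \<open>Inr b\<close> for the
  functional dual to it. The element \<open>m\<close> times the functional of \<open>n\<close>,
  evaluated at \<open>l\<close>, is the coefficient of \<open>n\<close> in \<open>l m\<close>; on
  the other side it is the coefficient of \<open>m\<close> in \<open>n l\<close>. Two functionals
  multiply to zero.\<close>

fun trivial_extension_rel :: "('b \<Rightarrow> 'b \<Rightarrow> 'b \<Rightarrow> bool) \<Rightarrow> 'b + 'b \<Rightarrow> 'b + 'b \<Rightarrow> 'b + 'b \<Rightarrow> bool" where
  "trivial_extension_rel R (Inl m) (Inl n) (Inl b) = R m n b"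
| "trivial_extension_rel R (Inl m) (Inr n) (Inr l) = R l m n"
| "trivial_extension_rel R (Inr m) (Inl n) (Inr l) = R n l m"
| "trivial_extension_rel R _ _ _ = False"

lemma trivial_extension_simps [simp]:
  "carrier (trivial_extension A) = carrier A \<times> dual A"
  "(a, f) \<otimes>\<^bsub>trivial_extension A\<^esub> (b, g) = (a \<otimes>\<^bsub>A\<^esub> b, dual_add A (dual_left A a g) (dual_right A f b))"
  "\<one>\<^bsub>trivial_extension A\<^esub> = (\<one>\<^bsub>A\<^esub>, \<lambda>x \<in> carrier A. 0)"
  "(a, f) \<oplus>\<^bsub>trivial_extension A\<^esub> (b, g) = (a \<oplus>\<^bsub>A\<^esub> b, dual_add A f g)"
  "c \<odot>\<^bsub>trivial_extension A\<^esub> (a, f) = (c \<odot>\<^bsub>A\<^esub> a, dual_smult A c f)"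
  by (simp_all add: trivial_extension_def)

context monomial_algebra begin

lemma alg_smult_mult:
  "x \<in> carrier A \<Longrightarrow> y \<in> carrier A \<Longrightarrow> (c \<odot>\<^bsub>A\<^esub> x) \<otimes>\<^bsub>A\<^esub> y = c \<odot>\<^bsub>A\<^esub> (x \<otimes>\<^bsub>A\<^esub> y)"
  "x \<in> carrier A \<Longrightarrow> y \<in> carrier A \<Longrightarrow> x \<otimes>\<^bsub>A\<^esub> (c \<odot>\<^bsub>A\<^esub> y) = c \<odot>\<^bsub>A\<^esub> (x \<otimes>\<^bsub>A\<^esub> y)"
  using K_algebra by (simp_all add: K_algebra_def)

lemma dual_closed:
  "f \<in> dual A \<Longrightarrow> g \<in> dual A \<Longrightarrow> dual_add A f g \<in> dual A"
  "f \<in> dual A \<Longrightarrow> dual_smult A c f \<in> dual A"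
  "f \<in> dual A \<Longrightarrow> a \<in> carrier A \<Longrightarrow> dual_left A a f \<in> dual A"
  "f \<in> dual A \<Longrightarrow> a \<in> carrier A \<Longrightarrow> dual_right A f a \<in> dual A"
  by (auto simp: dual_def dual_add_def dual_smult_def dual_left_def dual_right_def ring_distribs
      Alg.l_distr Alg.r_distr alg_smult_mult)

lemma zero_dual: "(\<lambda>x\<in>carrier A. 0) \<in> dual A"
  by (auto simp: dual_def)

text \<open>The coordinates of a functional are its values on the basis; the guard makes them vanish
  outside \<open>N\<close>, where \<open>basis_elem\<close> gives no basis vector.\<close>

definition ext_coord :: "'c \<times> ('c \<Rightarrow> 'k) \<Rightarrow> 'b + 'b \<Rightarrow> 'k" where
  "ext_coord z s = (case s of Inl b \<Rightarrow> \<kappa> (fst z) b | Inr b \<Rightarrow> if b \<in> N then snd z (basis_elem b) else 0)"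

lemma ext_coord_simps [simp]:
  "ext_coord (a, f) (Inl b) = \<kappa> a b"
  "ext_coord (a, f) (Inr b) = (if b \<in> N then f (basis_elem b) else 0)"
  by (simp_all add: ext_coord_def)

lemma bij_betw_ext_coord: "bij_betw ext_coord (carrier A \<times> dual A) (finite_support (N <+> N))"
  unfolding bij_betw_def
proof (intro conjI inj_onI subset_antisym subsetI)
  fix z w assume zw: "z \<in> carrier A \<times> dual A" "w \<in> carrier A \<times> dual A" "ext_coord z = ext_coord w"
  obtain a f b g where [simp]: "z = (a, f)" "w = (b, g)" by (cases z, cases w)
  have "a = b"
  proof (rule coord_eqI)
    show "\<kappa> a n = \<kappa> b n" for n using fun_cong[OF zw(3), of "Inl n"] by simp
  qed (use zw in auto)
  moreover have "f = g"
  proof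
    fix x
    have "f (basis_elem n) = g (basis_elem n)" if "n \<in> N" for n
      using fun_cong[OF zw(3), of "Inr n"] that by simp
    then have "f x = g x" if "x \<in> carrier A"
      using zw that by (simp add: dual_expand[OF finite_N, of _ x])
    then show "f x = g x" using zw by (cases "x \<in> carrier A") (auto simp: dual_def extensional_def)
  qed
  ultimately show "z = w" by simp
next
  fix F :: "'b + 'b \<Rightarrow> 'k" assume F: "F \<in> finite_support (N <+> N)"
  then have F0: "F s = 0" if "s \<notin> N <+> N" for s using that by (auto simp: finite_support_def)
  define a where "a = comb (\<lambda>b. if b \<in> N then F (Inl b) else 0)"
  define f where "f = (\<lambda>x\<in>carrier A. \<Sum>b\<in>N. \<kappa> x b * F (Inr b))"
  have "\<kappa> a = (\<lambda>b. if b \<in> N then F (Inl b) else 0)"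
    unfolding a_def by (intro coord_comb comb_restrict_finite_support)
  moreover have "f (basis_elem b) = F (Inr b)" if "b \<in> N" for b
    using that finite_N by (simp add: f_def if_distrib[where f = "\<lambda>x. x * _"] sum.delta cong: if_cong)
  ultimately have "ext_coord (a, f) s = F s" for s
    using F0[of s] by (cases s) (auto simp: Plus_def)
  then have "F = ext_coord (a, f)" by (auto simp: fun_eq_iff)
  moreover have "(a, f) \<in> carrier A \<times> dual A"
    by (auto simp: f_def a_def combination_in_dual intro!: comb_carrier comb_restrict_finite_support)
  ultimately show "F \<in> ext_coord ` (carrier A \<times> dual A)" by blast
next
  fix F assume "F \<in> ext_coord ` (carrier A \<times> dual A)"
  then obtain a f where F: "a \<in> carrier A" "F = ext_coord (a, f)" by auto
  have "F s = 0" if "s \<notin> N <+> N" for s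
    using that F coord_outside by (cases s) auto
  then show "F \<in> finite_support (N <+> N)" using finite_N by (simp add: finite_support_finite)
qed

text \<open>These values are the coordinates at \<open>Inr l\<close> of the mixed products in the
  trivial extension, where the element is moved into the argument of the functional.\<close>

lemma dual_mult_basis_elem:
  assumes "f \<in> dual A" "a \<in> carrier A" "l \<in> N"
  shows "f (basis_elem l \<otimes>\<^bsub>A\<^esub> a) = (\<Sum>m\<in>N. \<Sum>n\<in>N. if R l m n then \<kappa> a m * f (basis_elem n) else 0)"
    and "f (a \<otimes>\<^bsub>A\<^esub> basis_elem l) = (\<Sum>m\<in>N. \<Sum>n\<in>N. if R m l n then \<kappa> a m * f (basis_elem n) else 0)"
proof -
  have "\<kappa> (basis_elem l \<otimes>\<^bsub>A\<^esub> a) n = (\<Sum>m\<in>N. if R l m n then \<kappa> a m else 0)" if "n \<in> N" for n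
  proof -
    have "\<kappa> (basis_elem l \<otimes>\<^bsub>A\<^esub> a) n = (\<Sum>k\<in>N. if k = l then (\<Sum>m\<in>N. if R l m n then \<kappa> a m else 0) else 0)"
      using assms that by (simp add: coord_mult cong: if_cong) (intro sum.cong refl, auto cong: if_cong)
    then show ?thesis using assms finite_N by simp
  qed
  then have "f (basis_elem l \<otimes>\<^bsub>A\<^esub> a) = (\<Sum>n\<in>N. \<Sum>m\<in>N. if R l m n then \<kappa> a m * f (basis_elem n) else 0)"
    using assms by (subst dual_expand[OF finite_N]) (auto simp: sum_distrib_right intro!: sum.cong)
  then show "f (basis_elem l \<otimes>\<^bsub>A\<^esub> a) = (\<Sum>m\<in>N. \<Sum>n\<in>N. if R l m n then \<kappa> a m * f (basis_elem n) else 0)"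
    by (subst sum.swap)
  have "\<kappa> (a \<otimes>\<^bsub>A\<^esub> basis_elem l) n = (\<Sum>m\<in>N. if R m l n then \<kappa> a m else 0)" if "n \<in> N" for n
  proof -
    have "\<kappa> (a \<otimes>\<^bsub>A\<^esub> basis_elem l) n = (\<Sum>m\<in>N. \<Sum>k\<in>N. if k = l then (if R m l n then \<kappa> a m else 0) else 0)"
      using assms that by (simp add: coord_mult cong: if_cong) (intro sum.cong refl, auto cong: if_cong)
    then show ?thesis using assms finite_N by simp
  qed
  then have "f (a \<otimes>\<^bsub>A\<^esub> basis_elem l) = (\<Sum>n\<in>N. \<Sum>m\<in>N. if R m l n then \<kappa> a m * f (basis_elem n) else 0)"
    using assms by (subst dual_expand[OF finite_N]) (auto simp: sum_distrib_right intro!: sum.cong)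
  then show "f (a \<otimes>\<^bsub>A\<^esub> basis_elem l) = (\<Sum>m\<in>N. \<Sum>n\<in>N. if R m l n then \<kappa> a m * f (basis_elem n) else 0)"
    by (subst sum.swap)
qed

lemma trivial_extension_isoI:
  assumes B: "monomial_algebra B (N <+> N) \<kappa>' (trivial_extension_rel R)"
  shows "algebra_iso (trivial_extension A) B"
proof (rule algebra_isoI[OF B])
  show "bij_betw ext_coord (carrier (trivial_extension A)) (finite_support (N <+> N))"
    by (simp add: bij_betw_ext_coord)
  show "finite (N <+> N)" using finite_N by simp
next
  fix z w assume zw: "z \<in> carrier (trivial_extension A)" "w \<in> carrier (trivial_extension A)"
  obtain a f b g where [simp]: "z = (a, f)" "w = (b, g)" by (cases z, cases w)
  note [simp] = dual_closed
  have afbg: "a \<in> carrier A" "f \<in> dual A" "b \<in> carrier A" "g \<in> dual A" using zw by auto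
  have "ext_coord (z \<oplus>\<^bsub>trivial_extension A\<^esub> w) s = ext_coord z s + ext_coord w s" for s
    using zw by (cases s) (auto simp: coord_add dual_add_def)
  then show "z \<oplus>\<^bsub>trivial_extension A\<^esub> w \<in> carrier (trivial_extension A) \<and>
      ext_coord (z \<oplus>\<^bsub>trivial_extension A\<^esub> w) = (\<lambda>s. ext_coord z s + ext_coord w s)"
    using zw by auto
  show "z \<otimes>\<^bsub>trivial_extension A\<^esub> w \<in> carrier (trivial_extension A)"
    using zw by auto
  fix s assume "s \<in> N <+> N"
  then consider (l) l where "l \<in> N" "s = Inl l" | (r) l where "l \<in> N" "s = Inr l" by auto
  then show "ext_coord (z \<otimes>\<^bsub>trivial_extension A\<^esub> w) s = (\<Sum>m\<in>N <+> N. \<Sum>n\<in>N <+> N.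
      if trivial_extension_rel R m n s then ext_coord z m * ext_coord w n else 0)"
  proof cases
    case l
    then show ?thesis using afbg finite_N by (simp add: sum.Plus coord_mult cong: if_cong)
  next
    case r
    have "ext_coord (z \<otimes>\<^bsub>trivial_extension A\<^esub> w) s = g (basis_elem l \<otimes>\<^bsub>A\<^esub> a) + f (b \<otimes>\<^bsub>A\<^esub> basis_elem l)"
      using r by (simp add: dual_add_def dual_left_def dual_right_def)
    also have "\<dots> = (\<Sum>m\<in>N. \<Sum>n\<in>N. if R l m n then \<kappa> a m * g (basis_elem n) else 0) +
        (\<Sum>n\<in>N. \<Sum>m\<in>N. if R m l n then \<kappa> b m * f (basis_elem n) else 0)"
      using r afbg by (subst (2) sum.swap) (simp add: dual_mult_basis_elem)
    finally show ?thesis using r finite_N by (simp add: sum.Plus mult.commute cong: sum.cong if_cong)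
  qed
next
  fix c z assume z: "z \<in> carrier (trivial_extension A)"
  obtain a f where [simp]: "z = (a, f)" by (cases z)
  have "ext_coord (c \<odot>\<^bsub>trivial_extension A\<^esub> z) s = c * ext_coord z s" for s
    using z by (cases s) (auto simp: coord_smult dual_smult_def)
  then show "c \<odot>\<^bsub>trivial_extension A\<^esub> z \<in> carrier (trivial_extension A) \<and>
      ext_coord (c \<odot>\<^bsub>trivial_extension A\<^esub> z) = (\<lambda>s. c * ext_coord z s)"
    using z dual_closed(2) by auto
  have "dual_add A (dual_left A \<one>\<^bsub>A\<^esub> f) (dual_right A (\<lambda>x\<in>carrier A. 0) a) = f"
    using z by (auto simp: dual_add_def dual_left_def dual_right_def dual_def extensional_def fun_eq_iff)
  then show "\<one>\<^bsub>trivial_extension A\<^esub> \<otimes>\<^bsub>trivial_extension A\<^esub> z = z"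
    using z by simp
qed (simp add: zero_dual)

end

text \<open>\<open>d\<close> exchanges the degrees zero and one, so \<open>N\<close> consists of the
  labels of degree zero and their partners. By rotation, \<open>d b\<close> multiplies with elements
  of degree zero exactly as the functional dual to \<open>b\<close> does.\<close>

lemma trivial_extension_of_degree_zero_part:
  assumes B: "monomial_algebra B N \<kappa>' R"
    and A: "monomial_algebra A {b \<in> N. gr b = (0::nat)} \<kappa> R'"
    and R': "\<And>m n b. m \<in> N \<Longrightarrow> n \<in> N \<Longrightarrow> b \<in> N \<Longrightarrow> gr m = 0 \<Longrightarrow> gr n = 0 \<Longrightarrow> gr b = 0 \<Longrightarrow> R' m n b \<longleftrightarrow> R m n b"
    and d: "\<And>m. m \<in> N \<Longrightarrow> d m \<in> N" "\<And>m. m \<in> N \<Longrightarrow> d (d m) = m"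
    and cyclic: "\<And>l m n. l \<in> N \<Longrightarrow> m \<in> N \<Longrightarrow> n \<in> N \<Longrightarrow> R l m n \<Longrightarrow> R (d n) l (d m)"
    and gr_d: "\<And>m. m \<in> N \<Longrightarrow> gr m + gr (d m) = 1"
    and gr: "\<And>l m n. l \<in> N \<Longrightarrow> m \<in> N \<Longrightarrow> n \<in> N \<Longrightarrow> R l m n \<Longrightarrow> gr n = gr l + gr m"
  shows "algebra_iso (trivial_extension A) B"
proof -
  let ?N0 = "{b \<in> N. gr b = 0}"
  interpret A: monomial_algebra A ?N0 \<kappa> R' by fact
  have cyclic1: "R l m n \<longleftrightarrow> R (d n) l (d m)" if "l \<in> N" "m \<in> N" "n \<in> N" for l m n
  proof
    assume "R (d n) l (d m)"
    then have "R m (d n) (d l)" using cyclic[of "d n" l "d m"] that d by simp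
    then have "R (d (d l)) m (d (d n))" using cyclic[of m "d n" "d l"] that d by simp
    then show "R l m n" using that d by simp
  qed (use cyclic that in blast)
  have cyclic2: "R l m n \<longleftrightarrow> R m (d n) (d l)" if "l \<in> N" "m \<in> N" "n \<in> N" for l m n
    using cyclic1[of l m n] cyclic1[of "d n" l "d m"] that d by simp
  \<comment> \<open>\<open>Inl b\<close> goes to the label \<open>b\<close> of degree zero,
    \<open>Inr b\<close> to its partner of degree one.\<close>
  define h where "h = case_sum id d"
  have deg_le: "gr m \<le> 1" if "m \<in> N" for m using gr_d[OF that] by simp
  have gr_d': "gr (d m) = 1 - gr m" if "m \<in> N" for m using gr_d[OF that] by simp
  have h: "bij_betw h (?N0 <+> ?N0) N"
  proof (rule bij_betw_byWitness[of _ "\<lambda>b. if gr b = 0 then Inl b else Inr (d b)"])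
    show "(\<lambda>b. if gr b = 0 then Inl b else Inr (d b)) ` N \<subseteq> ?N0 <+> ?N0"
      using d gr_d' deg_le by (force simp: le_Suc_eq)
  qed (auto simp: h_def d gr_d')
  have rel: "trivial_extension_rel R' m n b \<longleftrightarrow> R (h m) (h n) (h b)"
    if mnb: "m \<in> ?N0 <+> ?N0" "n \<in> ?N0 <+> ?N0" "b \<in> (?N0 <+> ?N0)" for m n b
  proof -
    \<comment> \<open>Combinations absent from \<open>trivial_extension_rel\<close> are excluded by
      the degree; in particular two labels of degree one would need a product of degree two.\<close>
    have no: "\<not> R k l j" if "k \<in> N" "l \<in> N" "j \<in> N" "gr j \<noteq> gr k + gr l" for k l j
      using gr that by blast
    have k1: "R' l m n \<longleftrightarrow> R m (d n) (d l)" and k2: "R' n l m \<longleftrightarrow> R (d m) n (d l)"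
      if "l \<in> ?N0" "m \<in> ?N0" "n \<in> ?N0" for l m n
      using that R' cyclic2[of l m n] cyclic1[of n l m] by auto
    show ?thesis
    proof (cases m)
      case m: (Inl m')
      show ?thesis
      proof (cases n)
        case (Inl n')
        then show ?thesis using m mnb by (cases b) (auto simp: Plus_def h_def R' no d gr_d')
      next
        case (Inr n')
        then show ?thesis using m mnb by (cases b) (auto simp: Plus_def h_def k1 no d gr_d')
      qed
    next
      case m: (Inr m')
      show ?thesis
      proof (cases n)
        case (Inl n')
        then show ?thesis using m mnb by (cases b) (auto simp: Plus_def h_def k2 no d gr_d')
      next
        case (Inr n')
        then show ?thesis using m mnb by (cases b) (auto simp: Plus_def h_def no d gr_d')
      qed
    qed
  qed
  show ?thesis
    by (rule A.trivial_extension_isoI[OF monomial_algebra.reindex[OF B h rel]])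
qed

section \<open>Normal forms of paths\<close>

text \<open>
  \<open>nf\<close> assigns to a path its class, with \<open>None\<close> for the paths that vanish. The axioms say that the
  relations only identify paths with each other or with zero.
\<close>

locale path_normal_form = fin_digraph G for G :: "('a, 'b) pre_digraph" (structure) +
  fixes rels :: "(('a, 'b) path \<Rightarrow>\<^sub>0 'k::field) set"
    and nf :: "('a, 'b) path \<Rightarrow> 'n option" and mul :: "'n \<Rightarrow> 'n \<Rightarrow> 'n option"
  assumes rels_carrier: "r \<in> rels \<Longrightarrow> Poly_Mapping.keys r \<subseteq> quiver_paths G"
    and rels_kernel: "r \<in> rels \<Longrightarrow>
      (\<Sum>p\<in>Poly_Mapping.keys r. if nf p = Some b then Poly_Mapping.lookup r p else 0) = 0"
    and nf_mul: "p \<in> quiver_paths G \<Longrightarrow> q \<in> quiver_paths G \<Longrightarrow> nf p = Some m \<Longrightarrow> nf q = Some n \<Longrightarrow>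
      mul m n = (if pre_digraph.awalk G (fst p) (snd p) (fst q) then nf (fst p, snd p @ snd q) else None)"
    and nf_zero: "p \<in> quiver_paths G \<Longrightarrow> q \<in> quiver_paths G \<Longrightarrow> nf p = None \<or> nf q = None \<Longrightarrow>
      pre_digraph.awalk G (fst p) (snd p) (fst q) \<Longrightarrow> nf (fst p, snd p @ snd q) = None"
    and zero_path: "p \<in> quiver_paths G \<Longrightarrow> nf p = None \<Longrightarrow>
      Poly_Mapping.single p 1 \<in> genideal (path_algebra G) rels"
    and equal_paths: "p \<in> quiver_paths G \<Longrightarrow> q \<in> quiver_paths G \<Longrightarrow> nf p = Some b \<Longrightarrow> nf q = Some b \<Longrightarrow>
      Poly_Mapping.single p 1 - Poly_Mapping.single q 1 \<in> genideal (path_algebra G) rels"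
begin

definition path_classes :: "'n set" where
  "path_classes = {b. \<exists>p\<in>quiver_paths G. nf p = Some b}"

abbreviation "PA \<equiv> path_algebra G :: ('k, ('a, 'b) path \<Rightarrow>\<^sub>0 'k) module"
abbreviation "J \<equiv> genideal PA rels"

definition coeff :: "(('a, 'b) path \<Rightarrow>\<^sub>0 'k) \<Rightarrow> 'n \<Rightarrow> 'k" where
  "coeff f b = (\<Sum>p\<in>Poly_Mapping.keys f. if nf p = Some b then Poly_Mapping.lookup f p else 0)"

lemma coeff_superset:
  "finite M \<Longrightarrow> Poly_Mapping.keys f \<subseteq> M \<Longrightarrow>
   coeff f b = (\<Sum>p\<in>M. if nf p = Some b then Poly_Mapping.lookup f p else 0)"
  unfolding coeff_def by (intro sum.mono_neutral_left) (auto simp: in_keys_iff)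

lemma coeff_add: "coeff (f + g) b = coeff f b + coeff g b"
  using keys_add[of f g]
  by (simp add: coeff_superset[of "Poly_Mapping.keys f \<union> Poly_Mapping.keys g"] lookup_add flip: sum.distrib)
     (intro sum.cong, auto simp: lookup_add)

lemma coeff_smult: "coeff (Poly_Mapping.map ((*) c) f) b = c * coeff f b"
  by (simp add: coeff_superset[of "Poly_Mapping.keys f"] keys_smult_subset lookup_smult sum_distrib_left
      if_distrib cong: if_cong)

lemma coeff_zero [simp]: "coeff 0 b = 0"
  by (simp add: coeff_def)

lemma coeff_sum: "coeff (\<Sum>i\<in>M. F i) b = (\<Sum>i\<in>M. coeff (F i) b)"
  by (induction M rule: infinite_finite_induct) (simp_all add: coeff_add)

lemma coeff_diff: "coeff (f - g) b = coeff f b - coeff g b"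
  using coeff_add[of "f - g" g b] by simp

lemma coeff_single: "coeff (Poly_Mapping.single p c) b = (if nf p = Some b then c else 0)"
  by (simp add: coeff_superset[of "{p}"])

lemma finite_coeff: "finite {b. coeff f b \<noteq> 0}"
proof (rule finite_subset)
  show "{b. coeff f b \<noteq> 0} \<subseteq> (the \<circ> nf) ` Poly_Mapping.keys f"
  proof
    fix b assume b: "b \<in> {b. coeff f b \<noteq> 0}"
    obtain p where "p \<in> Poly_Mapping.keys f" "nf p = Some b"
    proof (rule ccontr)
      assume "\<not> thesis"
      then have "\<forall>p\<in>Poly_Mapping.keys f. nf p \<noteq> Some b" using that by blast
      then have "coeff f b = 0" by (simp add: coeff_def)
      then show False using b by simp
    qed
    then show "b \<in> (the \<circ> nf) ` Poly_Mapping.keys f" by force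
  qed
qed simp

lemma coeff_outside: "f \<in> carrier PA \<Longrightarrow> b \<notin> path_classes \<Longrightarrow> coeff f b = 0"
  unfolding coeff_def path_classes_def by (intro sum.neutral) auto

lemma coeff_path_prod:
  assumes "p \<in> quiver_paths G" "q \<in> quiver_paths G" "finite M"
    and M: "\<And>b. nf p = Some b \<Longrightarrow> b \<in> M" "\<And>b. nf q = Some b \<Longrightarrow> b \<in> M"
  shows "coeff (path_prod G p q (c * d)) b =
    (\<Sum>m\<in>M. \<Sum>n\<in>M. if mul m n = Some b then (if nf p = Some m then c else 0) * (if nf q = Some n then d else 0) else 0)"
proof (cases "nf p = None \<or> nf q = None")
  case True
  then have "coeff (path_prod G p q (c * d)) b = 0"
    using nf_zero[OF assms(1,2)] by (auto simp: path_prod_def coeff_single)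
  moreover have "(\<Sum>m\<in>M. \<Sum>n\<in>M. if mul m n = Some b then (if nf p = Some m then c else 0) * (if nf q = Some n then d else 0) else 0) = 0"
    using True by (intro sum.neutral ballI) auto
  ultimately show ?thesis by simp
next
  case False
  then obtain m n where mn: "nf p = Some m" "nf q = Some n" by auto
  have "(\<Sum>m'\<in>M. \<Sum>n'\<in>M. if mul m' n' = Some b then (if nf p = Some m' then c else 0) * (if nf q = Some n' then d else 0) else 0)
     = (\<Sum>m'\<in>M. \<Sum>n'\<in>M. if n' = n then (if m' = m then (if mul m n = Some b then c * d else 0) else 0) else 0)"
    using mn by (intro sum.cong refl) auto
  also have "\<dots> = (if mul m n = Some b then c * d else 0)"
    using assms mn by (simp add: sum.delta)
  finally show ?thesis
    using nf_mul[OF assms(1,2) mn] by (auto simp: path_prod_def coeff_single)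
qed

text \<open>The coefficients of a product depend bilinearly on those of its factors, because
  \<open>mul\<close> computes the class of a product from the classes of the factors. The finite set
  \<open>M\<close> stands in for \<open>path_classes\<close>, which can be infinite.\<close>

lemma coeff_path_mult:
  assumes f: "f \<in> carrier PA" "g \<in> carrier PA" and "finite M"
    and M: "\<And>p b. p \<in> Poly_Mapping.keys f \<union> Poly_Mapping.keys g \<Longrightarrow> nf p = Some b \<Longrightarrow> b \<in> M"
  shows "coeff (path_mult G f g) b = (\<Sum>m\<in>M. \<Sum>n\<in>M. if mul m n = Some b then coeff f m * coeff g n else 0)"
proof -
  let ?F = "\<lambda>p m. if nf p = Some m then Poly_Mapping.lookup f p else 0"
  let ?G = "\<lambda>q n. if nf q = Some n then Poly_Mapping.lookup g q else 0"
  let ?f = "Poly_Mapping.keys f" and ?g = "Poly_Mapping.keys g"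
  have "coeff (path_mult G f g) b = (\<Sum>p\<in>?f. \<Sum>q\<in>?g. coeff (path_prod G p q (Poly_Mapping.lookup f p * Poly_Mapping.lookup g q)) b)"
    by (simp add: path_mult_superset[of ?f f ?g g] coeff_sum)
  also have "\<dots> = (\<Sum>p\<in>?f. \<Sum>q\<in>?g. \<Sum>m\<in>M. \<Sum>n\<in>M. if mul m n = Some b then ?F p m * ?G q n else 0)"
  proof (intro sum.cong refl coeff_path_prod)
    fix p q assume pq: "p \<in> ?f" "q \<in> ?g"
    then show "p \<in> quiver_paths G" "q \<in> quiver_paths G" using f by auto
    show "b \<in> M" if "nf p = Some b" for b using M[OF _ that] pq by blast
    show "b \<in> M" if "nf q = Some b" for b using M[OF _ that] pq by blast
  qed (rule \<open>finite M\<close>)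
  also have "\<dots> = (\<Sum>p\<in>?f. \<Sum>m\<in>M. \<Sum>q\<in>?g. \<Sum>n\<in>M. if mul m n = Some b then ?F p m * ?G q n else 0)"
    by (rule sum.cong[OF refl]) (rule sum.swap)
  also have "\<dots> = (\<Sum>m\<in>M. \<Sum>p\<in>?f. \<Sum>q\<in>?g. \<Sum>n\<in>M. if mul m n = Some b then ?F p m * ?G q n else 0)"
    by (rule sum.swap)
  also have "\<dots> = (\<Sum>m\<in>M. \<Sum>p\<in>?f. \<Sum>n\<in>M. \<Sum>q\<in>?g. if mul m n = Some b then ?F p m * ?G q n else 0)"
    by (rule sum.cong[OF refl], rule sum.cong[OF refl]) (rule sum.swap)
  also have "\<dots> = (\<Sum>m\<in>M. \<Sum>n\<in>M. \<Sum>p\<in>?f. \<Sum>q\<in>?g. if mul m n = Some b then ?F p m * ?G q n else 0)"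
    by (rule sum.cong[OF refl]) (rule sum.swap)
  also have "\<dots> = (\<Sum>m\<in>M. \<Sum>n\<in>M. if mul m n = Some b then coeff f m * coeff g n else 0)"
    unfolding coeff_def sum_product by (intro sum.cong refl) simp
  finally show ?thesis .
qed

section \<open>The ideal of relations as a kernel\<close>

definition kernel :: "(('a, 'b) path \<Rightarrow>\<^sub>0 'k) set" where
  "kernel = {f \<in> carrier PA. \<forall>b. coeff f b = 0}"

lemma ring_PA: "ring PA" by (rule ring_path_algebra)

text \<open>Each coefficient of a product is a sum of terms with a coefficient of \<open>f\<close>
  as a factor, all of which vanish.\<close>

lemma ideal_kernel: "ideal kernel PA"
proof (rule idealI[OF ring_PA])
  show "subgroup kernel (add_monoid PA)"
  proof
    fix f assume f: "f \<in> kernel"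
    then have "inv\<^bsub>add_monoid PA\<^esub> f = - f"
      by (intro group.inv_equality abelian_group.a_group ring.is_abelian_group ring_PA)
         (auto simp: kernel_def in_keys_iff)
    then show "inv\<^bsub>add_monoid PA\<^esub> f \<in> kernel"
      using f coeff_diff[of 0 f] by (auto simp: kernel_def in_keys_iff)
  next
    fix f g assume "f \<in> kernel" "g \<in> kernel"
    then show "f \<otimes>\<^bsub>add_monoid PA\<^esub> g \<in> kernel"
      using keys_add[of f g] by (auto simp: kernel_def coeff_add)
  qed (auto simp: kernel_def)
next
  fix f g assume fg: "f \<in> kernel" "g \<in> carrier PA"
  \<comment> \<open>The classes met by the two supports; \<open>the None\<close> may slip in as a
    harmless extra index.\<close>
  let ?M = "(the \<circ> nf) ` (Poly_Mapping.keys f \<union> Poly_Mapping.keys g)"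
  have M: "b \<in> ?M" if "p \<in> Poly_Mapping.keys f \<union> Poly_Mapping.keys g" "nf p = Some b" for p b
    using that by force
  have "coeff (path_mult G g f) b = 0" for b
    using fg by (subst coeff_path_mult[of g f ?M, OF _ _ _ M]) (auto simp: kernel_def intro!: sum.neutral)
  then show "g \<otimes>\<^bsub>PA\<^esub> f \<in> kernel"
    using fg path_mult_carrier[of g f] by (simp add: kernel_def)
  have "coeff (path_mult G f g) b = 0" for b
    using fg by (subst coeff_path_mult[of f g ?M, OF _ _ _ M]) (auto simp: kernel_def intro!: sum.neutral)
  then show "f \<otimes>\<^bsub>PA\<^esub> g \<in> kernel"
    using fg path_mult_carrier[of f g] by (simp add: kernel_def)
qed

lemma ideal_J: "ideal J PA"
  using rels_carrier by (intro ring.genideal_ideal ring_PA) auto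

sublocale J: K_algebra_ideal J PA
  using ideal_J K_algebra_path_algebra by (simp add: K_algebra_ideal_def K_algebra_ideal_axioms_def)

lemma J_add: "f \<in> J \<Longrightarrow> g \<in> J \<Longrightarrow> f + g \<in> J"
  using additive_subgroup.a_closed[OF J.additive_subgroup_axioms] by simp

lemma J_smult: "f \<in> J \<Longrightarrow> Poly_Mapping.map ((*) c) f \<in> J"
  using J.smult_in_ideal by simp

lemma J_sum: "(\<And>i. i \<in> M \<Longrightarrow> F i \<in> J) \<Longrightarrow> (\<Sum>i\<in>M. F i) \<in> J"
  using additive_subgroup.zero_closed[OF J.additive_subgroup_axioms] by (induction M rule: infinite_finite_induct) (auto intro: J_add)

text \<open>One inclusion is minimality of the generated ideal. For the other, modulo
  \<open>J\<close> each path is zero or equal to a chosen representative of its class, so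
  \<open>f\<close> becomes the combination of representatives with coefficients
  \<open>coeff f b\<close>, which all vanish.\<close>

lemma genideal_eq_kernel: "J = kernel"
proof
  show "J \<subseteq> kernel"
    using rels_carrier rels_kernel
    by (intro ring.genideal_minimal ring_PA ideal_kernel) (auto simp: kernel_def coeff_def)
next
  show "kernel \<subseteq> J"
  proof
    fix f assume f: "f \<in> kernel"
    define rep where "rep b = (SOME p. p \<in> quiver_paths G \<and> nf p = Some b)" for b
    have rep: "rep b \<in> quiver_paths G" "nf (rep b) = Some b" if "p \<in> quiver_paths G" "nf p = Some b" for p b
      using someI[of "\<lambda>p. p \<in> quiver_paths G \<and> nf p = Some b" p] that by (auto simp: rep_def)
    let ?f = "Poly_Mapping.lookup f" and ?M = "(the \<circ> nf) ` Poly_Mapping.keys f"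
    define red where "red p = (case nf p of None \<Rightarrow> 0 | Some b \<Rightarrow> Poly_Mapping.single (rep b) (?f p))" for p
    have "f = (\<Sum>p\<in>Poly_Mapping.keys f. Poly_Mapping.single p (?f p))"
      by (rule poly_mapping_expand) auto
    also have "\<dots> = (\<Sum>p\<in>Poly_Mapping.keys f. Poly_Mapping.single p (?f p) - red p) + (\<Sum>p\<in>Poly_Mapping.keys f. red p)"
      by (simp flip: sum.distrib)
    also have "(\<Sum>p\<in>Poly_Mapping.keys f. red p) =
        (\<Sum>p\<in>Poly_Mapping.keys f. \<Sum>b\<in>?M. if nf p = Some b then Poly_Mapping.single (rep b) (?f p) else 0)"
    proof (rule sum.cong[OF refl])
      fix p assume p: "p \<in> Poly_Mapping.keys f"
      show "red p = (\<Sum>b\<in>?M. if nf p = Some b then Poly_Mapping.single (rep b) (?f p) else 0)"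
      proof (cases "nf p")
        case (Some b)
        then have "b \<in> ?M" using p by force
        then show ?thesis using Some by (simp add: red_def sum.delta)
      qed (simp add: red_def)
    qed
    also have "\<dots> = (\<Sum>b\<in>?M. \<Sum>p\<in>Poly_Mapping.keys f. if nf p = Some b then Poly_Mapping.single (rep b) (?f p) else 0)"
      by (rule sum.swap)
    also have "\<dots> = (\<Sum>b\<in>?M. Poly_Mapping.single (rep b) (coeff f b))"
    proof (rule sum.cong[OF refl])
      fix b
      have "Poly_Mapping.single (rep b) (\<Sum>p\<in>M. u p) = (\<Sum>p\<in>M. Poly_Mapping.single (rep b) (u p))"
        for M and u :: "('a, 'b) path \<Rightarrow> 'k"
        by (induction M rule: infinite_finite_induct) (auto simp: single_add)
      then show "(\<Sum>p\<in>Poly_Mapping.keys f. if nf p = Some b then Poly_Mapping.single (rep b) (?f p) else 0) =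
          Poly_Mapping.single (rep b) (coeff f b)"
        by (simp add: coeff_def if_distrib[where f = "Poly_Mapping.single (rep b)"] cong: if_cong)
    qed
    also have "\<dots> = 0" using f by (simp add: kernel_def)
    finally have "f = (\<Sum>p\<in>Poly_Mapping.keys f. Poly_Mapping.single p (?f p) - red p)" by simp
    also have "\<dots> \<in> J"
    proof (rule J_sum)
      fix p assume "p \<in> Poly_Mapping.keys f"
      then have p: "p \<in> quiver_paths G" using f by (auto simp: kernel_def)
      let ?e = "case nf p of None \<Rightarrow> 0 | Some b \<Rightarrow> Poly_Mapping.single (rep b) (1 :: 'k)"
      have "Poly_Mapping.single p 1 - ?e \<in> J"
        using zero_path[OF p] equal_paths[OF p] rep[OF p] by (auto split: option.split)
      then have "Poly_Mapping.map ((*) (?f p)) (Poly_Mapping.single p 1 - ?e) \<in> J"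
        by (rule J_smult)
      moreover have "Poly_Mapping.map ((*) (?f p)) (Poly_Mapping.single p 1 - ?e) = Poly_Mapping.single p (?f p) - red p"
        by (rule poly_mapping_eqI)
           (auto simp: lookup_smult lookup_minus red_def lookup_single when_def split: option.split)
      ultimately show "Poly_Mapping.single p (?f p) - red p \<in> J" by simp
    qed
    finally show "f \<in> J" .
  qed
qed

text \<open>An arbitrary representative will do: elements of one coset have equal coefficients
  because \<open>J\<close> is the kernel.\<close>

definition class_coeff :: "(('a, 'b) path \<Rightarrow>\<^sub>0 'k) set \<Rightarrow> 'n \<Rightarrow> 'k" where
  "class_coeff Y = coeff (SOME f. f \<in> carrier PA \<and> Y = J +>\<^bsub>PA\<^esub> f)"

lemma PA_minus: "f \<in> carrier PA \<Longrightarrow> g \<in> carrier PA \<Longrightarrow> f \<ominus>\<^bsub>PA\<^esub> g = f - g"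
proof -
  assume fg: "f \<in> carrier PA" "g \<in> carrier PA"
  have "\<ominus>\<^bsub>PA\<^esub> g = - g"
    using fg J.minus_equality[of "- g" g] by (simp add: subset_iff in_keys_iff)
  then show ?thesis by (simp add: a_minus_def)
qed

lemma coset_eq_iff_coeff:
  assumes "f \<in> carrier PA" "g \<in> carrier PA"
  shows "J +>\<^bsub>PA\<^esub> f = J +>\<^bsub>PA\<^esub> g \<longleftrightarrow> coeff f = coeff g"
proof -
  have "f - g \<in> carrier PA" using assms J.minus_closed[of f g] PA_minus by simp
  then have "f - g \<in> kernel \<longleftrightarrow> coeff f = coeff g"
    by (auto simp: kernel_def coeff_diff fun_eq_iff)
  then show ?thesis
    using assms J.coset_eq_iff[OF assms] PA_minus[OF assms] genideal_eq_kernel by simp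
qed

lemma class_coeff_coset [simp]:
  assumes "f \<in> carrier PA" shows "class_coeff (J +>\<^bsub>PA\<^esub> f) = coeff f"
proof -
  let ?P = "\<lambda>g. g \<in> carrier PA \<and> J +>\<^bsub>PA\<^esub> f = J +>\<^bsub>PA\<^esub> g"
  have P: "?P (Eps ?P)" by (rule someI[of ?P f]) (use assms in blast)
  have "coeff f = coeff (Eps ?P)"
    using coset_eq_iff_coeff[OF assms conjunct1[OF P]] conjunct2[OF P] by (rule iffD1)
  then show ?thesis unfolding class_coeff_def by (rule sym)
qed

lemma coordinates: "coordinates (bound_quiver_algebra G rels) path_classes class_coeff"
  unfolding bound_quiver_algebra_def
proof
  show "K_algebra (quotient_algebra PA J)" by (rule J.K_algebra_quotient)
  show "bij_betw class_coeff (carrier (quotient_algebra PA J)) (finite_support path_classes)"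
    unfolding bij_betw_def
  proof (intro conjI inj_onI)
    fix x y assume "x \<in> carrier (quotient_algebra PA J)" "y \<in> carrier (quotient_algebra PA J)"
      and eq: "class_coeff x = class_coeff y"
    then obtain f g where fg: "f \<in> carrier PA" "g \<in> carrier PA"
      and xy: "x = J +>\<^bsub>PA\<^esub> f" "y = J +>\<^bsub>PA\<^esub> g"
      by (elim J.coset_cases)
    have "coeff f = coeff g" using eq unfolding xy class_coeff_coset[OF fg(1)] class_coeff_coset[OF fg(2)] .
    then show "x = y" unfolding xy by (rule iffD2[OF coset_eq_iff_coeff[OF fg]])
  next
    show "class_coeff ` carrier (quotient_algebra PA J) = finite_support path_classes"
    proof (intro subset_antisym subsetI)
    fix c :: "'n \<Rightarrow> 'k" assume c: "c \<in> finite_support path_classes"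
    \<comment> \<open>The preimage of \<open>c\<close> is a combination of one chosen path per
      class.\<close>
    have "\<forall>b\<in>path_classes. \<exists>p. p \<in> quiver_paths G \<and> nf p = Some b"
      by (auto simp: path_classes_def)
    then obtain rep where "\<forall>b\<in>path_classes. rep b \<in> quiver_paths G \<and> nf (rep b) = Some b"
      using bchoice by meson
    then have rep: "rep b \<in> quiver_paths G" "nf (rep b) = Some b" if "b \<in> path_classes" for b
      using that by auto
    define f where "f = (\<Sum>b | c b \<noteq> 0. Poly_Mapping.single (rep b) (c b))"
    have cb: "b \<in> path_classes" if "c b \<noteq> 0" for b
      using c that by (auto simp: finite_support_def)
    have "Poly_Mapping.keys f \<subseteq> quiver_paths G"
      unfolding f_def by (rule keys_sum_subset) (simp add: rep(1) cb)
    then have f: "f \<in> carrier PA" by simp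
    have "coeff f = c"
    proof
      fix b
      have "coeff f b = (\<Sum>b' | c b' \<noteq> 0. if b' = b then c b' else 0)"
        unfolding f_def coeff_sum by (rule sum.cong[OF refl]) (simp add: coeff_single rep(2) cb)
      then show "coeff f b = c b" using c by (simp add: finite_support_def)
    qed
    then have "c = class_coeff (J +>\<^bsub>PA\<^esub> f)" using f by simp
    then show "c \<in> class_coeff ` carrier (quotient_algebra PA J)"
      using f J.coset_in_carrier by blast
    next
      fix c assume "c \<in> class_coeff ` carrier (quotient_algebra PA J)"
      then obtain f where "f \<in> carrier PA" "c = coeff f"
        by (auto elim!: J.coset_cases simp del: quotient_algebra_simps path_algebra_simps)
      then show "c \<in> finite_support path_classes"
        using coeff_outside[of f] finite_coeff[of f] by (auto simp: finite_support_def)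
    qed
  qed
next
  fix x y assume "x \<in> carrier (quotient_algebra PA J)" "y \<in> carrier (quotient_algebra PA J)"
  then show "class_coeff (x \<oplus>\<^bsub>quotient_algebra PA J\<^esub> y) = (\<lambda>b. class_coeff x b + class_coeff y b)"
    using J.a_closed
    by (elim J.coset_cases) (simp add: coeff_add keys_add[THEN subset_trans] fun_eq_iff del: quotient_algebra_simps)
next
  fix c x assume "x \<in> carrier (quotient_algebra PA J)"
  then show "class_coeff (c \<odot>\<^bsub>quotient_algebra PA J\<^esub> x) = (\<lambda>b. c * class_coeff x b)"
    by (elim J.coset_cases)
       (simp add: coeff_smult keys_smult_subset[THEN subset_trans] fun_eq_iff del: quotient_algebra_simps)
qed

lemma monomial_algebra:
  assumes "finite path_classes"
  shows "monomial_algebra (bound_quiver_algebra G rels) path_classes class_coeff (\<lambda>m n b. mul m n = Some b)"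
proof (intro monomial_algebra.intro monomial_algebra_axioms.intro coordinates assms)
  fix x y b
  assume "x \<in> carrier (bound_quiver_algebra G rels)" "y \<in> carrier (bound_quiver_algebra G rels)"
  then obtain f g where fg: "f \<in> carrier PA" "g \<in> carrier PA" "x = J +>\<^bsub>PA\<^esub> f" "y = J +>\<^bsub>PA\<^esub> g"
    unfolding bound_quiver_algebra_def by (elim J.coset_cases)
  have "coeff (path_mult G f g) b = (\<Sum>m\<in>path_classes. \<Sum>n\<in>path_classes. if mul m n = Some b then coeff f m * coeff g n else 0)"
    using fg by (intro coeff_path_mult assms) (auto simp: path_classes_def)
  moreover have "path_mult G f g \<in> carrier PA" using fg path_mult_carrier by simp
  ultimately show "class_coeff (x \<otimes>\<^bsub>bound_quiver_algebra G rels\<^esub> y) b =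
      (\<Sum>m\<in>path_classes. \<Sum>n\<in>path_classes. if mul m n = Some b then class_coeff x m * class_coeff y n else 0)"
    unfolding bound_quiver_algebra_def fg(3,4) using fg(1,2)
    by (simp add: J.quotient_mult del: quotient_algebra_simps path_algebra_simps(1) cong: if_cong)
qed

end

section \<open>Walks in the split quiver\<close>

lemma sg_quiver_simps [simp]:
  "verts (sg_quiver Q S) = {(x, e). x \<in> verts Q \<and> e \<in> signs S x}"
  "arcs (sg_quiver Q S) = {(e, a, e'). a \<in> arcs Q \<and> e \<in> signs S (tail Q a) \<and> e' \<in> signs S (head Q a)}"
  "tail (sg_quiver Q S) (e, a, e') = (tail Q a, e)"
  "head (sg_quiver Q S) (e, a, e') = (head Q a, e')"
  by (simp_all add: sg_quiver_def)

lemma underlying_simp [simp]: "underlying (e, a, e') = a"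
  by (simp add: underlying_def)

lemma finite_signs [simp]: "finite (signs S x)"
  by (simp add: signs_def)

lemma signs_nonempty: "\<exists>e. e \<in> signs S x"
  by (auto simp: signs_def)

lemma fin_digraph_sg_quiver:
  assumes "fin_digraph Q" shows "fin_digraph (sg_quiver Q S)"
proof -
  interpret fin_digraph Q by fact
  have "finite (SIGMA x : verts Q. signs S x)" by simp
  moreover have "verts (sg_quiver Q S) = (SIGMA x : verts Q. signs S x)" by auto
  moreover have "arcs (sg_quiver Q S) \<subseteq> (\<Union>a\<in>arcs Q. \<Union>e\<in>signs S (tail Q a). \<Union>e'\<in>signs S (head Q a). {(e, a, e')})"
    by auto
  then have "finite (arcs (sg_quiver Q S))" by (rule finite_subset) simp
  ultimately show ?thesis
    by unfold_locales auto
qed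

lemma (in wf_digraph) awalk_Cons_iff':
  "awalk u (a # p) w \<longleftrightarrow> a \<in> arcs G \<and> tail G a = u \<and> awalk (head G a) p w"
  by (auto simp: awalk_def)

lemma (in wf_digraph) awalk_snoc_iff:
  "awalk u (p @ [a]) w \<longleftrightarrow> a \<in> arcs G \<and> awalk u p (tail G a) \<and> head G a = w"
  by (induction p arbitrary: u) (auto simp: awalk_Cons_iff' awalk_def)

locale path_ideal = fin_digraph G + K_algebra_ideal I "path_algebra G"
  for G :: "('a, 'b) pre_digraph" (structure) and I :: "(('a, 'b) path \<Rightarrow>\<^sub>0 'k::field) set"
begin

lemma I_add: "f \<in> I \<Longrightarrow> g \<in> I \<Longrightarrow> f + g \<in> I"
  using additive_subgroup.a_closed[OF additive_subgroup_axioms] by simp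

lemma I_diff:
  assumes "f \<in> I" "g \<in> I" shows "f - g \<in> I"
proof -
  have "Poly_Mapping.map ((*) (- 1)) g \<in> I" using smult_in_ideal[OF assms(2), of "- 1"] by simp
  moreover have "Poly_Mapping.map ((*) (- 1)) g = - g"
    by (rule poly_mapping_eqI) (simp add: lookup_smult)
  ultimately show ?thesis using I_add[OF assms(1), of "- g"] by simp
qed

lemma zero_in_I: "0 \<in> I"
  using additive_subgroup.zero_closed[OF additive_subgroup_axioms] by simp

lemma single_carrier: "awalk u p v \<Longrightarrow> Poly_Mapping.single (u, p) c \<in> carrier (path_algebra G :: ('k, _) module)"
  by (auto simp: quiver_paths_def)

lemma zero_path_append:
  assumes "path_elem v q \<in> I" "awalk u p v" shows "path_elem u (p @ q) \<in> I"
proof -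
  have "path_mult G (path_elem u p) (path_elem v q) \<in> I"
    using I_l_closed[OF assms(1) single_carrier[OF assms(2), of 1]] by (simp add: path_elem_def)
  then show ?thesis using assms(2) by (simp add: path_elem_def path_mult_single path_prod_def)
qed

lemma zero_path_prepend:
  assumes "path_elem u p \<in> I" "awalk u p v" "awalk v q w" shows "path_elem u (p @ q) \<in> I"
proof -
  have "path_mult G (path_elem u p) (path_elem v q) \<in> I"
    using I_r_closed[OF assms(1) single_carrier[OF assms(3), of 1]] by (simp add: path_elem_def)
  then show ?thesis using assms(2) by (simp add: path_elem_def path_mult_single path_prod_def)
qed

lemma zero_path_infix:
  assumes "path_elem v q \<in> I" "awalk u (p @ q @ r) w" "awalk u p v" shows "path_elem u (p @ q @ r) \<in> I"
proof -
  have "awalk v (q @ r) w" using assms awalk_append_conv by blast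
  then obtain z where "awalk v q z" "awalk z r w" by (auto simp: awalk_append_iff)
  then have "path_elem v (q @ r) \<in> I" using assms zero_path_prepend by blast
  then show ?thesis using assms zero_path_append by blast
qed

definition path_cong :: "'a \<Rightarrow> 'b list \<Rightarrow> 'b list \<Rightarrow> bool" where
  "path_cong u p q \<longleftrightarrow> path_elem u p - path_elem u q \<in> I"

lemma path_cong_refl [simp]: "path_cong u p p"
  by (simp add: path_cong_def zero_in_I)

lemma path_cong_trans [trans]: "path_cong u p q \<Longrightarrow> path_cong u q r \<Longrightarrow> path_cong u p r"
  unfolding path_cong_def using I_add[of "path_elem u p - path_elem u q" "path_elem u q - path_elem u r"] by simp

lemma path_cong_sym: "path_cong u p q \<Longrightarrow> path_cong u q p"
  unfolding path_cong_def using I_diff[OF zero_in_I, of "path_elem u p - path_elem u q"] by simp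

lemma path_cong_zero: "path_cong u p q \<Longrightarrow> path_elem u q \<in> I \<Longrightarrow> path_elem u p \<in> I"
  unfolding path_cong_def using I_add[of "path_elem u p - path_elem u q" "path_elem u q"] by simp

lemma path_mult_diff:
  "path_mult G f (g - h) = path_mult G f g - path_mult G f h"
  "path_mult G (g - h) f = path_mult G g f - path_mult G h f"
  using path_mult_add_right[of G f "g - h" h] path_mult_add_left[of G "g - h" h f] by simp_all

lemma path_cong_append:
  assumes "path_cong v q r" "awalk u p v" shows "path_cong u (p @ q) (p @ r)"
proof -
  have "path_mult G (path_elem u p) (path_elem v q - path_elem v r) \<in> I"
    using I_l_closed[OF assms(1)[unfolded path_cong_def] single_carrier[OF assms(2), of 1]]
    by (simp add: path_elem_def)
  then show ?thesis
    using assms(2) by (simp add: path_elem_def path_mult_single path_prod_def path_mult_diff path_cong_def)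
qed

lemma path_cong_prepend:
  assumes "path_cong u p q" "awalk u p v" "awalk u q v" "awalk v r w" shows "path_cong u (p @ r) (q @ r)"
proof -
  have "path_mult G (path_elem u p - path_elem u q) (path_elem v r) \<in> I"
    using I_r_closed[OF assms(1)[unfolded path_cong_def] single_carrier[OF assms(4), of 1]]
    by (simp add: path_elem_def)
  then show ?thesis
    using assms by (simp add: path_elem_def path_mult_single path_prod_def path_mult_diff path_cong_def)
qed

end

locale split_path_ideal = Q: fin_digraph Q + path_ideal "sg_quiver Q S" I
  for Q :: "('v, 'a) pre_digraph" and S and I :: "(('v \<times> sign, 'a signed_arrow) path \<Rightarrow>\<^sub>0 'k::field) set" +
  assumes commutativity: "commutativity_relations Q S \<subseteq> I"
begin

abbreviation "sgwalk \<equiv> pre_digraph.awalk (sg_quiver Q S)"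

lemma sgwalk_Nil [simp]: "sgwalk u [] w \<longleftrightarrow> u = w \<and> fst u \<in> verts Q \<and> snd u \<in> signs S (fst u)"
  by (auto simp: pre_digraph.awalk_def pre_digraph.cas.simps split: prod.splits)

lemma sgwalk_Cons [simp]: "sgwalk u ((e, a, e') # p) w \<longleftrightarrow>
  a \<in> arcs Q \<and> u = (tail Q a, e) \<and> e \<in> signs S (tail Q a) \<and> e' \<in> signs S (head Q a) \<and> sgwalk (head Q a, e') p w"
  by (auto simp: awalk_Cons_iff')

text \<open>The start fixes the first sign and the end the last, so two lifts of one walk differ
  only in signs at special vertices strictly inside it. There an arrow arrives and an arrow leaves,
  and a commutativity relation exchanges the sign. The walks are aligned from the left.\<close>

lemma path_cong_if_same_underlying:
  assumes "sgwalk u p w" "sgwalk u q w" "map underlying p = map underlying q"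
  shows "path_cong u p q"
  using assms
proof (induction p arbitrary: u q)
  case (Cons \<alpha> p)
  obtain e a s where \<alpha>: "\<alpha> = (e, a, s)" by (cases \<alpha>)
  obtain \<alpha>' q' where q: "q = \<alpha>' # q'" using Cons.prems by (cases q) auto
  then obtain s' where \<alpha>': "\<alpha>' = (e, a, s')" using Cons.prems \<alpha> by (cases \<alpha>') auto
  have u: "u = (tail Q a, e)" "a \<in> arcs Q" "e \<in> signs S (tail Q a)" "s \<in> signs S (head Q a)" "s' \<in> signs S (head Q a)"
    and p: "sgwalk (head Q a, s) p w" and q': "sgwalk (head Q a, s') q' w"
    and eq: "map underlying p = map underlying q'"
    using Cons.prems \<alpha> \<alpha>' q by auto
  have w1: "sgwalk u [(e, a, t)] (head Q a, t)" if "t \<in> signs S (head Q a)" for t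
    using that u head_in_verts by auto
  show ?case
  proof (cases "s = s'")
    case True
    have "path_cong (head Q a, s) p q'" using p q' True eq Cons.IH by blast
    then show ?thesis using path_cong_append[OF _ w1] u True \<alpha> \<alpha>' q by fastforce
  next
    case False
    have S: "head Q a \<in> S" using False u by (auto simp: signs_def split: if_splits)
    show ?thesis
    proof (cases q')
      \<comment> \<open>The differing sign would belong to the end point, which both walks
        share.\<close>
      case Nil
      then show ?thesis using p q' eq False by auto
    next
      case (Cons \<beta> q'')
      then obtain b t where \<beta>: "\<beta> = (s', b, t)" using q' by (cases \<beta>) auto
      have b: "b \<in> arcs Q" "tail Q b = head Q a" "t \<in> signs S (head Q b)" and q'': "sgwalk (head Q b, t) q'' w"
        using q' Cons \<beta> by auto
      have "path_elem u [(e, a, SPos), (SPos, b, t)] - path_elem u [(e, a, SNeg), (SNeg, b, t)]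
          \<in> commutativity_relations Q S"
        unfolding commutativity_relations_def composable_pairs_def
        by (rule CollectI, intro exI[of _ a] exI[of _ b] exI[of _ e] exI[of _ t]) (use b S u in auto)
      then have rel: "path_cong u [(e, a, SPos), (SPos, b, t)] [(e, a, SNeg), (SNeg, b, t)]"
        unfolding path_cong_def using commutativity by blast
      have "{s, s'} = {SPos, SNeg}" using False u S by (auto simp: signs_def)
      then have "path_cong u [(e, a, s), (s, b, t)] [(e, a, s'), (s', b, t)]"
        using rel path_cong_sym[OF rel] by (auto simp: doubleton_eq_iff)
      then have "path_cong u ([(e, a, s), (s, b, t)] @ q'') ([(e, a, s'), (s', b, t)] @ q'')"
        by (rule path_cong_prepend[OF _ _ _ q'']) (use u b in auto)
      moreover have "path_cong (head Q a, s) p ((s, b, t) # q'')"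
        using b q'' u eq Cons \<beta> by (intro Cons.IH p) auto
      then have "path_cong u ([(e, a, s)] @ p) ([(e, a, s)] @ (s, b, t) # q'')"
        by (rule path_cong_append) (rule w1, fact)
      ultimately show ?thesis using path_cong_trans \<alpha> \<alpha>' q Cons \<beta> by auto
    qed
  qed
qed simp

end

section \<open>A monomial basis of a skew-Brauer graph algebra\<close>

text \<open>
  Classes of paths: \<open>Triv\<close> stands for trivial paths, \<open>Arc v i n e f\<close> for the walks of length \<open>n\<close>
  along the special cycle at \<open>v\<close> that start in position \<open>i\<close>, begin with sign \<open>e\<close> and end with sign
  \<open>f\<close>, and \<open>Soc\<close> for the full powers of special cycles.
\<close>

datatype ('v, 'e) label = Triv 'e sign | Arc 'v nat nat sign sign | Soc 'e sign

context skew_brauer_graph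
begin

section \<open>Labels, their product and the passage to complementary arcs\<close>

abbreviation V :: "'v \<Rightarrow> nat" where "V v \<equiv> val \<Gamma> v"
abbreviation L :: "'v \<Rightarrow> nat" where "L v \<equiv> mlt \<Gamma> v * val \<Gamma> v"
abbreviation cyc_at :: "'v \<Rightarrow> nat \<Rightarrow> 'e" where "cyc_at v i \<equiv> cyc \<Gamma> v ! i"
abbreviation sgn_at :: "'e \<Rightarrow> sign set" where "sgn_at x \<equiv> signs (special_edges \<Gamma>) x"

lemma val_eq_length: "v \<in> vertices \<Gamma> \<Longrightarrow> V v = length (cyc \<Gamma> v)"
  using sum_count_set[OF cyc_edges finite_edges, of v] cyc_count[of v] by (simp add: val_def)

lemma at_edges: "v \<in> vertices \<Gamma> \<Longrightarrow> i < V v \<Longrightarrow> cyc_at v i \<in> edges \<Gamma>"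
  using cyc_edges[of v] val_eq_length[of v] nth_mem[of i "cyc \<Gamma> v"] by auto

lemma L_pos: "v \<in> vertices \<Gamma> \<Longrightarrow> i < V v \<Longrightarrow> 0 < L v"
  using mlt_pos[of v] by auto

text \<open>The cases mirror the relations: below length \<open>L v\<close> a walk survives, at this
  length type IIb kills the walks joining different signs, beyond it everything vanishes.
  \<open>Soc\<close> forgets \<open>v\<close>, which is the identification made by type I.\<close>

definition arc_label :: "'v \<Rightarrow> nat \<Rightarrow> nat \<Rightarrow> sign \<Rightarrow> sign \<Rightarrow> ('v, 'e) label option" where
  "arc_label v i n e f = (if n < L v then Some (Arc v i n e f)
     else if n = L v \<and> e = f then Some (Soc (cyc_at v i) e) else None)"

fun source :: "('v, 'e) label \<Rightarrow> 'e \<times> sign" where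
  "source (Triv x e) = (x, e)"
| "source (Soc x e) = (x, e)"
| "source (Arc v i n e f) = (cyc_at v i, e)"

fun target :: "('v, 'e) label \<Rightarrow> 'e \<times> sign" where
  "target (Triv x e) = (x, e)"
| "target (Soc x e) = (x, e)"
| "target (Arc v i n e f) = (cyc_at v ((i + n) mod V v), f)"

text \<open>Two arcs multiply only if the second continues the first on the same special cycle,
  which is type III, and with the same sign at the junction. A socle element is annihilated by all
  labels except trivial ones.\<close>

fun label_mul :: "('v, 'e) label \<Rightarrow> ('v, 'e) label \<Rightarrow> ('v, 'e) label option" where
  "label_mul (Triv x e) l = (if source l = (x, e) then Some l else None)"
| "label_mul l (Triv x e) = (if target l = (x, e) then Some l else None)"
| "label_mul (Arc v i n e f) (Arc w j m g h) =
     (if w = v \<and> j = (i + n) mod V v \<and> f = g then arc_label v i (n + m) e h else None)"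
| "label_mul _ _ = None"

text \<open>The lengths zero and \<open>L v\<close> are left to \<open>Triv\<close> and
  \<open>Soc\<close>. A length strictly between them forces \<open>L v\<close> to be at least two,
  so the vertex is not truncated and the arrows of the arc exist.\<close>

fun valid_label :: "('v, 'e) label \<Rightarrow> bool" where
  "valid_label (Triv x e) \<longleftrightarrow> x \<in> edges \<Gamma> \<and> e \<in> sgn_at x"
| "valid_label (Soc x e) \<longleftrightarrow> x \<in> edges \<Gamma> \<and> e \<in> sgn_at x"
| "valid_label (Arc v i n e f) \<longleftrightarrow> v \<in> vertices \<Gamma> \<and> i < V v \<and> 0 < n \<and> n < L v \<and>
     e \<in> sgn_at (cyc_at v i) \<and> f \<in> sgn_at (cyc_at v ((i + n) mod V v))"

fun dual_label :: "('v, 'e) label \<Rightarrow> ('v, 'e) label" where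
  "dual_label (Triv x e) = Soc x e"
| "dual_label (Soc x e) = Triv x e"
| "dual_label (Arc v i n e f) = Arc v ((i + n) mod V v) (L v - n) f e"

lemma label_mul_Triv_right: "label_mul l (Triv x e) = (if target l = (x, e) then Some l else None)"
  by (cases l) auto

lemma label_mul_arc_label:
  assumes "arc_label v i n e f = Some a" "arc_label w j m g h = Some b" "0 < n" "0 < m"
  shows "label_mul a b = (if w = v \<and> j = (i + n) mod V v \<and> f = g then arc_label v i (n + m) e h else None)"
  using assms by (auto simp: arc_label_def split: if_splits)

text \<open>\<open>L v\<close> is a multiple of the valency, so an arc followed by its complement
  returns to position \<open>i\<close>.\<close>

lemma full_turn:
  assumes "i < V v" "n \<le> L v" shows "((i + n) mod V v + L v - n) mod V v = i"
proof -
  have "(i + n) mod V v + L v - n = (i + n) mod V v + (L v - n)" using assms by simp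
  then have "((i + n) mod V v + L v - n) mod V v = (i + L v) mod V v"
    using assms by (simp only: mod_add_left_eq) simp
  then show ?thesis using assms by simp
qed

lemma valid_dual_label: "valid_label l \<Longrightarrow> valid_label (dual_label l)"
  by (cases l) (auto simp: full_turn)

lemma dual_dual_label: "valid_label l \<Longrightarrow> dual_label (dual_label l) = l"
  by (cases l) (auto simp: full_turn)

lemma dual_label_mul_self:
  assumes "valid_label l" shows "label_mul (dual_label l) l = Some (Soc (fst (target l)) (snd (target l)))"
  using assms by (cases l) (auto simp: arc_label_def intro: full_turn[symmetric])

lemma target_dual_label: "valid_label l \<Longrightarrow> target (dual_label l) = source l"
  by (cases l) (auto simp: full_turn)

text \<open>In the main case the arcs \<open>l\<close>, \<open>m\<close> and the complement of their
  product close up to exactly one full power of the special cycle. Closing up does not depend on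
  where the reading starts, and starting with the complement gives the claim.\<close>

lemma label_mul_cyclic:
  assumes "valid_label l" "valid_label m" "label_mul l m = Some n"
  shows "label_mul (dual_label n) l = Some (dual_label m)"
proof (cases l)
  case (Triv x e)
  then show ?thesis using assms by (auto simp: label_mul_Triv_right target_dual_label split: if_splits)
next
  case l: (Soc x e)
  then show ?thesis using assms by (cases m) (auto split: if_splits)
next
  case l: (Arc v i k e f)
  show ?thesis
  proof (cases m)
    case (Triv y g)
    then have "n = l" "target l = (y, g)" using assms l by (auto split: if_splits)
    then show ?thesis using assms(1) Triv by (simp add: dual_label_mul_self)
  next
    case (Soc y g)
    then show ?thesis using assms l by simp
  next
    case m: (Arc w j k' g h)
    then have eqs: "w = v" "j = (i + k) mod V v" "g = f" and n: "arc_label v i (k + k') e h = Some n"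
      using assms l by (auto split: if_splits)
    have iv: "i < V v" using assms l by simp
    show ?thesis
    proof (cases "k + k' < L v")
      case True
      then have n: "n = Arc v i (k + k') e h" using n by (simp add: arc_label_def)
      have "(i + (k + k')) mod V v = (j + k') mod V v"
        by (simp add: eqs mod_add_left_eq add.assoc)
      moreover have "((j + k') mod V v + (L v - (k + k'))) mod V v = i"
      proof -
        have "((j + k') mod V v + (L v - (k + k'))) mod V v = (i + k + k' + (L v - (k + k'))) mod V v"
          by (simp only: eqs mod_add_left_eq)
        also have "i + k + k' + (L v - (k + k')) = i + L v" using True by simp
        finally show ?thesis using iv by simp
      qed
      moreover have "L v - (k + k') + k = L v - k'" "L v - k' < L v"
        using True assms m by auto
      ultimately show ?thesis
        using eqs by (simp add: n l m arc_label_def)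
    next
      \<comment> \<open>The product is a socle element and its dual a trivial path, so it remains to
        see that \<open>l\<close> is the complement of \<open>m\<close>.\<close>
      case False
      then have kk: "k + k' = L v" "e = h" and n: "n = Soc (cyc_at v i) e"
        using n by (auto simp: arc_label_def split: if_splits)
      have "(j + k') mod V v = (i + (k + k')) mod V v" by (simp add: eqs mod_add_left_eq add.assoc)
      then have "(j + k') mod V v = i" "L v - k' = k"
        using iv kk(1) by simp_all
      then show ?thesis using eqs kk by (simp add: n l m)
    qed
  qed
qed

lemma finite_valid_label: "finite {l. valid_label l}"
proof -
  have sign: "(UNIV :: sign set) = {SPos, SNeg, SEmpty}" using sign.exhaust by auto
  have "{l. valid_label l} \<subseteq> (\<lambda>(x, e). Triv x e) ` (edges \<Gamma> \<times> UNIV) \<union> (\<lambda>(x, e). Soc x e) ` (edges \<Gamma> \<times> UNIV) \<union>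
     (\<lambda>(v, i, n, e, f). Arc v i n e f) ` (SIGMA v : vertices \<Gamma>. {..<V v} \<times> {..<L v} \<times> UNIV \<times> UNIV)"
  proof
    fix l assume "l \<in> {l. valid_label l}"
    then show "l \<in> (\<lambda>(x, e). Triv x e) ` (edges \<Gamma> \<times> UNIV) \<union> (\<lambda>(x, e). Soc x e) ` (edges \<Gamma> \<times> UNIV) \<union>
     (\<lambda>(v, i, n, e, f). Arc v i n e f) ` (SIGMA v : vertices \<Gamma>. {..<V v} \<times> {..<L v} \<times> UNIV \<times> UNIV)"
      by (cases l) (auto simp: image_iff)
  qed
  then show ?thesis
    by (rule finite_subset) (auto simp: finite_vertices finite_edges sign intro!: finite_SigmaI)
qed

end

text \<open>
  Both the quiver of \<open>\<Gamma>\<close> and the auxiliary quiver of a skew-gentle algebra carry, up to renaming,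
  arrows of the form \<open>(v, i)\<close>; \<open>pos\<close> and \<open>\<gamma>\<close> are the renamings of arrows and of vertices.
\<close>

locale brauer_cover = skew_brauer_graph \<Gamma> + Q: fin_digraph Q
  for \<Gamma> :: "('v, 'e) skew_brauer_graph" and Q :: "('x, 'a) pre_digraph" +
  fixes \<gamma> :: "'x \<Rightarrow> 'e" and pos :: "'a \<Rightarrow> 'v \<times> nat" and S :: "'x set"
  assumes \<gamma>_edges: "x \<in> verts Q \<Longrightarrow> \<gamma> x \<in> edges \<Gamma>"
    and \<gamma>_inj: "inj_on \<gamma> (verts Q)"
    and \<gamma>_special: "x \<in> verts Q \<Longrightarrow> x \<in> S \<longleftrightarrow> \<gamma> x \<in> special_edges \<Gamma>"
    and pos_range: "a \<in> arcs Q \<Longrightarrow> fst (pos a) \<in> vertices \<Gamma> \<and> snd (pos a) < V (fst (pos a))"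
    and pos_inj: "inj_on pos (arcs Q)"
    and pos_tail: "a \<in> arcs Q \<Longrightarrow> \<gamma> (tail Q a) = cyc_at (fst (pos a)) (snd (pos a))"
    and pos_head: "a \<in> arcs Q \<Longrightarrow> \<gamma> (head Q a) = cyc_at (fst (pos a)) (Suc (snd (pos a)) mod V (fst (pos a)))"
begin

sublocale G: fin_digraph "sg_quiver Q S"
  by (rule fin_digraph_sg_quiver) unfold_locales

abbreviation "sgwalk \<equiv> pre_digraph.awalk (sg_quiver Q S)"
abbreviation "sgpaths \<equiv> quiver_paths (sg_quiver Q S)"

section \<open>Normal forms of walks in a split quiver\<close>

definition apos :: "'a signed_arrow \<Rightarrow> 'v \<times> nat" where "apos \<alpha> = pos (underlying \<alpha>)"

text \<open>A run follows a single special cycle. The condition on neighbouring arrows already fixes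
  all positions once the first is known.\<close>

definition run :: "'a signed_arrow list \<Rightarrow> bool" where
  "run = successively (\<lambda>\<alpha> \<beta>. apos \<beta> = next_arrow \<Gamma> (apos \<alpha>))"

definition nf :: "('x \<times> sign, 'a signed_arrow) path \<Rightarrow> ('v, 'e) label option" where
  "nf = (\<lambda>(u, p). if p = [] then Some (Triv (\<gamma> (fst u)) (snd u))
     else if run p then arc_label (fst (apos (hd p))) (snd (apos (hd p))) (length p) (snd u) (snd (snd (last p)))
     else None)"

lemma sgwalk_Nil [simp]: "sgwalk u [] w \<longleftrightarrow> u = w \<and> fst u \<in> verts Q \<and> snd u \<in> signs S (fst u)"
  by (auto simp: pre_digraph.awalk_def pre_digraph.cas.simps split: prod.splits)

lemma sgwalk_Cons [simp]: "sgwalk u ((e, a, e') # p) w \<longleftrightarrow>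
  a \<in> arcs Q \<and> u = (tail Q a, e) \<and> e \<in> signs S (tail Q a) \<and> e' \<in> signs S (head Q a) \<and> sgwalk (head Q a, e') p w"
  by (auto simp: G.awalk_Cons_iff')

lemma sgwalk_end_unique: "sgwalk u p w \<Longrightarrow> sgwalk u p w' \<Longrightarrow> w = w'"
  by (rule G.awalk_unique_end)

lemma sgwalk_append: "sgwalk u p v \<Longrightarrow> sgwalk u (p @ q) w \<longleftrightarrow> sgwalk v q w"
  by (rule G.awalk_append_conv)

lemma signs_\<gamma>: "x \<in> verts Q \<Longrightarrow> signs S x = sgn_at (\<gamma> x)"
  by (simp add: signs_def \<gamma>_special)

lemma sgwalk_start:
  assumes "sgwalk u p w" shows "fst u \<in> verts Q" "snd u \<in> sgn_at (\<gamma> (fst u))"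
  using assms signs_\<gamma>[of "fst u"] by (auto simp: pre_digraph.awalk_def)

lemma sgwalk_end:
  assumes "sgwalk u p w" shows "fst w \<in> verts Q" "snd w \<in> sgn_at (\<gamma> (fst w))"
  using G.awalk_last_in_verts[OF assms] signs_\<gamma>[of "fst w"] by auto

lemma sgwalk_hd:
  assumes "sgwalk u p w" "p \<noteq> []"
  shows "fst (apos (hd p)) \<in> vertices \<Gamma>" "snd (apos (hd p)) < V (fst (apos (hd p)))"
    "\<gamma> (fst u) = cyc_at (fst (apos (hd p))) (snd (apos (hd p)))" "snd u = fst (hd p)"
proof -
  obtain \<alpha> p' where p: "p = \<alpha> # p'" using assms by (cases p) auto
  obtain e a e' where "\<alpha> = (e, a, e')" by (cases \<alpha>)
  then show "fst (apos (hd p)) \<in> vertices \<Gamma>" "snd (apos (hd p)) < V (fst (apos (hd p)))"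
    "\<gamma> (fst u) = cyc_at (fst (apos (hd p))) (snd (apos (hd p)))" "snd u = fst (hd p)"
    using assms p pos_range pos_tail by (auto simp: apos_def)
qed

lemma sgwalk_last:
  assumes "sgwalk u p w" "p \<noteq> []"
  shows "\<gamma> (fst w) = cyc_at (fst (apos (last p))) (Suc (snd (apos (last p))) mod V (fst (apos (last p))))"
    "snd w = snd (snd (last p))"
proof -
  obtain \<alpha> p' where p: "p = p' @ [\<alpha>]" using assms by (cases p rule: rev_cases) auto
  obtain e a e' where \<alpha>: "\<alpha> = (e, a, e')" by (cases \<alpha>)
  have "a \<in> arcs Q" "w = (head Q a, e')" using assms p \<alpha> by (auto simp: G.awalk_snoc_iff)
  then show "\<gamma> (fst w) = cyc_at (fst (apos (last p))) (Suc (snd (apos (last p))) mod V (fst (apos (last p))))"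
    "snd w = snd (snd (last p))"
    using p \<alpha> pos_head by (auto simp: apos_def)
qed

lemma run_nth:
  assumes "run p" "k < length p" "apos (hd p) = (v, i)" "i < V v"
  shows "apos (p ! k) = (v, (i + k) mod V v)"
  using assms
proof (induction p arbitrary: k i)
  case (Cons \<alpha> p)
  show ?case
  proof (cases k)
    case (Suc k')
    then have p: "p \<noteq> []" "k' < length p" "run p" "apos (hd p) = (v, Suc i mod V v)"
      using Cons.prems by (auto simp: run_def successively_Cons next_arrow_def)
    have "Suc i mod V v < V v" using Cons.prems by simp
    then have "apos (p ! k') = (v, (Suc i mod V v + k') mod V v)" using Cons.IH[OF p(3,2,4)] by simp
    then show ?thesis using Suc by (simp add: mod_add_left_eq)
  qed (use Cons.prems in auto)
qed simp

lemma run_append: "p \<noteq> [] \<Longrightarrow> q \<noteq> [] \<Longrightarrow> run (p @ q) \<longleftrightarrow> run p \<and> run q \<and> apos (hd q) = next_arrow \<Gamma> (apos (last p))"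
  by (auto simp: run_def successively_append_iff)

lemma run_last:
  assumes "run p" "p \<noteq> []" "apos (hd p) = (v, i)" "i < V v"
  shows "next_arrow \<Gamma> (apos (last p)) = (v, (i + length p) mod V v)"
proof -
  obtain m where m: "length p = Suc m" using assms(2) by (cases p) auto
  then have "apos (last p) = (v, (i + m) mod V v)"
    using run_nth[OF assms(1), of m v i] assms by (simp add: last_conv_nth)
  then show ?thesis by (simp add: next_arrow_def mod_Suc_eq m)
qed

lemma run_end:
  assumes "sgwalk u p w" "run p" "p \<noteq> []" "apos (hd p) = (v, i)" "i < V v"
  shows "\<gamma> (fst w) = cyc_at v ((i + length p) mod V v)"
  using sgwalk_last(1)[OF assms(1,3)] run_last[OF assms(2-)] by (auto simp: next_arrow_def split: prod.splits)

lemma nf_Nil [simp]: "nf (u, []) = Some (Triv (\<gamma> (fst u)) (snd u))"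
  by (simp add: nf_def)

lemma nf_run:
  "p \<noteq> [] \<Longrightarrow> run p \<Longrightarrow> apos (hd p) = (v, i) \<Longrightarrow> nf (u, p) = arc_label v i (length p) (snd u) (snd (snd (last p)))"
  by (simp add: nf_def)

lemma nf_no_run: "p \<noteq> [] \<Longrightarrow> \<not> run p \<Longrightarrow> nf (u, p) = None"
  by (simp add: nf_def)

text \<open>The label of a path determines both its end points, up to the injective renaming
  \<open>\<gamma>\<close>. This is why composability of paths can be decided on labels, as
  \<open>nf_mul\<close> demands.\<close>

lemma nf_source_target:
  assumes "sgwalk u p w" "nf (u, p) = Some l"
  shows "source l = (\<gamma> (fst u), snd u)" "target l = (\<gamma> (fst w), snd w)" "valid_label l"
proof -
  have "source l = (\<gamma> (fst u), snd u) \<and> target l = (\<gamma> (fst w), snd w) \<and> valid_label l"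
  proof (cases "p = []")
    case True
    then show ?thesis using assms sgwalk_start[OF assms(1)] \<gamma>_edges by auto
  next
    case False
    then have run: "run p" using assms(2) nf_no_run[of p u] by auto
    obtain v i where vi: "apos (hd p) = (v, i)" by (cases "apos (hd p)")
    note hd = sgwalk_hd[OF assms(1) False, unfolded vi fst_conv snd_conv]
    note w = run_end[OF assms(1) run False vi hd(2)] sgwalk_last(2)[OF assms(1) False]
    have l: "arc_label v i (length p) (snd u) (snd w) = Some l"
      using assms(2) nf_run[OF False run vi] w by simp
    show ?thesis
    proof (cases "length p < L v")
      case True
      then show ?thesis
        using l hd w sgwalk_start[OF assms(1)] sgwalk_end[OF assms(1)] False by (auto simp: arc_label_def)
    next
      case F: False
      then have "length p = L v" "snd u = snd w" "l = Soc (cyc_at v i) (snd u)"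
        using l by (auto simp: arc_label_def split: if_splits)
      then show ?thesis
        using hd w sgwalk_start[OF assms(1)] at_edges by auto
    qed
  qed
  then show "source l = (\<gamma> (fst u), snd u)" "target l = (\<gamma> (fst w), snd w)" "valid_label l" by auto
qed

lemma vertex_eqI: "x \<in> verts Q \<Longrightarrow> y \<in> verts Q \<Longrightarrow> \<gamma> x = \<gamma> y \<Longrightarrow> x = y"
  using \<gamma>_inj by (auto simp: inj_on_def)

lemma nf_mul:
  assumes p: "p \<in> sgpaths" and q: "q \<in> sgpaths" and "nf p = Some m" "nf q = Some n"
  shows "label_mul m n = (if sgwalk (fst p) (snd p) (fst q) then nf (fst p, snd p @ snd q) else None)"
proof -
  obtain u p' u' q' where pq: "p = (u, p')" "q = (u', q')" by (cases p, cases q)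
  obtain w w' where w: "sgwalk u p' w" and w': "sgwalk u' q' w'"
    using p q pq by (auto simp: quiver_paths_def)
  note P = nf_source_target[OF w assms(3)[unfolded pq(1)]] and Q = nf_source_target[OF w' assms(4)[unfolded pq(2)]]
  have comp: "sgwalk u p' u' \<longleftrightarrow> w = u'" using w sgwalk_end_unique by blast
  have comp': "w = u' \<longleftrightarrow> \<gamma> (fst w) = \<gamma> (fst u') \<and> snd w = snd u'"
    using vertex_eqI[of "fst w" "fst u'"] sgwalk_start[OF w'] sgwalk_end[OF w] by (auto simp: prod_eq_iff)
  show ?thesis
  proof (cases "p' = []")
    case True
    then have "m = Triv (\<gamma> (fst u)) (snd u)" "u = w" using assms(3) w pq by auto
    then show ?thesis using True P Q pq comp comp' assms by auto
  next
    case p': False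
    show ?thesis
    proof (cases "q' = []")
      case True
      then have "n = Triv (\<gamma> (fst u')) (snd u')" using assms(4) pq by auto
      then show ?thesis using True P pq comp comp' assms by (auto simp: label_mul_Triv_right)
    next
      case q': False
      have run: "run p'" "run q'"
        using assms(3,4) pq nf_no_run[OF p', of u] nf_no_run[OF q', of u'] by auto
      obtain v i v' j where vi: "apos (hd p') = (v, i)" "apos (hd q') = (v', j)"
        by (cases "apos (hd p')", cases "apos (hd q')")
      note hdp = sgwalk_hd[OF w p', unfolded vi fst_conv snd_conv]
      note hdq = sgwalk_hd[OF w' q', unfolded vi fst_conv snd_conv]
      have l: "arc_label v i (length p') (snd u) (snd w) = Some m"
        "arc_label v' j (length q') (snd u') (snd w') = Some n"
        using assms(3,4) nf_run[OF p' run(1) vi(1)] nf_run[OF q' run(2) vi(2)] pq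
          sgwalk_last(2)[OF w p'] sgwalk_last(2)[OF w' q'] by simp_all
      have mul: "label_mul m n = (if v' = v \<and> j = (i + length p') mod V v \<and> snd w = snd u'
         then arc_label v i (length p' + length q') (snd u) (snd w') else None)"
        using p' q' by (intro label_mul_arc_label[OF l]) auto
      have "run (p' @ q') \<longleftrightarrow> v' = v \<and> j = (i + length p') mod V v"
        using run_append[OF p' q'] run run_last[OF run(1) p' vi(1) hdp(2)] vi by auto
      \<comment> \<open>Continuing the run fixes the vertex of \<open>Q\<close> at the junction, and
        agreement of the signs then the vertex of the split quiver.\<close>
      moreover have "run (p' @ q') \<Longrightarrow> snd w = snd u' \<Longrightarrow> w = u'"
        using run_end[OF w run(1) p' vi(1) hdp(2)] hdq(3) calculation comp' by simp
      moreover have "nf (u, p' @ q') = (if run (p' @ q') then arc_label v i (length p' + length q') (snd u) (snd w') else None)"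
        using p' q' vi sgwalk_last(2)[OF w' q'] by (simp add: nf_def)
      ultimately show ?thesis using mul comp pq by auto
    qed
  qed
qed

lemma nf_zero:
  assumes p: "p \<in> sgpaths" and q: "q \<in> sgpaths" and "nf p = None \<or> nf q = None"
    and comp: "sgwalk (fst p) (snd p) (fst q)"
  shows "nf (fst p, snd p @ snd q) = None"
proof -
  obtain u p' u' q' where pq: "p = (u, p')" "q = (u', q')" by (cases p, cases q)
  obtain w' where w: "sgwalk u p' u'" and w': "sgwalk u' q' w'"
    using q comp pq by (auto simp: quiver_paths_def)
  show ?thesis
  proof (cases "p' = [] \<or> q' = []")
    case True
    then show ?thesis using assms w w' pq by auto
  next
    case False
    then have ne: "p' \<noteq> []" "q' \<noteq> []" by auto
    obtain v i where vi: "apos (hd p') = (v, i)" by (cases "apos (hd p')")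
    note hdp = sgwalk_hd[OF w ne(1), unfolded vi fst_conv snd_conv]
    show ?thesis
    proof (cases "run (p' @ q')")
      case True
      then have run: "run p'" "run q'" and hdq: "apos (hd q') = (v, (i + length p') mod V v)"
        using run_append[OF ne] run_last[OF _ ne(1) vi hdp(2)] by auto
      have "arc_label v i (length p') (snd u) (snd (snd (last p'))) = None \<or>
          arc_label v ((i + length p') mod V v) (length q') (snd u') (snd (snd (last q'))) = None"
        using assms(3) pq nf_run[OF ne(1) run(1) vi] nf_run[OF ne(2) run(2) hdq] by simp
      moreover have pos: "0 < length p'" "0 < length q'" using ne by auto
      ultimately have "\<not> length p' + length q' \<le> L v"
        using pos by (auto simp del: length_greater_0_conv simp: arc_label_def split: if_splits)
      then show ?thesis using nf_run[of "p' @ q'" v i u] True ne vi pq by (simp add: arc_label_def)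
    next
      case False
      then show ?thesis using pq ne by (simp add: nf_no_run)
    qed
  qed
qed

lemma sgwalk_underlying: "sgwalk u p w \<Longrightarrow> \<alpha> \<in> set p \<Longrightarrow> underlying \<alpha> \<in> arcs Q"
  by (cases \<alpha>) (auto simp: pre_digraph.awalk_def)

lemma same_underlying_if_run:
  assumes "sgwalk u p w" "sgwalk u' q w'" "run p" "run q" "p \<noteq> []" "q \<noteq> []"
    "apos (hd p) = apos (hd q)" "length p = length q"
  shows "map underlying p = map underlying q"
proof (rule nth_equalityI)
  fix k assume k: "k < length (map underlying p)"
  obtain v i where vi: "apos (hd p) = (v, i)" by (cases "apos (hd p)")
  have i: "i < V v" using sgwalk_hd(2)[OF assms(1,5)] vi by simp
  have "apos (p ! k) = apos (q ! k)"
    using run_nth[OF assms(3) _ vi i, of k] run_nth[OF assms(4) _ _ i, of k] assms vi k by simp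
  moreover have "underlying (p ! k) \<in> arcs Q" "underlying (q ! k) \<in> arcs Q"
    using sgwalk_underlying[OF assms(1), of "p ! k"] sgwalk_underlying[OF assms(2), of "q ! k"] assms(8) k
    by simp_all
  ultimately show "map underlying p ! k = map underlying q ! k"
    using k assms(8) pos_inj by (auto simp: apos_def inj_on_def)
qed (use assms in simp)

lemma nf_eq_if_same_underlying:
  assumes "sgwalk u p w" "sgwalk u q w" "map underlying p = map underlying q"
  shows "nf (u, p) = nf (u, q)"
proof (cases "p = []")
  case False
  then have q: "q \<noteq> []" using assms(3) by auto
  have eq: "map apos p = map apos q" using arg_cong[OF assms(3), of "map pos"] by (simp add: apos_def[abs_def] comp_def)
  have run_map: "run r = successively (\<lambda>x y. y = next_arrow \<Gamma> x) (map apos r)" for r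
    by (simp add: run_def successively_map)
  have "run p = run q" "apos (hd p) = apos (hd q)" "length p = length q"
    using eq map_eq_imp_length_eq[OF eq] hd_map[OF False, of apos] hd_map[OF q, of apos]
    by (simp_all add: run_map)
  then show ?thesis
    using False q sgwalk_last(2)[OF assms(1) False] sgwalk_last(2)[OF assms(2) q] by (simp add: nf_def)
qed (use assms in auto)

text \<open>Below the socle a label retains the start position, the length and the outer signs; only
  inner signs are lost. \<open>Soc\<close> also loses the special cycle that was run through, hence
  its exclusion.\<close>

lemma same_nf_imp_same_underlying:
  assumes "sgwalk u p w" "sgwalk u' q w'" "nf (u, p) = Some l" "nf (u', q) = Some l" "\<And>x e. l \<noteq> Soc x e"
  shows "u = u'" "w = w'" "map underlying p = map underlying q"
proof -
  note P = nf_source_target[OF assms(1,3)] and Q = nf_source_target[OF assms(2,4)]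
  show "u = u'" "w = w'"
    using P Q vertex_eqI sgwalk_start[OF assms(1)] sgwalk_start[OF assms(2)] sgwalk_end[OF assms(1)] sgwalk_end[OF assms(2)]
    by (auto simp: prod_eq_iff)
  have *: "l = Arc (fst (apos (hd p))) (snd (apos (hd p))) (length p) (snd u) (snd (snd (last p))) \<and> run p"
    if "nf (u, p) = Some l" "p \<noteq> []" for u p
    using that assms(5) by (auto simp: nf_def arc_label_def split: if_splits)
  have **: "p = [] \<longleftrightarrow> (\<exists>x e. l = Triv x e)" if "nf (u, p) = Some l" for u p
    using that *[OF that] by (cases "p = []") auto
  show "map underlying p = map underlying q"
  proof (cases "p = []")
    case True
    then show ?thesis using **[OF assms(3)] **[OF assms(4)] by simp
  next
    case False
    then have "q \<noteq> []" using **[OF assms(3)] **[OF assms(4)] by simp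
    then show ?thesis
      using *[OF assms(3) False] *[OF assms(4)] False
      by (intro same_underlying_if_run[OF assms(1,2)]) (auto simp: prod_eq_iff)
  qed
qed

end

lemma not_successively_split:
  "\<not> successively P xs \<Longrightarrow> \<exists>ys x y zs. xs = ys @ [x, y] @ zs \<and> \<not> P x y"
proof (induction xs rule: induct_list012)
  case (3 x y zs)
  show ?case
  proof (cases "P x y")
    case True
    then obtain ys a b zs' where "y # zs = ys @ [a, b] @ zs'" "\<not> P a b" using 3 by auto
    then show ?thesis by (intro exI[of _ "x # ys"]) auto
  next
    case False
    then show ?thesis by (intro exI[of _ "[]"]) auto
  qed
qed auto

lemma path_elem_diff_kernel:
  assumes "nf (u, p) = nf (u, q)"
  shows "(\<Sum>k\<in>Poly_Mapping.keys (path_elem u p - path_elem u q :: _ \<Rightarrow>\<^sub>0 'k::field).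
    if nf k = Some b then Poly_Mapping.lookup (path_elem u p - path_elem u q) k else 0) = 0"
proof (cases "p = q")
  case False
  let ?r = "path_elem u p - path_elem u q :: _ \<Rightarrow>\<^sub>0 'k"
  have "Poly_Mapping.keys ?r = {(u, p), (u, q)}"
    using False by (auto simp: path_elem_def in_keys_iff lookup_minus lookup_single when_def split: if_splits)
  then show ?thesis
    using False assms by (simp add: path_elem_def lookup_minus lookup_single)
qed simp

lemma path_elem_kernel:
  "nf (u, p) = None \<Longrightarrow> (\<Sum>k\<in>Poly_Mapping.keys (path_elem u p :: _ \<Rightarrow>\<^sub>0 'k::field).
    if nf k = Some b then Poly_Mapping.lookup (path_elem u p) k else 0) = 0"
  by (simp add: path_elem_def)

lemma keys_path_elem_diff:
  "Poly_Mapping.keys (path_elem u p - path_elem u q :: _ \<Rightarrow>\<^sub>0 'k::field) \<subseteq> {(u, p), (u, q)}"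
  by (auto simp: path_elem_def in_keys_iff lookup_minus lookup_single when_def split: if_splits)

context brauer_cover
begin

lemma sgwalk_Cons_iff: "sgwalk u (\<alpha> # p) w \<longleftrightarrow>
  \<alpha> \<in> arcs (sg_quiver Q S) \<and> tail (sg_quiver Q S) \<alpha> = u \<and> sgwalk (head (sg_quiver Q S) \<alpha>) p w"
  by (rule G.awalk_Cons_iff')

text \<open>Inner signs are chosen freely, the outer ones are prescribed. An empty walk cannot
  change the sign of its vertex, so it is excluded.\<close>

lemma lift_walk:
  assumes "pre_digraph.awalk Q x p y" "p \<noteq> []" "e \<in> signs S x" "f \<in> signs S y"
  shows "\<exists>c. map underlying c = p \<and> sgwalk (x, e) c (y, f)"
  using assms
proof (induction p arbitrary: x e)
  case (Cons a p)
  then have a: "a \<in> arcs Q" "tail Q a = x" and p: "Q.awalk (head Q a) p y"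
    by (auto simp: Q.awalk_Cons_iff')
  show ?case
  proof (cases "p = []")
    case True
    then have "head Q a = y" using p by (auto simp: Q.awalk_def)
    then show ?thesis
      using Cons.prems a True Q.head_in_verts[of a] by (intro exI[of _ "[(e, a, f)]"]) auto
  next
    case False
    obtain g where g: "g \<in> signs S (head Q a)" using signs_nonempty[of S "head Q a"] by blast
    obtain c where "map underlying c = p" "sgwalk (head Q a, g) c (y, f)"
      using Cons.IH[OF p False g] Cons.prems by blast
    then show ?thesis using Cons.prems a g by (intro exI[of _ "(e, a, g) # c"]) auto
  qed
qed simp

lemma commutativity_relationsE:
  assumes "(r :: _ \<Rightarrow>\<^sub>0 'k::field) \<in> commutativity_relations Q S"
  obtains u p q w where "r = path_elem u p - path_elem u q" "sgwalk u p w" "sgwalk u q w"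
    "map underlying p = map underlying q"
proof -
  from assms obtain a b e e' where r:
    "r = path_elem (tail Q a, e) [(e, a, SPos), (SPos, b, e')] - path_elem (tail Q a, e) [(e, a, SNeg), (SNeg, b, e')]"
    "(a, b) \<in> composable_pairs Q" "head Q a \<in> S" "e \<in> signs S (tail Q a)" "e' \<in> signs S (head Q b)"
    unfolding commutativity_relations_def by blast
  have walk: "sgwalk (tail Q a, e) [(e, a, g), (g, b, e')] (head Q b, e')" if "g \<in> {SPos, SNeg}" for g
    using r that by (auto simp: composable_pairs_def signs_def)
  show thesis by (rule that[OF r(1) walk walk]) auto
qed

lemma lifted_zero_relationsE:
  assumes "(r :: _ \<Rightarrow>\<^sub>0 'k::field) \<in> lifted_zero_relations Q S P"
  obtains u \<alpha> \<beta> w where "r = path_elem u [\<alpha>, \<beta>]" "sgwalk u [\<alpha>, \<beta>] w" "(underlying \<alpha>, underlying \<beta>) \<in> P"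
  using assms unfolding lifted_zero_relations_def by blast

end

text \<open>An ideal containing the relations common to both algebras: commutativity, and vanishing
  of walks that leave a special cycle. They settle the comparison of paths below the socle once for
  both ideals.\<close>

locale brauer_cover_ideal = brauer_cover \<Gamma> Q \<gamma> pos S + I: path_ideal "sg_quiver Q S" I
  for \<Gamma> :: "('v, 'e) skew_brauer_graph" and Q :: "('x, 'a) pre_digraph" and \<gamma> pos S
    and I :: "(('x \<times> sign, 'a signed_arrow) path \<Rightarrow>\<^sub>0 'k::field) set" +
  assumes commutativity: "commutativity_relations Q S \<subseteq> I"
    and zero_relations: "sgwalk u [\<alpha>, \<beta>] w \<Longrightarrow> apos \<beta> \<noteq> next_arrow \<Gamma> (apos \<alpha>) \<Longrightarrow> path_elem u [\<alpha>, \<beta>] \<in> I"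
begin

sublocale split: split_path_ideal Q S I
  by unfold_locales (rule commutativity)

lemma zero_if_no_run:
  assumes "sgwalk u p w" "\<not> run p" shows "path_elem u p \<in> I"
proof -
  obtain ys \<alpha> \<beta> zs where p: "p = ys @ [\<alpha>, \<beta>] @ zs" "apos \<beta> \<noteq> next_arrow \<Gamma> (apos \<alpha>)"
    using not_successively_split[OF assms(2)[unfolded run_def]] by blast
  then obtain v where v: "sgwalk u ys v" using assms(1) unfolding p(1) G.awalk_append_iff by blast
  then have "sgwalk v ([\<alpha>, \<beta>] @ zs) w" using assms(1) sgwalk_append unfolding p(1) by blast
  then obtain z where "sgwalk v [\<alpha>, \<beta>] z" unfolding G.awalk_append_iff by blast
  then show ?thesis using I.zero_path_infix[OF zero_relations[OF _ p(2)]] v assms(1) p(1) by blast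
qed

lemma equal_paths_below_socle:
  assumes "sgwalk u p w" "sgwalk u' q w'" "nf (u, p) = Some l" "nf (u', q) = Some l" "\<And>x e. l \<noteq> Soc x e"
  shows "u = u'" "path_elem u p - path_elem u q \<in> I"
proof -
  note same = same_nf_imp_same_underlying[OF assms]
  show "u = u'" by (rule same)
  show "path_elem u p - path_elem u q \<in> I"
    using split.path_cong_if_same_underlying[OF assms(1)] assms(2) same unfolding I.path_cong_def by simp
qed

end

section \<open>Skew-Brauer graph algebras are symmetric\<close>

locale brauer_relations = skew_brauer_graph \<Gamma> for \<Gamma> :: "('v, 'e) skew_brauer_graph"
begin

definition seg :: "'v \<Rightarrow> nat \<Rightarrow> nat \<Rightarrow> ('v \<times> nat) list" where
  "seg v i n = map (\<lambda>j. (v, (i + j) mod V v)) [0..<n]"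

lemma length_seg [simp]: "length (seg v i n) = n"
  by (simp add: seg_def)

lemma hd_seg: "0 < n \<Longrightarrow> i < V v \<Longrightarrow> hd (seg v i n) = (v, i)"
  by (simp add: seg_def upt_conv_Cons)

lemma special_cycle_eq_seg: "special_cycle \<Gamma> v i = seg v i (V v)"
  by (simp add: special_cycle_def seg_def)

lemma seg_append: "seg v i n @ seg v ((i + n) mod V v) m = seg v i (n + m)"
  by (rule nth_equalityI) (auto simp: seg_def nth_append mod_add_left_eq)

lemma seg_turn: "i < V v \<Longrightarrow> seg v i (V v) @ seg v i m = seg v i (V v + m)"
  using seg_append[of v i "V v" m] by simp

lemma seg_Suc: "seg v i (Suc n) = seg v i n @ [(v, (i + n) mod V v)]"
  by (simp add: seg_def)

lemma successively_seg: "successively (\<lambda>x y. y = next_arrow \<Gamma> x) (seg v i n)"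
proof (induction n)
  case (Suc n)
  show ?case
  proof (cases n)
    case (Suc m)
    then show ?thesis
      using Suc.IH unfolding seg_Suc[of v i n]
      by (auto simp: successively_append_iff seg_Suc next_arrow_def mod_Suc_eq)
  qed (simp add: seg_Suc, simp add: seg_def)
qed (simp add: seg_def)

lemma power_0 [simp]: "Defs.power p 0 = []" and power_Suc [simp]: "Defs.power p (Suc n) = p @ Defs.power p n"
  by (simp_all add: Defs.power_def)

lemma fin_digraph_brauer_quiver: "fin_digraph (brauer_quiver \<Gamma>)"
proof
  have "arcs (brauer_quiver \<Gamma>) \<subseteq> (SIGMA v : vertices \<Gamma>. {..<V v})"
    by (auto simp: brauer_quiver_def carries_arrows_def)
  then show "finite (arcs (brauer_quiver \<Gamma>))"
    by (rule finite_subset) (auto simp: finite_vertices)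
  fix a assume "a \<in> arcs (brauer_quiver \<Gamma>)"
  then obtain v i where a: "a = (v, i)" "v \<in> vertices \<Gamma>" "i < V v"
    by (auto simp: brauer_quiver_def carries_arrows_def)
  moreover have "Suc i mod V v < V v" using a by (intro mod_less_divisor) auto
  ultimately show "tail (brauer_quiver \<Gamma>) a \<in> verts (brauer_quiver \<Gamma>)" "head (brauer_quiver \<Gamma>) a \<in> verts (brauer_quiver \<Gamma>)"
    using at_edges by (auto simp: brauer_quiver_def)
qed (simp add: brauer_quiver_def finite_edges)

lemma brauer_quiver_simps [simp]:
  "verts (brauer_quiver \<Gamma>) = edges \<Gamma>"
  "(v, i) \<in> arcs (brauer_quiver \<Gamma>) \<longleftrightarrow> carries_arrows \<Gamma> v \<and> i < V v"
  "tail (brauer_quiver \<Gamma>) (v, i) = cyc_at v i"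
  "head (brauer_quiver \<Gamma>) (v, i) = cyc_at v (Suc i mod V v)"
  by (simp_all add: brauer_quiver_def)

sublocale B: brauer_cover \<Gamma> "brauer_quiver \<Gamma>" id id "special_edges \<Gamma>"
proof -
  interpret Q: fin_digraph "brauer_quiver \<Gamma>" by (rule fin_digraph_brauer_quiver)
  show "brauer_cover \<Gamma> (brauer_quiver \<Gamma>) id id (special_edges \<Gamma>)"
    by unfold_locales (auto simp: brauer_quiver_def carries_arrows_def)
qed

lemma apos_eq: "B.apos = underlying"
  by (simp add: B.apos_def[abs_def] fun_eq_iff)

lemma run_iff_seg:
  assumes "B.sgwalk u p w" "p \<noteq> []" "underlying (hd p) = (v, i)"
  shows "B.run p \<longleftrightarrow> map underlying p = seg v i (length p)"
proof
  assume run: "B.run p"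
  have "i < V v" using B.sgwalk_hd(2)[OF assms(1,2)] assms(3) by (simp add: apos_eq)
  then show "map underlying p = seg v i (length p)"
    using B.run_nth[OF run, of _ v i] assms by (intro nth_equalityI) (auto simp: apos_eq seg_def)
next
  assume "map underlying p = seg v i (length p)"
  then show "B.run p"
    using successively_seg[of v i "length p"] successively_map[of "\<lambda>x y. y = next_arrow \<Gamma> x" underlying p]
    by (simp add: B.run_def apos_eq)
qed

lemma nf_seg:
  assumes "B.sgwalk u p w" "map underlying p = seg v i n" "0 < n" "i < V v"
  shows "B.nf (u, p) = arc_label v i n (snd u) (snd w)"
proof -
  have n: "length p = n" using assms(2) map_eq_imp_length_eq[of underlying p id "seg v i n"] by simp
  then have p: "p \<noteq> []" using assms(3) by auto
  have "underlying (hd p) = hd (seg v i n)" using hd_map[OF p, of underlying] assms(2) by simp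
  also have "\<dots> = (v, i)" using assms(3,4) by (rule hd_seg)
  finally have hd: "underlying (hd p) = (v, i)" .
  then have "B.run p" using run_iff_seg[OF assms(1) p hd] assms(2) n by simp
  then show ?thesis
    using B.nf_run[OF p _, of v i u] hd n B.sgwalk_last(2)[OF assms(1) p] by (simp add: apos_eq)
qed

lemma awalk_seg:
  assumes "carries_arrows \<Gamma> v" "i < V v"
  shows "pre_digraph.awalk (brauer_quiver \<Gamma>) (cyc_at v i) (seg v i n) (cyc_at v ((i + n) mod V v))"
proof (induction n)
  case 0
  then show ?case using assms at_edges by (auto simp: B.Q.awalk_def seg_def carries_arrows_def)
next
  case (Suc n)
  have "(i + n) mod V v < V v" using assms(2) by (intro mod_less_divisor) auto
  then show ?case
    using Suc assms unfolding seg_Suc B.Q.awalk_snoc_iff by (simp add: mod_Suc_eq)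
qed

lemma lift_seg:
  assumes "carries_arrows \<Gamma> v" "i < V v" "0 < n" "e \<in> sgn_at (cyc_at v i)" "f \<in> sgn_at (cyc_at v ((i + n) mod V v))"
  shows "\<exists>c. map underlying c = seg v i n \<and> B.sgwalk (cyc_at v i, e) c (cyc_at v ((i + n) mod V v), f)"
proof -
  have "seg v i n \<noteq> []" using assms(3) length_seg[of v i n] by (cases "seg v i n") auto
  then show ?thesis using B.lift_walk[OF awalk_seg[OF assms(1,2)] _ assms(4,5)] by blast
qed

lemma lifts_cycle_iff: "lifts_cycle \<Gamma> v i u c w \<longleftrightarrow>
    carries_arrows \<Gamma> v \<and> i < V v \<and> map underlying c = seg v i (V v) \<and> B.sgwalk u c w"
  by (simp add: lifts_cycle_def special_cycle_eq_seg skew_brauer_quiver_def)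

lemma lifts_cycle_exists:
  assumes "carries_arrows \<Gamma> v" "i < V v" "e \<in> sgn_at (cyc_at v i)" "f \<in> sgn_at (cyc_at v i)"
  shows "\<exists>c. lifts_cycle \<Gamma> v i (cyc_at v i, e) c (cyc_at v i, f)"
  using lift_seg[of v i "V v" e f] assms by (auto simp: lifts_cycle_iff)

lemma power_walk:
  assumes "lifts_cycle \<Gamma> v i u c u"
  shows "map underlying (Defs.power c m) = seg v i (m * V v)" "B.sgwalk u (Defs.power c m) u"
proof (induction m)
  case 0
  { case 1 show ?case by (simp add: seg_def) }
  { case 2 show ?case using assms B.sgwalk_start[of u c u] by (simp add: lifts_cycle_iff) }
next
  case (Suc m)
  { case 1 show ?case using Suc assms seg_turn[of i v "m * V v"] by (simp add: lifts_cycle_iff) }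
  { case 2 show ?case using Suc assms B.sgwalk_append[of u c u] by (simp add: lifts_cycle_iff) }
qed

lemma carries_arrows_vertex: "carries_arrows \<Gamma> v \<Longrightarrow> v \<in> vertices \<Gamma>"
  by (simp add: carries_arrows_def)

lemma lifts_cycle_start:
  assumes "lifts_cycle \<Gamma> v i u c w" shows "fst u = cyc_at v i" "snd u \<in> sgn_at (cyc_at v i)" "c \<noteq> []"
    "fst w = cyc_at v i" "snd w \<in> sgn_at (cyc_at v i)"
proof -
  have c: "B.sgwalk u c w" "map underlying c = seg v i (V v)" "i < V v" "carries_arrows \<Gamma> v"
    using assms by (auto simp: lifts_cycle_iff)
  have len: "length c = V v" using arg_cong[OF c(2), of length] by simp
  then show ne: "c \<noteq> []" using c(3) by auto
  have "underlying (hd c) = (v, i)"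
    using hd_map[OF ne, of underlying] hd_seg[of "V v" i v] c(2,3) by simp
  then show fst: "fst u = cyc_at v i" using B.sgwalk_hd(3)[OF c(1) ne] by (simp add: apos_eq)
  then show "snd u \<in> sgn_at (cyc_at v i)" using B.sgwalk_start[OF c(1)] by simp
  show "fst w = cyc_at v i"
    using B.run_end[OF c(1) _ ne, of v i] run_iff_seg[OF c(1) ne, of v i] c \<open>underlying (hd c) = (v, i)\<close> len
    by (simp add: apos_eq)
  then show "snd w \<in> sgn_at (cyc_at v i)" using B.sgwalk_end[OF c(1)] by simp
qed

end

lemma (in brauer_cover) sgwalk_in_sgpaths: "sgwalk u p w \<Longrightarrow> (u, p) \<in> sgpaths"
  unfolding quiver_paths_def by blast

context brauer_relations
begin

section \<open>The relations in terms of normal forms\<close>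

definition brauer_rels :: "(('e sg_vertex, 'v sg_arrow) path \<Rightarrow>\<^sub>0 'k::field) set" where
  "brauer_rels = commutativity_relations (brauer_quiver \<Gamma>) (special_edges \<Gamma>) \<union> type_I_relations \<Gamma> \<union>
     type_IIa_relations \<Gamma> \<union> type_IIb_relations \<Gamma> \<union> type_III_relations \<Gamma>"

lemma seg_turns: "i < V v \<Longrightarrow> seg v i (k * V v) @ seg v i n = seg v i (k * V v + n)"
  using seg_append[of v i "k * V v" n] by simp

lemma arc_label_full: "arc_label v i (L v) e f = (if e = f then Some (Soc (cyc_at v i) e) else None)"
  by (simp add: arc_label_def)

lemma nf_full_cycle:
  assumes "lifts_cycle \<Gamma> v i u c u"
  shows "B.nf (u, Defs.power c (mlt \<Gamma> v)) = Some (Soc (fst u) (snd u))"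
proof -
  have iv: "i < V v" "v \<in> vertices \<Gamma>"
    using assms carries_arrows_vertex by (auto simp: lifts_cycle_iff)
  then show ?thesis
    using nf_seg[OF power_walk(2,1)[OF assms], of "mlt \<Gamma> v"] L_pos[of v i] lifts_cycle_start(1)[OF assms]
    by (simp add: arc_label_full)
qed

lemma IIa_walk:
  assumes "lifts_cycle \<Gamma> v i u c u"
  shows "map underlying (Defs.power c (mlt \<Gamma> v) @ [hd c]) = seg v i (Suc (L v))"
    "B.sgwalk u (Defs.power c (mlt \<Gamma> v) @ [hd c]) (head (sg_quiver (brauer_quiver \<Gamma>) (special_edges \<Gamma>)) (hd c))"
proof -
  have c: "c \<noteq> []" "i < V v" "B.sgwalk u c u" "map underlying c = seg v i (V v)"
    using assms lifts_cycle_start(3)[OF assms] by (simp_all add: lifts_cycle_iff)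
  then obtain \<alpha> c' where c': "c = \<alpha> # c'" by (cases c) auto
  have "underlying \<alpha> = (v, i)" using arg_cong[OF c(4), of hd] hd_seg[of "V v" i v] c(2) c' by simp
  then show "map underlying (Defs.power c (mlt \<Gamma> v) @ [hd c]) = seg v i (Suc (L v))"
    using power_walk(1)[OF assms] c(2) c' by (simp add: seg_Suc)
  have "B.sgwalk u [\<alpha>] (head (sg_quiver (brauer_quiver \<Gamma>) (special_edges \<Gamma>)) \<alpha>)"
    using c(3) c' by (auto simp: B.sgwalk_Cons_iff pre_digraph.awalk_def)
  then show "B.sgwalk u (Defs.power c (mlt \<Gamma> v) @ [hd c]) (head (sg_quiver (brauer_quiver \<Gamma>) (special_edges \<Gamma>)) (hd c))"
    using B.sgwalk_append[OF power_walk(2)[OF assms]] c' by simp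
qed

lemma IIb_walk:
  assumes "lifts_cycle \<Gamma> v i u c u" "lifts_cycle \<Gamma> v i u d w"
  shows "map underlying (Defs.power c (mlt \<Gamma> v - 1) @ d) = seg v i (L v)"
    "B.sgwalk u (Defs.power c (mlt \<Gamma> v - 1) @ d) w"
proof -
  have iv: "i < V v" "v \<in> vertices \<Gamma>" "map underlying d = seg v i (V v)" "B.sgwalk u d w"
    using assms carries_arrows_vertex by (auto simp: lifts_cycle_iff)
  obtain m where "mlt \<Gamma> v = Suc m" using mlt_pos[OF iv(2)] by (cases "mlt \<Gamma> v") auto
  then show "map underlying (Defs.power c (mlt \<Gamma> v - 1) @ d) = seg v i (L v)"
    using power_walk(1)[OF assms(1)] seg_turns[OF iv(1)] iv(3) by (simp add: add.commute)
  show "B.sgwalk u (Defs.power c (mlt \<Gamma> v - 1) @ d) w"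
    using B.sgwalk_append[OF power_walk(2)[OF assms(1)]] iv(4) by blast
qed

text \<open>All five types come down to the two shapes a normal form can absorb: a difference of two
  paths with the same label, or a single path without label.\<close>

lemma brauer_rels_cases:
  assumes "(r :: _ \<Rightarrow>\<^sub>0 'k::field) \<in> brauer_rels"
  obtains (diff) u p q w w' where "r = path_elem u p - path_elem u q" "B.sgwalk u p w" "B.sgwalk u q w'"
      "B.nf (u, p) = B.nf (u, q)"
    | (zero) u p w where "r = path_elem u p" "B.sgwalk u p w" "B.nf (u, p) = None"
proof -
  consider "r \<in> commutativity_relations (brauer_quiver \<Gamma>) (special_edges \<Gamma>)"
    | "r \<in> type_I_relations \<Gamma>" | "r \<in> type_IIa_relations \<Gamma>" | "r \<in> type_IIb_relations \<Gamma>" | "r \<in> type_III_relations \<Gamma>"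
    using assms unfolding brauer_rels_def by blast
  then show thesis
  proof cases
    case 1
    then obtain u p q w where "r = path_elem u p - path_elem u q" "B.sgwalk u p w" "B.sgwalk u q w"
      "map underlying p = map underlying q"
      by (rule B.commutativity_relationsE)
    then show thesis using B.nf_eq_if_same_underlying diff by blast
  next
    case 2
    then obtain u v c v' c' i i' where r: "r = path_elem u (Defs.power c (mlt \<Gamma> v)) - path_elem u (Defs.power c' (mlt \<Gamma> v'))"
      "lifts_cycle \<Gamma> v i u c u" "lifts_cycle \<Gamma> v' i' u c' u"
      unfolding type_I_relations_def sg_special_cycle_def by blast
    show thesis
      by (rule diff[OF r(1) power_walk(2)[OF r(2)] power_walk(2)[OF r(3)]])
         (simp add: nf_full_cycle[OF r(2)] nf_full_cycle[OF r(3)])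
  next
    case 3
    then obtain u v c i where r: "r = path_elem u (Defs.power c (mlt \<Gamma> v) @ [hd c])" "lifts_cycle \<Gamma> v i u c u"
      unfolding type_IIa_relations_def sg_special_cycle_def by blast
    have "i < V v" using r(2) by (simp add: lifts_cycle_iff)
    then have "B.nf (u, Defs.power c (mlt \<Gamma> v) @ [hd c]) = None"
      using nf_seg[OF IIa_walk(2,1)[OF r(2)]] by (simp add: arc_label_def)
    then show thesis using zero[OF r(1) IIa_walk(2)[OF r(2)]] by blast
  next
    case 4
    then obtain x e e' v i c d where r: "r = path_elem (x, e) (Defs.power c (mlt \<Gamma> v - 1) @ d)" "e \<noteq> e'"
      "lifts_cycle \<Gamma> v i (x, e) c (x, e)" "lifts_cycle \<Gamma> v i (x, e) d (x, e')"
      unfolding type_IIb_relations_def by blast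
    have iv: "i < V v" "v \<in> vertices \<Gamma>" using r(3) carries_arrows_vertex by (auto simp: lifts_cycle_iff)
    then have "B.nf ((x, e), Defs.power c (mlt \<Gamma> v - 1) @ d) = None"
      using nf_seg[OF IIb_walk(2,1)[OF r(3,4)]] L_pos[of v i] r(2) by (simp add: arc_label_full)
    then show thesis using zero[OF r(1) IIb_walk(2)[OF r(3,4)]] by blast
  next
    case 5
    then obtain u \<alpha> \<beta> w where r: "r = path_elem u [\<alpha>, \<beta>]" "B.sgwalk u [\<alpha>, \<beta>] w"
      "underlying \<beta> \<noteq> next_arrow \<Gamma> (underlying \<alpha>)"
      unfolding type_III_relations_def by (rule B.lifted_zero_relationsE) auto
    then have "B.nf (u, [\<alpha>, \<beta>]) = None"
      by (intro B.nf_no_run) (auto simp: B.run_def apos_eq)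
    then show thesis using zero[OF r(1,2)] by blast
  qed
qed

lemma brauer_rels_carrier:
  assumes "(r :: _ \<Rightarrow>\<^sub>0 'k::field) \<in> brauer_rels" shows "Poly_Mapping.keys r \<subseteq> B.sgpaths"
  using assms
proof (cases rule: brauer_rels_cases)
  case (diff u p q w w')
  then have "(u, p) \<in> B.sgpaths" "(u, q) \<in> B.sgpaths" by (blast intro: B.sgwalk_in_sgpaths)+
  then show ?thesis using keys_path_elem_diff[of u p q] unfolding diff(1) by blast
next
  case (zero u p w)
  then show ?thesis using B.sgwalk_in_sgpaths[of u p w] by (simp add: path_elem_def)
qed

lemma brauer_rels_kernel:
  assumes "(r :: _ \<Rightarrow>\<^sub>0 'k::field) \<in> brauer_rels"
  shows "(\<Sum>k\<in>Poly_Mapping.keys r. if B.nf k = Some b then Poly_Mapping.lookup r k else 0) = 0"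
  using assms
proof (cases rule: brauer_rels_cases)
  case (diff u p q w w')
  show ?thesis unfolding diff(1) by (rule path_elem_diff_kernel) (rule diff(4))
next
  case (zero u p w)
  show ?thesis unfolding zero(1) by (rule path_elem_kernel) (rule zero(3))
qed

section \<open>Paths that the relations force to vanish or to coincide\<close>

abbreviation brauer_ideal :: "(('e sg_vertex, 'v sg_arrow) path \<Rightarrow>\<^sub>0 'k::field) set" where
  "brauer_ideal \<equiv> genideal (path_algebra (skew_brauer_quiver \<Gamma>)) brauer_rels"

lemma brauer_rels_subset: "(brauer_rels :: (_ \<Rightarrow>\<^sub>0 'k::field) set) \<subseteq> brauer_ideal"
  unfolding skew_brauer_quiver_def
  by (rule ring.genideal_self[OF B.G.ring_path_algebra]) (use brauer_rels_carrier in auto)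

lemma brauer_cover_ideal_brauer_ideal:
  "brauer_cover_ideal \<Gamma> (brauer_quiver \<Gamma>) id id (special_edges \<Gamma>) (brauer_ideal :: (_ \<Rightarrow>\<^sub>0 'k::field) set)"
proof (intro brauer_cover_ideal.intro path_ideal.intro K_algebra_ideal.intro K_algebra_ideal_axioms.intro
    brauer_cover_ideal_axioms.intro B.brauer_cover_axioms B.G.fin_digraph_axioms B.G.K_algebra_path_algebra)
  show "ideal (brauer_ideal :: (_ \<Rightarrow>\<^sub>0 'k) set) (path_algebra (sg_quiver (brauer_quiver \<Gamma>) (special_edges \<Gamma>)))"
    unfolding skew_brauer_quiver_def
    by (rule ring.genideal_ideal[OF B.G.ring_path_algebra]) (use brauer_rels_carrier in auto)
  show "commutativity_relations (brauer_quiver \<Gamma>) (special_edges \<Gamma>) \<subseteq> (brauer_ideal :: (_ \<Rightarrow>\<^sub>0 'k) set)"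
    using brauer_rels_subset by (auto simp: brauer_rels_def)
  fix u \<alpha> \<beta> w assume "B.sgwalk u [\<alpha>, \<beta>] w" "B.apos \<beta> \<noteq> next_arrow \<Gamma> (B.apos \<alpha>)"
  then have "path_elem u [\<alpha>, \<beta>] \<in> (type_III_relations \<Gamma> :: (_ \<Rightarrow>\<^sub>0 'k) set)"
    unfolding type_III_relations_def lifted_zero_relations_def apos_eq by blast
  then show "path_elem u [\<alpha>, \<beta>] \<in> (brauer_ideal :: (_ \<Rightarrow>\<^sub>0 'k) set)"
    using brauer_rels_subset by (auto simp: brauer_rels_def)
qed

text \<open>Different signs over one edge exist only if the edge is special, so type IIb applies to
  a lift of the same power with the same end points; \<open>p\<close> has the same underlying arrows
  and is congruent to it.\<close>

lemma unequal_full_cycle_zero: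
  assumes p: "B.sgwalk u p w" "map underlying p = seg v i (L v)" and iv: "carries_arrows \<Gamma> v" "i < V v"
    and ne: "snd u \<noteq> snd w"
  shows "path_elem u p \<in> (brauer_ideal :: (_ \<Rightarrow>\<^sub>0 'k::field) set)"
proof -
  interpret J: brauer_cover_ideal \<Gamma> "brauer_quiver \<Gamma>" id id "special_edges \<Gamma>" "brauer_ideal :: (_ \<Rightarrow>\<^sub>0 'k) set"
    by (rule brauer_cover_ideal_brauer_ideal)
  have "0 < L v" using iv carries_arrows_vertex L_pos by blast
  then have p_ne: "p \<noteq> []" using arg_cong[OF p(2), of length] by auto
  have hd: "underlying (hd p) = (v, i)" using hd_map[OF p_ne, of underlying] p(2) hd_seg[of "L v" i v] \<open>0 < L v\<close> iv by simp
  have len: "length p = L v" using arg_cong[OF p(2), of length] by simp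
  have u: "fst u = cyc_at v i" using B.sgwalk_hd(3)[OF p(1) p_ne] hd by (simp add: apos_eq)
  have w: "fst w = cyc_at v i"
    using B.run_end[OF p(1) _ p_ne, of v i] run_iff_seg[OF p(1) p_ne hd] p(2) hd iv(2) len by (simp add: apos_eq)
  have e: "snd u \<in> sgn_at (cyc_at v i)" "snd w \<in> sgn_at (cyc_at v i)"
    using B.sgwalk_start(2)[OF p(1)] B.sgwalk_end(2)[OF p(1)] u w by auto
  then have special: "cyc_at v i \<in> special_edges \<Gamma>" using ne by (auto simp: signs_def split: if_splits)
  obtain c where c: "lifts_cycle \<Gamma> v i u c u" using lifts_cycle_exists[OF iv e(1) e(1)] u by (metis prod.collapse)
  obtain d where d: "lifts_cycle \<Gamma> v i u d w" using lifts_cycle_exists[OF iv e] u w by (metis prod.collapse)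
  have "lifts_cycle \<Gamma> v i (cyc_at v i, snd u) c (cyc_at v i, snd u)" "lifts_cycle \<Gamma> v i (cyc_at v i, snd u) d (cyc_at v i, snd w)"
    using c d u w by (metis prod.collapse)+
  then have "path_elem (cyc_at v i, snd u) (Defs.power c (mlt \<Gamma> v - 1) @ d) \<in> (type_IIb_relations \<Gamma> :: (_ \<Rightarrow>\<^sub>0 'k) set)"
    unfolding type_IIb_relations_def using special ne by blast
  moreover have "(cyc_at v i, snd u) = u" using u by (metis prod.collapse)
  ultimately have "path_elem u (Defs.power c (mlt \<Gamma> v - 1) @ d) \<in> (brauer_ideal :: (_ \<Rightarrow>\<^sub>0 'k) set)"
    using brauer_rels_subset by (auto simp: brauer_rels_def)
  then show ?thesis
    using J.split.path_cong_if_same_underlying[OF p(1) IIb_walk(2)[OF c d]] IIb_walk(1)[OF c d] p(2)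
      J.I.path_cong_zero by simp
qed

text \<open>The walk is a full power followed by its first arrow once more. At a special starting
  edge the sign before this last arrow can be exchanged so that the full power ends in the sign
  opposite to its initial one, and it vanishes by type IIb. At an ordinary edge there is no sign to
  choose, and the walk is congruent to a relation of type IIa.\<close>

lemma too_long_zero:
  assumes p: "B.sgwalk u p w" "map underlying p = seg v i (Suc (L v))" and iv: "carries_arrows \<Gamma> v" "i < V v"
  shows "path_elem u p \<in> (brauer_ideal :: (_ \<Rightarrow>\<^sub>0 'k::field) set)"
proof -
  interpret J: brauer_cover_ideal \<Gamma> "brauer_quiver \<Gamma>" id id "special_edges \<Gamma>" "brauer_ideal :: (_ \<Rightarrow>\<^sub>0 'k) set"
    by (rule brauer_cover_ideal_brauer_ideal)
  let ?x = "cyc_at v i"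
  have L: "0 < L v" using iv carries_arrows_vertex L_pos by blast
  obtain q \<alpha> where q: "p = q @ [\<alpha>]" using arg_cong[OF p(2), of length] by (cases p rule: rev_cases) auto
  have uq: "map underlying q = seg v i (L v)" and u\<alpha>: "underlying \<alpha> = (v, i)"
    using p(2) iv(2) by (simp_all add: q seg_Suc)
  obtain s a g where \<alpha>: "\<alpha> = (s, a, g)" by (cases \<alpha>)
  then have a: "a = (v, i)" using u\<alpha> by simp
  have q_walk: "B.sgwalk u q (?x, s)" and w: "w = (cyc_at v (Suc i mod V v), g)"
    and sg: "s \<in> sgn_at ?x" "g \<in> sgn_at (cyc_at v (Suc i mod V v))"
    using p(1) unfolding q B.G.awalk_snoc_iff \<alpha> a by auto
  have "length q = L v" using arg_cong[OF uq, of length] by simp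
  then have q_ne: "q \<noteq> []" using L by auto
  have "underlying (hd q) = (v, i)" using hd_map[OF q_ne, of underlying] uq hd_seg[OF L iv(2)] by simp
  then have u: "fst u = ?x" using B.sgwalk_hd(3)[OF q_walk q_ne] by (simp add: apos_eq)
  have e: "snd u \<in> sgn_at ?x" using B.sgwalk_start(2)[OF q_walk] u by simp
  show ?thesis
  proof (cases "?x \<in> special_edges \<Gamma>")
    case True
    obtain f where f: "f \<in> sgn_at ?x" "f \<noteq> snd u" using True by (auto simp: signs_def) (metis sign.distinct(1))
    obtain q' where q': "map underlying q' = seg v i (L v)" "B.sgwalk u q' (?x, f)"
      using lift_seg[OF iv L, of "snd u" f] e f u iv(2) by (metis (no_types, lifting) mod_less mod_mult_self1 mult.commute prod.collapse)
    have step: "B.sgwalk (?x, f) [(f, (v, i), g)] w"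
      using iv f sg w carries_arrows_vertex at_edges mod_less_divisor[of "V v" "Suc i"] by auto
    have "path_elem u q' \<in> (brauer_ideal :: (_ \<Rightarrow>\<^sub>0 'k) set)"
      using unequal_full_cycle_zero[OF q'(2,1) iv] f by simp
    then have "path_elem u (q' @ [(f, (v, i), g)]) \<in> (brauer_ideal :: (_ \<Rightarrow>\<^sub>0 'k) set)"
      using J.I.zero_path_prepend q'(2) step by blast
    moreover have "J.I.path_cong u p (q' @ [(f, (v, i), g)])"
    proof (rule J.split.path_cong_if_same_underlying[OF p(1)])
      show "B.sgwalk u (q' @ [(f, (v, i), g)]) w" using B.sgwalk_append[OF q'(2)] step by blast
      show "map underlying p = map underlying (q' @ [(f, (v, i), g)])" by (simp add: q uq q' u\<alpha>)
    qed
    ultimately show ?thesis using J.I.path_cong_zero by blast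
  next
    case False
    then have su: "s = SEmpty" "snd u = SEmpty" using sg e by (auto simp: signs_def)
    have uu: "u = (?x, SEmpty)" using u su by (metis prod.collapse)
    have step: "B.sgwalk u [\<alpha>] w"
      using iv sg su w uu \<alpha> a carries_arrows_vertex at_edges mod_less_divisor[of "V v" "Suc i"] by auto
    \<comment> \<open>Type IIa asks for a closed lift of the cycle beginning with the very arrow
      \<open>\<alpha>\<close> that ends the walk, signs included.\<close>
    have "\<exists>c. lifts_cycle \<Gamma> v i u c u \<and> hd c = \<alpha>"
    proof (cases "V v = 1")
      case True
      then have "i = 0" "w = u" using iv False sg w uu by (auto simp: signs_def)
      then show ?thesis using True iv step u\<alpha> by (intro exI[of _ "[\<alpha>]"]) (auto simp: lifts_cycle_iff seg_def)
    next
      case V: False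
      let ?j = "Suc i mod V v"
      have j: "?j < V v" using iv by (intro mod_less_divisor) auto
      have full: "(?j + (V v - 1)) mod V v = i"
      proof -
        have "(?j + (V v - 1)) mod V v = (Suc i + (V v - 1)) mod V v" by (rule mod_add_left_eq)
        also have "Suc i + (V v - 1) = i + V v" using iv by simp
        finally show ?thesis using iv by simp
      qed
      obtain c where c: "map underlying c = seg v ?j (V v - 1)" "B.sgwalk w c u"
        using lift_seg[OF iv(1) j, of "V v - 1" g SEmpty] V iv e sg(2) su uu w unfolding full by auto
      have "(v, i) # seg v ?j (V v - 1) = seg v i (V v)"
        using seg_append[of v i 1 "V v - 1"] iv by (simp add: seg_def)
      moreover have "B.sgwalk u (\<alpha> # c) u" using B.sgwalk_append[OF step, of c u] c(2) by simp
      ultimately show ?thesis using iv c u\<alpha> by (intro exI[of _ "\<alpha> # c"]) (simp add: lifts_cycle_iff)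
    qed
    then obtain c where c: "lifts_cycle \<Gamma> v i u c u" "hd c = \<alpha>" by blast
    have "path_elem u (Defs.power c (mlt \<Gamma> v) @ [hd c]) \<in> (type_IIa_relations \<Gamma> :: (_ \<Rightarrow>\<^sub>0 'k) set)"
      unfolding type_IIa_relations_def sg_special_cycle_def using c by blast
    then have "path_elem u (Defs.power c (mlt \<Gamma> v) @ [hd c]) \<in> (brauer_ideal :: (_ \<Rightarrow>\<^sub>0 'k) set)"
      using brauer_rels_subset by (auto simp: brauer_rels_def)
    moreover have "J.I.path_cong u p (Defs.power c (mlt \<Gamma> v) @ [hd c])"
    proof (rule J.split.path_cong_if_same_underlying[OF p(1)])
      show "B.sgwalk u (Defs.power c (mlt \<Gamma> v) @ [hd c]) w"
        using B.sgwalk_append[OF power_walk(2)[OF c(1)]] step c(2) by simp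
      show "map underlying p = map underlying (Defs.power c (mlt \<Gamma> v) @ [hd c])"
        unfolding IIa_walk(1)[OF c(1)] p(2) ..
    qed
    ultimately show ?thesis using J.I.path_cong_zero by blast
  qed
qed

lemma path_normal_form_brauer:
  "path_normal_form (skew_brauer_quiver \<Gamma>) (brauer_rels :: (_ \<Rightarrow>\<^sub>0 'k::field) set) B.nf label_mul"
proof -
  interpret J: brauer_cover_ideal \<Gamma> "brauer_quiver \<Gamma>" id id "special_edges \<Gamma>" "brauer_ideal :: (_ \<Rightarrow>\<^sub>0 'k) set"
    by (rule brauer_cover_ideal_brauer_ideal)
  have carries: "carries_arrows \<Gamma> v" "i < V v" "map underlying p = seg v i (length p)" "fst u = cyc_at v i"
    if "B.sgwalk u p w" "p \<noteq> []" "B.run p" "underlying (hd p) = (v, i)" for u p w v i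
  proof -
    show "map underlying p = seg v i (length p)" using run_iff_seg that by blast
    show "i < V v" "fst u = cyc_at v i" using B.sgwalk_hd(2,3)[OF that(1,2)] that(4) by (simp_all add: apos_eq)
    have "underlying (hd p) \<in> arcs (brauer_quiver \<Gamma>)"
      using B.sgwalk_underlying[OF that(1), of "hd p"] that(2) by simp
    then show "carries_arrows \<Gamma> v" using that(4) by simp
  qed
  show ?thesis
    unfolding skew_brauer_quiver_def
  proof (intro path_normal_form.intro path_normal_form_axioms.intro B.G.fin_digraph_axioms)
    fix r :: "_ \<Rightarrow>\<^sub>0 'k" and b assume "r \<in> brauer_rels"
    then show "Poly_Mapping.keys r \<subseteq> B.sgpaths"
      "(\<Sum>p\<in>Poly_Mapping.keys r. if B.nf p = Some b then Poly_Mapping.lookup r p else 0) = 0"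
      by (rule brauer_rels_carrier, rule brauer_rels_kernel)
  next
    fix p assume "p \<in> B.sgpaths" and nf: "B.nf p = None"
    then obtain u p' w where p: "p = (u, p')" and walk: "B.sgwalk u p' w" by (auto simp: quiver_paths_def)
    have "path_elem u p' \<in> (brauer_ideal :: (_ \<Rightarrow>\<^sub>0 'k) set)"
    proof (cases "B.run p'")
      case True
      have ne: "p' \<noteq> []" using nf p by auto
      obtain v i where vi: "underlying (hd p') = (v, i)" by (cases "underlying (hd p')")
      note c = carries[OF walk ne True vi]
      have "0 < length p'" using ne by simp
      then have "arc_label v i (length p') (snd u) (snd w) = None"
        using nf_seg[OF walk c(3) _ c(2)] nf p by simp
      then have "\<not> length p' < L v" "length p' = L v \<Longrightarrow> snd u \<noteq> snd w"
        by (auto simp: arc_label_def split: if_splits)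
      \<comment> \<open>A run without label either has full length and different outer signs, or is
        too long; in the latter case an initial part of length \<open>Suc (L v)\<close> already
        vanishes.\<close>
      then consider "length p' = L v" "snd u \<noteq> snd w" | "Suc (L v) \<le> length p'" by linarith
      then show ?thesis
      proof cases
        case 1
        then show ?thesis using unequal_full_cycle_zero[OF walk _ c(1,2)] c(3) by simp
      next
        case 2
        let ?q = "take (Suc (L v)) p'" and ?r = "drop (Suc (L v)) p'"
        obtain z where z: "B.sgwalk u ?q z" "B.sgwalk z ?r w"
          using walk B.G.awalk_append_iff[of u ?q ?r w] by (metis append_take_drop_id)
        have "map underlying ?q = seg v i (Suc (L v))"
          using 2 c(3) by (simp add: take_map[symmetric] seg_def take_map)
        then have "path_elem u ?q \<in> (brauer_ideal :: (_ \<Rightarrow>\<^sub>0 'k) set)" using too_long_zero[OF z(1) _ c(1,2)] by blast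
        then have "path_elem u (?q @ ?r) \<in> (brauer_ideal :: (_ \<Rightarrow>\<^sub>0 'k) set)" using J.I.zero_path_prepend z by blast
        then show ?thesis by simp
      qed
    qed (use J.zero_if_no_run walk in blast)
    then show "Poly_Mapping.single p 1 \<in> genideal (path_algebra (sg_quiver (brauer_quiver \<Gamma>) (special_edges \<Gamma>))) (brauer_rels :: (_ \<Rightarrow>\<^sub>0 'k) set)"
      by (simp add: p path_elem_def skew_brauer_quiver_def)
  next
    fix p q b assume "p \<in> B.sgpaths" "q \<in> B.sgpaths" and nf: "B.nf p = Some b" "B.nf q = Some b"
    then obtain u p' w u' q' w' where p: "p = (u, p')" "B.sgwalk u p' w" and q: "q = (u', q')" "B.sgwalk u' q' w'"
      by (auto simp: quiver_paths_def)
    have "u = u' \<and> path_elem u p' - path_elem u q' \<in> (brauer_ideal :: (_ \<Rightarrow>\<^sub>0 'k) set)"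
    proof (cases "\<exists>x e. b = Soc x e")
      case False
      then show ?thesis using J.equal_paths_below_socle[OF p(2) q(2)] nf p(1) q(1) by blast
    next
      case True
      then obtain x e where b: "b = Soc x e" by blast
      \<comment> \<open>A path in the socle is congruent to a power of a closed lift of the special
        cycle it follows; type I then compares the two cycles.\<close>
      have *: "u = (x, e) \<and> (\<exists>v i c. lifts_cycle \<Gamma> v i u c u \<and> J.I.path_cong u p (Defs.power c (mlt \<Gamma> v)))"
        if walk: "B.sgwalk u p w" and nf: "B.nf (u, p) = Some b" for u p w
      proof -
        note st = B.nf_source_target[OF walk nf]
        then have u: "u = (x, e)" "w = (x, e)" by (auto simp: b prod_eq_iff)
        have ne: "p \<noteq> []" using nf b by auto
        have run: "B.run p" using nf B.nf_no_run[OF ne, of u] by auto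
        obtain v i where vi: "underlying (hd p) = (v, i)" by (cases "underlying (hd p)")
        note c = carries[OF walk ne run vi]
        have "0 < length p" using ne by simp
        then have "arc_label v i (length p) (snd u) (snd w) = Some (Soc x e)"
          using nf_seg[OF walk c(3) _ c(2)] nf b by simp
        then have len: "length p = L v" by (auto simp: arc_label_def split: if_splits)
        have "e \<in> sgn_at (cyc_at v i)" using B.sgwalk_start(2)[OF walk] c(4) u by simp
        then obtain d where d: "lifts_cycle \<Gamma> v i u d u" using lifts_cycle_exists[OF c(1,2)] u c(4) by (metis fst_conv)
        have "J.I.path_cong u p (Defs.power d (mlt \<Gamma> v))"
          using walk u power_walk[OF d, of "mlt \<Gamma> v"] c(3) len
          by (intro J.split.path_cong_if_same_underlying[of u p w]) auto
        then show ?thesis using u d by blast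
      qed
      obtain v i c v' i' c' where c: "u = (x, e)" "u' = (x, e)" "lifts_cycle \<Gamma> v i u c u"
        "J.I.path_cong u p' (Defs.power c (mlt \<Gamma> v))"
        "lifts_cycle \<Gamma> v' i' u' c' u'" "J.I.path_cong u' q' (Defs.power c' (mlt \<Gamma> v'))"
        using *[OF p(2)] *[OF q(2)] nf p(1) q(1) by blast
      have "path_elem u (Defs.power c (mlt \<Gamma> v)) - path_elem u (Defs.power c' (mlt \<Gamma> v')) \<in> (type_I_relations \<Gamma> :: (_ \<Rightarrow>\<^sub>0 'k) set)"
        unfolding type_I_relations_def sg_special_cycle_def using c by blast
      then have "J.I.path_cong u (Defs.power c (mlt \<Gamma> v)) (Defs.power c' (mlt \<Gamma> v'))"
        unfolding J.I.path_cong_def using brauer_rels_subset by (auto simp: brauer_rels_def)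
      then have "J.I.path_cong u p' q'"
        using c J.I.path_cong_trans J.I.path_cong_sym by metis
      then show ?thesis using c by (simp add: J.I.path_cong_def)
    qed
    then show "Poly_Mapping.single p 1 - Poly_Mapping.single q 1
        \<in> genideal (path_algebra (sg_quiver (brauer_quiver \<Gamma>) (special_edges \<Gamma>))) (brauer_rels :: (_ \<Rightarrow>\<^sub>0 'k) set)"
      by (auto simp: p q path_elem_def skew_brauer_quiver_def)
  qed (rule B.nf_mul B.nf_zero; assumption)+
qed

text \<open>If both ends of an edge are truncated, the convention in \<open>carries_arrows\<close>
  keeps their loops; otherwise an end that is not truncated carries arrows anyway. Without such an
  end no path would have the label \<open>Soc x e\<close>.\<close>

lemma carrying_end:
  assumes "x \<in> edges \<Gamma>"
  obtains v i where "carries_arrows \<Gamma> v" "i < V v" "cyc_at v i = x"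
proof -
  obtain w where w: "w \<in># ends \<Gamma> x" using ends[OF assms] by (metis multiset_nonemptyE size_empty zero_neq_numeral)
  have "\<exists>v. v \<in># ends \<Gamma> x \<and> carries_arrows \<Gamma> v"
  proof (cases "\<forall>v \<in># ends \<Gamma> x. truncated \<Gamma> v")
    case True
    then show ?thesis using w assms ends[OF assms] by (auto simp: carries_arrows_def)
  next
    case False
    then show ?thesis using ends[OF assms] by (auto simp: carries_arrows_def)
  qed
  then obtain v where v: "v \<in># ends \<Gamma> x" "carries_arrows \<Gamma> v" by blast
  have vv: "v \<in> vertices \<Gamma>" using v(2) by (rule carries_arrows_vertex)
  have "count_list (cyc \<Gamma> v) x \<noteq> 0" using cyc_count[OF vv assms] v(1) by simp
  then have "x \<in> set (cyc \<Gamma> v)" by (metis count_notin)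
  then obtain i where "i < length (cyc \<Gamma> v)" "cyc_at v i = x" by (auto simp: in_set_conv_nth)
  then show thesis using that v(2) val_eq_length[OF vv] by simp
qed

lemma nf_image: "{b. \<exists>p\<in>B.sgpaths. B.nf p = Some b} = {l. valid_label l}"
proof (intro equalityI subsetI)
  fix l assume "l \<in> {b. \<exists>p\<in>B.sgpaths. B.nf p = Some b}"
  then obtain u p w where "B.sgwalk u p w" "B.nf (u, p) = Some l" by (auto simp: quiver_paths_def)
  then show "l \<in> {l. valid_label l}" using B.nf_source_target(3) by simp
next
  fix l assume "l \<in> {l. valid_label l}"
  then have l: "valid_label l" by simp
  have "\<exists>p\<in>B.sgpaths. B.nf p = Some l"
  proof (cases l)
    case (Triv x e)
    then show ?thesis using l by (intro bexI[of _ "((x, e), [])"]) (auto simp: quiver_paths_def)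
  next
    case (Soc x e)
    then have xe: "x \<in> edges \<Gamma>" "e \<in> sgn_at x" using l by auto
    obtain v i where vi: "carries_arrows \<Gamma> v" "i < V v" "cyc_at v i = x" using carrying_end[OF xe(1)] .
    obtain c where "lifts_cycle \<Gamma> v i (x, e) c (x, e)" using lifts_cycle_exists[OF vi(1,2)] xe vi(3) by blast
    then show ?thesis
      using nf_full_cycle B.sgwalk_in_sgpaths[OF power_walk(2)] Soc by fastforce
  next
    case (Arc v i n e f)
    then have a: "v \<in> vertices \<Gamma>" "i < V v" "0 < n" "n < L v" "e \<in> sgn_at (cyc_at v i)" "f \<in> sgn_at (cyc_at v ((i + n) mod V v))"
      using l by auto
    then have "L v \<noteq> 1" by linarith
    then have "carries_arrows \<Gamma> v" using a(1) unfolding carries_arrows_def truncated_def by blast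
    from lift_seg[OF this a(2,3,5,6)] obtain c where c: "map underlying c = seg v i n"
      "B.sgwalk (cyc_at v i, e) c (cyc_at v ((i + n) mod V v), f)" by blast
    then have "B.nf ((cyc_at v i, e), c) = Some l" using nf_seg[OF c(2,1) a(3,2)] a Arc by (simp add: arc_label_def)
    then show ?thesis using B.sgwalk_in_sgpaths[OF c(2)] by blast
  qed
  then show "l \<in> {b. \<exists>p\<in>B.sgpaths. B.nf p = Some b}" by simp
qed

theorem monomial_algebra_brauer:
  "\<exists>\<kappa>. monomial_algebra (skew_brauer_graph_algebra \<Gamma> :: ('k::field, _) module) {l. valid_label l} \<kappa>
     (\<lambda>m n b. label_mul m n = Some b)"
proof -
  interpret N: path_normal_form "skew_brauer_quiver \<Gamma>" "brauer_rels :: (_ \<Rightarrow>\<^sub>0 'k) set" B.nf label_mul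
    by (rule path_normal_form_brauer)
  have "N.path_classes = {l. valid_label l}"
    by (rule trans[OF N.path_classes_def nf_image[folded skew_brauer_quiver_def]])
  then show ?thesis
    using N.monomial_algebra finite_valid_label
    by (auto simp: skew_brauer_graph_algebra_def brauer_rels_def)
qed

theorem skew_brauer_graph_algebra_symmetric:
  "K_algebra (skew_brauer_graph_algebra \<Gamma> :: ('k::field, _) module)"
  "fin_dim (skew_brauer_graph_algebra \<Gamma> :: ('k, _) module)"
  "symmetric_algebra (skew_brauer_graph_algebra \<Gamma> :: ('k, _) module)"
proof -
  obtain \<kappa> where "monomial_algebra (skew_brauer_graph_algebra \<Gamma> :: ('k, _) module) {l. valid_label l} \<kappa>
     (\<lambda>m n b. label_mul m n = Some b)"
    using monomial_algebra_brauer by blast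
  then interpret M: monomial_algebra "skew_brauer_graph_algebra \<Gamma> :: ('k, _) module" "{l. valid_label l}" \<kappa>
     "\<lambda>m n b. label_mul m n = Some b" .
  show "K_algebra (skew_brauer_graph_algebra \<Gamma> :: ('k, _) module)" by (rule M.K_algebra)
  show "fin_dim (skew_brauer_graph_algebra \<Gamma> :: ('k, _) module)" by (rule M.fin_dim_if_finite[OF finite_valid_label])
  show "symmetric_algebra (skew_brauer_graph_algebra \<Gamma> :: ('k, _) module)"
    by (rule M.symmetric_algebraI[of dual_label]) (auto simp: valid_dual_label dual_dual_label label_mul_cyclic)
qed

end

section \<open>Cutting the special cycles\<close>

context skew_brauer_graph
begin

lemma special_edge_ends:
  assumes "x \<in> special_edges \<Gamma>"
  obtains s w where "ends \<Gamma> x = {#s, w#}" "s \<in> special \<Gamma>" "V s = 1" "w \<in> vertices \<Gamma>" "s \<noteq> w"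
proof -
  obtain s where s: "s \<in> special \<Gamma>" "s \<in># ends \<Gamma> x" "x \<in> edges \<Gamma>" using assms by (auto simp: special_edges_def)
  obtain y w where y: "cyc \<Gamma> s = [y]" "w \<in> vertices \<Gamma> - special \<Gamma>" "ends \<Gamma> y = {#s, w#}"
    using special_vertex[OF s(1)] by blast
  have sv: "s \<in> vertices \<Gamma>" using s special_subset by auto
  have "count_list (cyc \<Gamma> s) x > 0" using cyc_count[OF sv s(3)] s(2) by simp
  then have "y = x" using y by (auto split: if_splits)
  then show thesis using that y s val_eq_length[OF sv] by auto
qed

lemma count_list_one_unique:
  "count_list xs x = 1 \<Longrightarrow> i < length xs \<Longrightarrow> j < length xs \<Longrightarrow> xs ! i = x \<Longrightarrow> xs ! j = x \<Longrightarrow> i = j"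
proof (induction xs arbitrary: i j)
  case (Cons a xs)
  show ?case
  proof (cases "a = x")
    case True
    then have "x \<notin> set xs" using Cons.prems(1) by (simp add: count_list_0_iff)
    then show ?thesis using Cons.prems by (cases i; cases j) auto
  next
    case False
    then show ?thesis using Cons by (cases i; cases j) auto
  qed
qed simp

text \<open>The special end has valency one, so a vertex of larger valency where the edge occurs is
  its other end, and there it occurs once. It follows that a special vertex of the cut quiver has at
  most one arrow in and one out, and that these are consecutive.\<close>

lemma special_edge_position:
  assumes "x \<in> special_edges \<Gamma>" "v \<in> vertices \<Gamma>" "w \<in> vertices \<Gamma>" "1 < V v" "1 < V w"
    "i < V v" "j < V w" "cyc_at v i = x" "cyc_at w j = x"
  shows "v = w" "i = j"
proof -
  obtain s t where st: "ends \<Gamma> x = {#s, t#}" "V s = 1" "t \<in> vertices \<Gamma>" "s \<noteq> t"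
    using special_edge_ends[OF assms(1)] by metis
  have x: "x \<in> edges \<Gamma>" using assms(1) by (simp add: special_edges_def)
  have "x \<in> set (cyc \<Gamma> v)" "x \<in> set (cyc \<Gamma> w)"
    using nth_mem[of i "cyc \<Gamma> v"] nth_mem[of j "cyc \<Gamma> w"] assms val_eq_length[OF assms(2)] val_eq_length[OF assms(3)]
    by simp_all
  then have "count_list (cyc \<Gamma> v) x \<noteq> 0" "count_list (cyc \<Gamma> w) x \<noteq> 0"
    by (simp_all add: count_list_0_iff)
  then have "v \<in># ends \<Gamma> x" "w \<in># ends \<Gamma> x"
    using cyc_count[OF assms(2) x] cyc_count[OF assms(3) x] by (simp_all add: count_eq_zero_iff)
  then have "v = t" "w = t" using st assms(4,5) by auto
  then show vw: "v = w" by simp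
  have "count_list (cyc \<Gamma> t) x = 1" using cyc_count[OF st(3) x] st by simp
  then show "i = j"
    using count_list_one_unique[of "cyc \<Gamma> t" x i j] assms val_eq_length[OF assms(2)] \<open>v = t\<close> \<open>w = t\<close> by simp
qed

end

text \<open>
  A quiver obtained from that of \<open>\<Gamma>\<close> by removing the last arrow of every special cycle.
\<close>

locale cut_cover = brauer_cover \<Gamma> Q \<gamma> pos S
  for \<Gamma> :: "('v, 'e) skew_brauer_graph" and Q :: "('x, 'a) pre_digraph" and \<gamma> pos S +
  fixes P :: "('a \<times> 'a) set"
  assumes mult_one: "multiplicity_one \<Gamma>"
    and pos_image: "pos ` arcs Q = {(v, i). v \<in> vertices \<Gamma> \<and> Suc i < val \<Gamma> v}"
    and \<gamma>_image: "\<gamma> ` verts Q = edges \<Gamma>"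
    and zero_pairs: "a \<in> arcs Q \<Longrightarrow> b \<in> arcs Q \<Longrightarrow> head Q a = tail Q b \<Longrightarrow>
      (a, b) \<in> P \<longleftrightarrow> pos b \<noteq> next_arrow \<Gamma> (pos a) \<and> head Q a \<notin> S"
begin

section \<open>The grading by removed arrows\<close>

lemma L_eq_V: "v \<in> vertices \<Gamma> \<Longrightarrow> L v = V v"
  using mult_one by (simp add: multiplicity_one_def)

text \<open>How often a walk with this label passes the removed arrow. The arrow in position
  \<open>V v - 1\<close> is passed each time the running position completes a multiple of
  \<open>V v\<close>; a socle element runs round once, the multiplicity being one.\<close>

fun cuts :: "('v, 'e) label \<Rightarrow> nat" where
  "cuts (Triv x e) = 0"
| "cuts (Soc x e) = 1"
| "cuts (Arc v i n e f) = (i + n) div V v"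

text \<open>An arc and its complement make one full turn, which passes the removed arrow exactly
  once.\<close>

lemma cuts_dual_label: "valid_label l \<Longrightarrow> cuts l + cuts (dual_label l) = 1"
proof (cases l)
  case (Arc v i n e f)
  assume "valid_label l"
  then have "v \<in> vertices \<Gamma>" "i < V v" "0 < n" "n < L v" using Arc by auto
  then have *: "v \<in> vertices \<Gamma>" "i < V v" "0 < n" "n < V v" using L_eq_V[of v] by auto
  have "(i + n) div V v + ((i + n) mod V v + (V v - n)) div V v = (i + n + (V v - n)) div V v"
  proof -
    have "i + n + (V v - n) = ((i + n) mod V v + (V v - n)) + V v * ((i + n) div V v)"
      using div_mult_mod_eq[of "i + n" "V v"] by (simp add: mult.commute)
    moreover have "V v \<noteq> 0" using * by linarith
    ultimately show ?thesis by (metis div_mult_self2 add.commute)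
  qed
  also have "i + n + (V v - n) = i + V v" using * by simp
  also have "(i + V v) div V v = 1" using * by simp
  finally show ?thesis using Arc * L_eq_V[of v] by simp
qed auto

lemma cuts_label_mul:
  assumes "valid_label l" "valid_label m" "label_mul l m = Some n"
  shows "cuts n = cuts l + cuts m"
proof (cases l)
  case (Triv x e)
  then show ?thesis using assms by (auto split: if_splits)
next
  case l: (Soc x e)
  then show ?thesis using assms by (cases m) (auto split: if_splits)
next
  case l: (Arc v i k e f)
  show ?thesis
  proof (cases m)
    case (Triv y g)
    then show ?thesis using assms l by (auto split: if_splits)
  next
    case (Soc y g)
    then show ?thesis using assms l by simp
  next
    case m: (Arc w j k' g h)
    then have eqs: "w = v" "j = (i + k) mod V v" and n: "arc_label v i (k + k') e h = Some n"
      using assms l by (auto split: if_splits)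
    have v: "v \<in> vertices \<Gamma>" "i < V v" using assms l by auto
    have "(i + (k + k')) div V v = (i + k) div V v + ((i + k) mod V v + k') div V v"
    proof -
      have "i + (k + k') = ((i + k) mod V v + k') + V v * ((i + k) div V v)"
        using div_mult_mod_eq[of "i + k" "V v"] by (simp add: mult.commute)
      moreover have "V v \<noteq> 0" using v by linarith
      ultimately show ?thesis by (metis div_mult_self2 add.commute)
    qed
    moreover have "cuts n = (i + (k + k')) div V v"
      using n v L_eq_V[OF v(1)] by (auto simp: arc_label_def split: if_splits)
    ultimately show ?thesis using eqs by (simp add: l m)
  qed
qed

lemma cut_arrow:
  assumes "a \<in> arcs Q"
  shows "fst (pos a) \<in> vertices \<Gamma>" "Suc (snd (pos a)) < V (fst (pos a))"
proof -
  have "pos a \<in> pos ` arcs Q" using assms by blast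
  then show "fst (pos a) \<in> vertices \<Gamma>" "Suc (snd (pos a)) < V (fst (pos a))"
    unfolding pos_image by auto
qed

text \<open>\<open>P\<close> contains no pair of arrows meeting at a special vertex, and none is
  missing: arrows composable there always follow each other on a special cycle.\<close>

lemma special_composable:
  assumes "a \<in> arcs Q" "b \<in> arcs Q" "head Q a = tail Q b" "head Q a \<in> S"
  shows "pos b = next_arrow \<Gamma> (pos a)"
proof -
  note A = cut_arrow[OF assms(1)] and B = cut_arrow[OF assms(2)]
  have "\<gamma> (head Q a) \<in> special_edges \<Gamma>" using \<gamma>_special assms(1,4) Q.head_in_verts by blast
  moreover have "cyc_at (fst (pos a)) (Suc (snd (pos a))) = \<gamma> (head Q a)" using pos_head[OF assms(1)] A by simp
  moreover have "cyc_at (fst (pos b)) (snd (pos b)) = \<gamma> (head Q a)" using pos_tail[OF assms(2)] assms(3) by simp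
  ultimately have "fst (pos a) = fst (pos b)" "Suc (snd (pos a)) = snd (pos b)"
    using special_edge_position[of "\<gamma> (head Q a)" "fst (pos a)" "fst (pos b)" "Suc (snd (pos a))" "snd (pos b)"] A B by auto
  then show ?thesis using A by (simp add: next_arrow_def prod_eq_iff split: prod.split)
qed

section \<open>A basis of the cut algebra\<close>

definition cut_rels :: "(('x \<times> sign, 'a signed_arrow) path \<Rightarrow>\<^sub>0 'k::field) set" where
  "cut_rels = commutativity_relations Q S \<union> lifted_zero_relations Q S P"

lemma cut_rels_cases:
  assumes "(r :: _ \<Rightarrow>\<^sub>0 'k::field) \<in> cut_rels"
  obtains (diff) u p q w w' where "r = path_elem u p - path_elem u q" "sgwalk u p w" "sgwalk u q w'"
      "nf (u, p) = nf (u, q)"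
    | (zero) u p w where "r = path_elem u p" "sgwalk u p w" "nf (u, p) = None"
proof -
  consider "r \<in> commutativity_relations Q S" | "r \<in> lifted_zero_relations Q S P"
    using assms unfolding cut_rels_def by blast
  then show thesis
  proof cases
    case 1
    then obtain u p q w where "r = path_elem u p - path_elem u q" "sgwalk u p w" "sgwalk u q w"
      "map underlying p = map underlying q"
      by (rule commutativity_relationsE)
    then show thesis using nf_eq_if_same_underlying diff by blast
  next
    case 2
    then obtain u \<alpha> \<beta> w where r: "r = path_elem u [\<alpha>, \<beta>]" "sgwalk u [\<alpha>, \<beta>] w" "(underlying \<alpha>, underlying \<beta>) \<in> P"
      by (rule lifted_zero_relationsE)
    have "underlying \<alpha> \<in> arcs Q" "underlying \<beta> \<in> arcs Q" "head Q (underlying \<alpha>) = tail Q (underlying \<beta>)"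
      using r(2) by (cases \<alpha>; cases \<beta>; auto)+
    then have "apos \<beta> \<noteq> next_arrow \<Gamma> (apos \<alpha>)" using zero_pairs r(3) by (simp add: apos_def)
    then have "nf (u, [\<alpha>, \<beta>]) = None" by (intro nf_no_run) (auto simp: run_def)
    then show thesis using zero[OF r(1,2)] by blast
  qed
qed

lemma cut_rels_carrier:
  assumes "(r :: _ \<Rightarrow>\<^sub>0 'k::field) \<in> cut_rels" shows "Poly_Mapping.keys r \<subseteq> sgpaths"
  using assms
proof (cases rule: cut_rels_cases)
  case (diff u p q w w')
  then have "(u, p) \<in> sgpaths" "(u, q) \<in> sgpaths" by (blast intro: sgwalk_in_sgpaths)+
  then show ?thesis using keys_path_elem_diff[of u p q] unfolding diff(1) by blast
next
  case (zero u p w)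
  then show ?thesis using sgwalk_in_sgpaths[of u p w] by (simp add: path_elem_def)
qed

lemma cut_rels_kernel:
  assumes "(r :: _ \<Rightarrow>\<^sub>0 'k::field) \<in> cut_rels"
  shows "(\<Sum>k\<in>Poly_Mapping.keys r. if nf k = Some b then Poly_Mapping.lookup r k else 0) = 0"
  using assms
proof (cases rule: cut_rels_cases)
  case (diff u p q w w')
  show ?thesis unfolding diff(1) by (rule path_elem_diff_kernel) (rule diff(4))
next
  case (zero u p w)
  show ?thesis unfolding zero(1) by (rule path_elem_kernel) (rule zero(3))
qed

abbreviation cut_ideal :: "(('x \<times> sign, 'a signed_arrow) path \<Rightarrow>\<^sub>0 'k::field) set" where
  "cut_ideal \<equiv> genideal (path_algebra (sg_quiver Q S)) cut_rels"

lemma cut_rels_subset: "(cut_rels :: (_ \<Rightarrow>\<^sub>0 'k::field) set) \<subseteq> cut_ideal"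
  by (rule ring.genideal_self[OF G.ring_path_algebra]) (use cut_rels_carrier in auto)

lemma brauer_cover_ideal_cut_ideal:
  "brauer_cover_ideal \<Gamma> Q \<gamma> pos S (cut_ideal :: (_ \<Rightarrow>\<^sub>0 'k::field) set)"
proof (intro brauer_cover_ideal.intro path_ideal.intro K_algebra_ideal.intro K_algebra_ideal_axioms.intro
    brauer_cover_ideal_axioms.intro brauer_cover_axioms G.fin_digraph_axioms G.K_algebra_path_algebra)
  show "ideal (cut_ideal :: (_ \<Rightarrow>\<^sub>0 'k) set) (path_algebra (sg_quiver Q S))"
    by (rule ring.genideal_ideal[OF G.ring_path_algebra]) (use cut_rels_carrier in auto)
  show "commutativity_relations Q S \<subseteq> (cut_ideal :: (_ \<Rightarrow>\<^sub>0 'k) set)"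
    using cut_rels_subset by (auto simp: cut_rels_def)
  fix u \<alpha> \<beta> w assume walk: "sgwalk u [\<alpha>, \<beta>] w" and ne: "apos \<beta> \<noteq> next_arrow \<Gamma> (apos \<alpha>)"
  have "underlying \<alpha> \<in> arcs Q" "underlying \<beta> \<in> arcs Q" "head Q (underlying \<alpha>) = tail Q (underlying \<beta>)"
    using walk by (cases \<alpha>; cases \<beta>; auto)+
  then have "(underlying \<alpha>, underlying \<beta>) \<in> P"
    using zero_pairs special_composable ne by (auto simp: apos_def)
  then have "path_elem u [\<alpha>, \<beta>] \<in> (lifted_zero_relations Q S P :: (_ \<Rightarrow>\<^sub>0 'k) set)"
    unfolding lifted_zero_relations_def using walk by blast
  then show "path_elem u [\<alpha>, \<beta>] \<in> (cut_ideal :: (_ \<Rightarrow>\<^sub>0 'k) set)"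
    using cut_rels_subset by (auto simp: cut_rels_def)
qed

text \<open>To return to position zero a run would have to use the arrow in the last position, which
  was removed.\<close>

lemma run_below_cut:
  assumes "sgwalk u p w" "run p" "p \<noteq> []" "apos (hd p) = (v, i)"
  shows "v \<in> vertices \<Gamma>" "i + length p < V v"
proof -
  have iv: "v \<in> vertices \<Gamma>" "i < V v" using sgwalk_hd(1,2)[OF assms(1,3)] assms(4) by auto
  then show "v \<in> vertices \<Gamma>" by simp
  have "k \<le> length p \<Longrightarrow> i + k < V v" for k
  proof (induction k)
    case (Suc k)
    then have "apos (p ! k) = (v, i + k)" using run_nth[OF assms(2) _ assms(4) iv(2), of k] by simp
    moreover have "underlying (p ! k) \<in> arcs Q" using sgwalk_underlying[OF assms(1)] Suc.prems by simp
    ultimately show ?case using cut_arrow(2)[of "underlying (p ! k)"] by (simp add: apos_def)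
  qed (use iv in simp)
  then show "i + length p < V v" by simp
qed

text \<open>Runs stay shorter than \<open>L v\<close>, so none vanishes and none reaches the socle;
  this is why the cut algebra gets by with the analogues of types 0 and III.\<close>

lemma nf_cut:
  assumes "sgwalk u p w" "run p" "p \<noteq> []" "apos (hd p) = (v, i)"
  shows "nf (u, p) = Some (Arc v i (length p) (snd u) (snd w))"
  using run_below_cut[OF assms] nf_run[OF assms(3,2,4)] sgwalk_last(2)[OF assms(1,3)] L_eq_V
  by (simp add: arc_label_def)

lemma nf_not_Soc: "sgwalk u p w \<Longrightarrow> nf (u, p) \<noteq> Some (Soc x e)"
  using nf_cut[of u p w] nf_no_run[of p u] by (cases "p = []"; cases "run p") (auto simp: prod_eq_iff)

lemma path_normal_form_cut:
  "path_normal_form (sg_quiver Q S) (cut_rels :: (_ \<Rightarrow>\<^sub>0 'k::field) set) nf label_mul"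
proof -
  interpret J: brauer_cover_ideal \<Gamma> Q \<gamma> pos S "cut_ideal :: (_ \<Rightarrow>\<^sub>0 'k) set"
    by (rule brauer_cover_ideal_cut_ideal)
  show ?thesis
  proof (intro path_normal_form.intro path_normal_form_axioms.intro G.fin_digraph_axioms)
    fix r :: "_ \<Rightarrow>\<^sub>0 'k" and b assume "r \<in> cut_rels"
    then show "Poly_Mapping.keys r \<subseteq> sgpaths"
      "(\<Sum>p\<in>Poly_Mapping.keys r. if nf p = Some b then Poly_Mapping.lookup r p else 0) = 0"
      by (rule cut_rels_carrier, rule cut_rels_kernel)
  next
    fix p assume "p \<in> sgpaths" and nf: "nf p = None"
    then obtain u p' w where p: "p = (u, p')" and walk: "sgwalk u p' w" by (auto simp: quiver_paths_def)
    have "\<not> run p'"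
      using nf_cut[OF walk] nf p by (cases "p' = []"; cases "apos (hd p')") auto
    then have "path_elem u p' \<in> (cut_ideal :: (_ \<Rightarrow>\<^sub>0 'k) set)" using J.zero_if_no_run walk by blast
    then show "Poly_Mapping.single p 1 \<in> (cut_ideal :: (_ \<Rightarrow>\<^sub>0 'k) set)" by (simp add: p path_elem_def)
  next
    fix p q b assume "p \<in> sgpaths" "q \<in> sgpaths" and nf: "nf p = Some b" "nf q = Some b"
    then obtain u p' w u' q' w' where p: "p = (u, p')" "sgwalk u p' w" and q: "q = (u', q')" "sgwalk u' q' w'"
      by (auto simp: quiver_paths_def)
    have "b \<noteq> Soc x e" for x e using nf_not_Soc[OF p(2)] nf(1) p(1) by metis
    then have "u = u'" "path_elem u p' - path_elem u q' \<in> (cut_ideal :: (_ \<Rightarrow>\<^sub>0 'k) set)"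
      using J.equal_paths_below_socle[OF p(2) q(2)] nf p(1) q(1) by auto
    then show "Poly_Mapping.single p 1 - Poly_Mapping.single q 1 \<in> (cut_ideal :: (_ \<Rightarrow>\<^sub>0 'k) set)"
      by (auto simp: p q path_elem_def)
  qed (rule nf_mul nf_zero; assumption)+
qed

lemma nf_image_cut: "{b. \<exists>p\<in>sgpaths. nf p = Some b} = {l \<in> {l. valid_label l}. cuts l = 0}"
proof (intro equalityI subsetI)
  fix l assume "l \<in> {b. \<exists>p\<in>sgpaths. nf p = Some b}"
  then obtain u p w where walk: "sgwalk u p w" and l: "nf (u, p) = Some l" by (auto simp: quiver_paths_def)
  have "cuts l = 0"
  proof (cases "p = []")
    case False
    then have "run p" using l nf_no_run[of p u] by auto
    then show ?thesis
      using nf_cut[OF walk _ False, of "fst (apos (hd p))" "snd (apos (hd p))"]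
        run_below_cut[OF walk _ False, of "fst (apos (hd p))" "snd (apos (hd p))"] l by simp
  qed (use l in auto)
  then show "l \<in> {l \<in> {l. valid_label l}. cuts l = 0}" using nf_source_target(3)[OF walk l] by simp
next
  fix l assume "l \<in> {l \<in> {l. valid_label l}. cuts l = 0}"
  then have l: "valid_label l" "cuts l = 0" by auto
  have "\<exists>p\<in>sgpaths. nf p = Some l"
  proof (cases l)
    case (Triv x e)
    then have "x \<in> \<gamma> ` verts Q" using l(1) unfolding \<gamma>_image by simp
    then obtain y where y: "y \<in> verts Q" "\<gamma> y = x" by auto
    then have "sgwalk (y, e) [] (y, e)" using l(1) Triv signs_\<gamma>[of y] by simp
    then show ?thesis using sgwalk_in_sgpaths[of "(y, e)" "[]"] y Triv by (intro bexI[of _ "((y, e), [])"]) auto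
  next
    case (Soc x e)
    then show ?thesis using l by simp
  next
    case (Arc v i n e f)
    then have a: "v \<in> vertices \<Gamma>" "0 < n" "i + n < V v" "e \<in> sgn_at (cyc_at v i)" "f \<in> sgn_at (cyc_at v (i + n))"
      using l by (auto simp: div_eq_0_iff)
    \<comment> \<open>The arrow of \<open>Q\<close> in a given position, which exists for every
      position but the last one at a vertex.\<close>
    define arr where "arr = inv_into (arcs Q) pos"
    have arr: "arr (v, i + k) \<in> arcs Q" "pos (arr (v, i + k)) = (v, i + k)" if "k < n" for k
    proof -
      have "(v, i + k) \<in> pos ` arcs Q" using a that unfolding pos_image by auto
      then show "arr (v, i + k) \<in> arcs Q" "pos (arr (v, i + k)) = (v, i + k)"
        by (simp_all add: arr_def inv_into_into f_inv_into_f)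
    qed
    have vert: "\<exists>y. y \<in> verts Q \<and> \<gamma> y = cyc_at v (i + k)" if "k \<le> n" for k
    proof -
      have "cyc_at v (i + k) \<in> \<gamma> ` verts Q" unfolding \<gamma>_image using at_edges a that by simp
      then show ?thesis by auto
    qed
    \<comment> \<open>The arrows fit together because \<open>\<gamma>\<close> is injective on
      vertices and the adjacent ends have the same image in \<open>\<Gamma>\<close>.\<close>
    have walk: "\<exists>y z. pre_digraph.awalk Q y (map (\<lambda>k. arr (v, i + k)) [0..<m]) z \<and> \<gamma> y = cyc_at v i \<and> \<gamma> z = cyc_at v (i + m)"
      if "m \<le> n" for m
      using that
    proof (induction m)
      case 0
      then show ?case using vert[of 0] by (auto simp: Q.awalk_def)
    next
      case (Suc m)
      then obtain y z where y: "Q.awalk y (map (\<lambda>k. arr (v, i + k)) [0..<m]) z" "\<gamma> y = cyc_at v i" "\<gamma> z = cyc_at v (i + m)"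
        by auto
      have b: "arr (v, i + m) \<in> arcs Q" "pos (arr (v, i + m)) = (v, i + m)" using arr[of m] Suc.prems by auto
      then have "\<gamma> (tail Q (arr (v, i + m))) = \<gamma> z" using pos_tail y(3) by simp
      then have "tail Q (arr (v, i + m)) = z"
        using vertex_eqI Q.tail_in_verts[OF b(1)] Q.awalk_last_in_verts[OF y(1)] by blast
      moreover have "\<gamma> (head Q (arr (v, i + m))) = cyc_at v (i + Suc m)"
        using pos_head[OF b(1)] b(2) a(3) Suc.prems by simp
      moreover have "Q.awalk y (map (\<lambda>k. arr (v, i + k)) [0..<Suc m]) (head Q (arr (v, i + m)))"
        using y(1) b(1) calculation(1)
        by (simp only: upt_Suc_append[OF le0] map_append list.map Q.awalk_snoc_iff simp_thms)
      ultimately show ?case using y(2) by blast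
    qed
    obtain y z where y: "Q.awalk y (map (\<lambda>k. arr (v, i + k)) [0..<n]) z" "\<gamma> y = cyc_at v i" "\<gamma> z = cyc_at v (i + n)"
      using walk[of n] by auto
    have "y \<in> verts Q" "z \<in> verts Q" using y(1) Q.awalk_last_in_verts[OF y(1)] by (auto simp: Q.awalk_def)
    then have ef: "e \<in> signs S y" "f \<in> signs S z" using a(4,5) y(2,3) signs_\<gamma> by auto
    have "map (\<lambda>k. arr (v, i + k)) [0..<n] \<noteq> []" using a(2) by simp
    from lift_walk[OF y(1) this ef] obtain c where c: "map underlying c = map (\<lambda>k. arr (v, i + k)) [0..<n]" "sgwalk (y, e) c (z, f)"
      by blast
    have len: "length c = n" using arg_cong[OF c(1), of length] by simp
    then have ne: "c \<noteq> []" using a(2) by auto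
    have "apos (c ! k) = (v, i + k)" if "k < n" for k
      using arg_cong[OF c(1), of "\<lambda>l. l ! k"] that arr(2)[OF that] len by (simp add: apos_def)
    then have "map apos c = map (\<lambda>k. (v, i + k)) [0..<n]" using len by (intro nth_equalityI) auto
    moreover have "successively (\<lambda>x y. y = next_arrow \<Gamma> x) (map (\<lambda>k. (v, i + k)) [0..<m])" if "m \<le> n" for m
      using that
    proof (induction m)
      case (Suc m)
      then show ?case using a(3) by (cases m) (auto simp: successively_append_iff next_arrow_def)
    qed simp
    ultimately have "run c" using successively_map[of "\<lambda>x y. y = next_arrow \<Gamma> x" apos c] by (simp add: run_def)
    moreover have "apos (hd c) = (v, i)"
      using \<open>\<And>k. k < n \<Longrightarrow> apos (c ! k) = (v, i + k)\<close>[of 0] a(2) ne by (simp add: hd_conv_nth)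
    ultimately have "nf ((y, e), c) = Some l" using nf_cut[OF c(2) _ ne] len Arc by simp
    then show ?thesis using sgwalk_in_sgpaths[OF c(2)] by blast
  qed
  then show "l \<in> {b. \<exists>p\<in>sgpaths. nf p = Some b}" by simp
qed

text \<open>Both algebras have coordinates in the same labels with the same product, the cut algebra
  in those with \<open>cuts\<close> equal to zero, so \<open>cuts\<close> is the degree that the
  comparison asks for.\<close>

theorem trivial_extension_iso_brauer:
  "algebra_iso (trivial_extension (bound_quiver_algebra (sg_quiver Q S)
      (commutativity_relations Q S \<union> lifted_zero_relations Q S P) :: ('k::field, _) module))
     (skew_brauer_graph_algebra \<Gamma>)"
proof -
  interpret BR: brauer_relations \<Gamma> by (rule brauer_relations.intro) (rule skew_brauer_graph_axioms)
  obtain \<kappa> where B: "monomial_algebra (skew_brauer_graph_algebra \<Gamma> :: ('k, _) module) {l. valid_label l} \<kappa>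
     (\<lambda>m n b. label_mul m n = Some b)"
    using BR.monomial_algebra_brauer by blast
  interpret N: path_normal_form "sg_quiver Q S" "cut_rels :: (_ \<Rightarrow>\<^sub>0 'k) set" nf label_mul
    by (rule path_normal_form_cut)
  have classes: "N.path_classes = {l \<in> {l. valid_label l}. cuts l = 0}"
    by (rule trans[OF N.path_classes_def nf_image_cut])
  then have "finite N.path_classes" using finite_valid_label by simp
  then have A: "monomial_algebra (bound_quiver_algebra (sg_quiver Q S) (cut_rels :: (_ \<Rightarrow>\<^sub>0 'k) set))
      {l \<in> {l. valid_label l}. cuts l = 0} N.class_coeff (\<lambda>m n b. label_mul m n = Some b)"
    using N.monomial_algebra classes by simp
  show ?thesis
    unfolding cut_rels_def[symmetric]
    by (rule trivial_extension_of_degree_zero_part[OF B A, where d = dual_label])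
       (auto simp: valid_dual_label dual_dual_label label_mul_cyclic cuts_dual_label cuts_label_mul)
qed

end

section \<open>Gentle pairs\<close>

lemma distinct_if_acyclic:
  assumes "acyclic E" "successively (\<lambda>a b. (a, b) \<in> E) p" shows "distinct p"
  using assms(2)
proof (induction p)
  case (Cons a p)
  have *: "(a, b) \<in> E\<^sup>+" if "successively (\<lambda>a b. (a, b) \<in> E) (a # p)" "b \<in> set p" for a b p
    using that
  proof (induction p arbitrary: a)
    case (Cons c p)
    show ?case
    proof (cases "b = c")
      case False
      then have "(c, b) \<in> E\<^sup>+" using Cons by auto
      then show ?thesis using Cons.prems(1) by (auto intro: trancl_into_trancl2)
    qed (use Cons.prems in auto)
  qed simp
  have "a \<notin> set p" using *[OF Cons.prems] assms(1) by (auto simp: acyclic_def)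
  then show ?case using Cons by (auto simp: successively_Cons)
qed simp

text \<open>From a point on a cycle one can always take one more step and still be on the way back
  to \<open>a\<close>.\<close>

lemma long_walks_if_cyclic:
  assumes "\<not> acyclic E" shows "\<exists>p. length p = Suc n \<and> successively (\<lambda>a b. (a, b) \<in> E) p \<and> set p \<subseteq> Domain E"
proof -
  obtain a where a: "(a, a) \<in> E\<^sup>+" using assms by (auto simp: acyclic_def)
  have step: "\<exists>c. (b, c) \<in> E \<and> (c, a) \<in> E\<^sup>+" if "(b, a) \<in> E\<^sup>+" for b
    using that a by (meson converse_tranclE)
  have "\<exists>p. length p = Suc n \<and> hd p = b \<and> successively (\<lambda>a b. (a, b) \<in> E) p \<and> set p \<subseteq> Domain E" if "(b, a) \<in> E\<^sup>+" for b
    using that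
  proof (induction n arbitrary: b)
    case 0
    then show ?case using step[OF 0] by (intro exI[of _ "[b]"]) auto
  next
    case (Suc n)
    obtain c where c: "(b, c) \<in> E" "(c, a) \<in> E\<^sup>+" using step[OF Suc.prems] by blast
    obtain p where "length p = Suc n" "hd p = c" "successively (\<lambda>a b. (a, b) \<in> E) p" "set p \<subseteq> Domain E"
      using Suc.IH[OF c(2)] by blast
    then show ?case using c(1) by (intro exI[of _ "b # p"]) (auto simp: successively_Cons)
  qed
  then show ?thesis using a by blast
qed

locale monomial_quiver = fin_digraph Q for Q :: "('v, 'a) pre_digraph" +
  fixes \<rho> :: "('a \<times> 'a) set"
  assumes \<rho>_composable: "\<rho> \<subseteq> composable_pairs Q"
begin

definition nonzero :: "'a list \<Rightarrow> bool" where
  "nonzero = successively (\<lambda>a b. (a, b) \<notin> \<rho>)"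

text \<open>With monomial relations no two paths are identified, so a path that does not vanish is
  its own class.\<close>

definition mono_nf :: "('v, 'a) path \<Rightarrow> ('v, 'a) path option" where
  "mono_nf p = (if nonzero (snd p) then Some p else None)"

definition mono_mul :: "('v, 'a) path \<Rightarrow> ('v, 'a) path \<Rightarrow> ('v, 'a) path option" where
  "mono_mul p q = (if pre_digraph.awalk Q (fst p) (snd p) (fst q) then mono_nf (fst p, snd p @ snd q) else None)"

definition mono_rels :: "(('v, 'a) path \<Rightarrow>\<^sub>0 'k::field) set" where
  "mono_rels = {path_elem (tail Q a) [a, b] | a b. (a, b) \<in> \<rho>}"

lemma mono_rel_walk: "(a, b) \<in> \<rho> \<Longrightarrow> pre_digraph.awalk Q (tail Q a) [a, b] (head Q b)"
  using \<rho>_composable by (auto simp: composable_pairs_def awalk_Cons_iff' awalk_def)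

lemma nonzero_append: "nonzero (p @ q) \<Longrightarrow> nonzero p \<and> nonzero q"
  by (auto simp: nonzero_def successively_append_iff)

lemma path_normal_form_mono:
  "path_normal_form Q (mono_rels :: (_ \<Rightarrow>\<^sub>0 'k::field) set) mono_nf mono_mul"
proof -
  have carrier: "Poly_Mapping.keys r \<subseteq> quiver_paths Q" if "r \<in> (mono_rels :: (_ \<Rightarrow>\<^sub>0 'k) set)" for r
  proof -
    obtain a b where r: "r = path_elem (tail Q a) [a, b]" "(a, b) \<in> \<rho>" using \<open>r \<in> mono_rels\<close> by (auto simp: mono_rels_def)
    have "(tail Q a, [a, b]) \<in> quiver_paths Q" unfolding quiver_paths_def using mono_rel_walk[OF r(2)] by blast
    then show ?thesis unfolding r(1) by (simp add: path_elem_def)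
  qed
  let ?I = "genideal (path_algebra Q) (mono_rels :: (_ \<Rightarrow>\<^sub>0 'k) set)"
  have ideal: "ideal ?I (path_algebra Q)"
    by (rule ring.genideal_ideal[OF ring_path_algebra]) (use carrier in auto)
  interpret I: path_ideal Q ?I
    by (intro path_ideal.intro K_algebra_ideal.intro K_algebra_ideal_axioms.intro fin_digraph_axioms
        K_algebra_path_algebra ideal)
  have rels: "mono_rels \<subseteq> ?I"
    by (rule ring.genideal_self[OF ring_path_algebra]) (use carrier in auto)
  show ?thesis
  proof (intro path_normal_form.intro path_normal_form_axioms.intro fin_digraph_axioms carrier)
    fix r :: "_ \<Rightarrow>\<^sub>0 'k" and b assume "r \<in> mono_rels"
    then obtain a c where r: "r = path_elem (tail Q a) [a, c]" "(a, c) \<in> \<rho>" by (auto simp: mono_rels_def)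
    then have "mono_nf (tail Q a, [a, c]) = None" by (simp add: mono_nf_def nonzero_def)
    then show "(\<Sum>p\<in>Poly_Mapping.keys r. if mono_nf p = Some b then Poly_Mapping.lookup r p else 0) = 0"
      unfolding r(1) by (rule path_elem_kernel)
  next
    fix p q m n
    assume "mono_nf p = Some m" "mono_nf q = Some n"
    then show "mono_mul m n = (if awalk (fst p) (snd p) (fst q) then mono_nf (fst p, snd p @ snd q) else None)"
      by (auto simp: mono_mul_def mono_nf_def split: if_splits)
  next
    fix p q :: "('v, 'a) path"
    assume "mono_nf p = None \<or> mono_nf q = None"
    then show "mono_nf (fst p, snd p @ snd q) = None"
      using nonzero_append[of "snd p" "snd q"] by (auto simp: mono_nf_def split: if_splits)
  next
    fix p assume "p \<in> quiver_paths Q" "mono_nf p = None"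
    then obtain u p' w where p: "p = (u, p')" "awalk u p' w" "\<not> nonzero p'"
      by (cases p) (auto simp: quiver_paths_def mono_nf_def split: if_splits)
    obtain ys a b zs where ab: "p' = ys @ [a, b] @ zs" "(a, b) \<in> \<rho>"
      using not_successively_split[OF p(3)[unfolded nonzero_def]] by auto
    obtain z where z: "awalk u ys z" "awalk z ([a, b] @ zs) w" using p(2) unfolding ab(1) awalk_append_iff by blast
    then have "z = tail Q a" by (simp add: awalk_Cons_iff')
    then have "path_elem z [a, b] \<in> ?I" using rels ab(2) by (auto simp: mono_rels_def)
    then have "path_elem u p' \<in> ?I" using I.zero_path_infix z p(2) unfolding ab(1) by blast
    then show "Poly_Mapping.single p 1 \<in> ?I" by (simp add: p path_elem_def)
  next
    fix p q b assume "mono_nf p = Some b" "mono_nf q = Some b"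
    then have "p = q" by (auto simp: mono_nf_def split: if_splits)
    then show "Poly_Mapping.single p 1 - Poly_Mapping.single q 1 \<in> ?I" using I.zero_in_I by simp
  qed
qed

definition allowed :: "('a \<times> 'a) set" where "allowed = composable_pairs Q - \<rho>"

text \<open>The gentle conditions speak of membership in the generated ideal. As the paths avoiding
  \<open>\<rho>\<close> are independent modulo it, a path of length two lies in the ideal only if it
  is a generator.\<close>

lemma zero_ideal_iff:
  assumes "(a, b) \<in> composable_pairs Q"
  shows "path_elem (tail Q a) [a, b] \<in> zero_ideal TYPE('k::field) Q \<rho> \<longleftrightarrow> (a, b) \<in> \<rho>"
proof -
  interpret N: path_normal_form Q "mono_rels :: (_ \<Rightarrow>\<^sub>0 'k) set" mono_nf mono_mul
    by (rule path_normal_form_mono)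
  have eq: "zero_ideal TYPE('k) Q \<rho> = N.kernel"
    unfolding zero_ideal_def mono_rels_def[symmetric] by (rule N.genideal_eq_kernel)
  show ?thesis
  proof
    assume "path_elem (tail Q a) [a, b] \<in> zero_ideal TYPE('k) Q \<rho>"
    then have "N.coeff (path_elem (tail Q a) [a, b]) (tail Q a, [a, b]) = 0"
      unfolding eq N.kernel_def by blast
    then show "(a, b) \<in> \<rho>" by (auto simp: path_elem_def N.coeff_single mono_nf_def nonzero_def split: if_splits)
  next
    assume "(a, b) \<in> \<rho>"
    then have "N.coeff (path_elem (tail Q a) [a, b]) c = 0" for c
      by (simp add: path_elem_def N.coeff_single mono_nf_def nonzero_def)
    moreover have "path_elem (tail Q a) [a, b] \<in> carrier N.PA"
      using mono_rel_walk[OF \<open>(a, b) \<in> \<rho>\<close>] by (auto simp: path_elem_def quiver_paths_def)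
    ultimately show "path_elem (tail Q a) [a, b] \<in> zero_ideal TYPE('k) Q \<rho>" unfolding eq N.kernel_def by blast
  qed
qed

lemma successively_allowed:
  assumes "awalk u p w" shows "successively (\<lambda>a b. (a, b) \<in> allowed) p \<longleftrightarrow> nonzero p"
  using assms
proof (induction p arbitrary: u)
  case (Cons a p)
  then have a: "a \<in> arcs Q" "awalk (head Q a) p w" by (auto simp: awalk_Cons_iff')
  have "p \<noteq> [] \<Longrightarrow> (a, hd p) \<in> composable_pairs Q"
    using a by (cases p) (auto simp: composable_pairs_def awalk_Cons_iff')
  then show ?case using Cons.IH[OF a(2)] by (auto simp: nonzero_def successively_Cons allowed_def)
qed (simp add: nonzero_def)

text \<open>The paths avoiding \<open>\<rho>\<close> form a basis. A cycle of allowed pairs yields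
  such paths of every positive length; without one, no such path repeats an arrow, so there are
  finitely many.\<close>

lemma fin_dim_iff_acyclic:
  "fin_dim (quotient_algebra (path_algebra Q) (zero_ideal TYPE('k::field) Q \<rho>)) \<longleftrightarrow> acyclic allowed"
proof -
  interpret N: path_normal_form Q "mono_rels :: (_ \<Rightarrow>\<^sub>0 'k) set" mono_nf mono_mul
    by (rule path_normal_form_mono)
  interpret C: coordinates "bound_quiver_algebra Q (mono_rels :: (_ \<Rightarrow>\<^sub>0 'k) set)" N.path_classes N.class_coeff
    by (rule N.coordinates)
  have classes: "N.path_classes = {p \<in> quiver_paths Q. nonzero (snd p)}"
    by (auto simp: N.path_classes_def mono_nf_def)
  have "fin_dim (quotient_algebra (path_algebra Q) (zero_ideal TYPE('k) Q \<rho>)) \<longleftrightarrow> finite N.path_classes"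
    using C.finite_if_fin_dim C.fin_dim_if_finite
    unfolding bound_quiver_algebra_def zero_ideal_def mono_rels_def by blast
  also have "\<dots> \<longleftrightarrow> acyclic allowed"
  proof
    assume fin: "finite N.path_classes"
    show "acyclic allowed"
    proof (rule ccontr)
      assume cyc: "\<not> acyclic allowed"
      have "\<exists>x\<in>N.path_classes. length (snd x) = Suc n" for n
      proof -
        obtain p where p: "length p = Suc n" "successively (\<lambda>a b. (a, b) \<in> allowed) p" "set p \<subseteq> Domain allowed"
          using long_walks_if_cyclic[OF cyc] by blast
        have "p \<noteq> []" "set p \<subseteq> arcs Q" using p(1,3) by (auto simp: allowed_def composable_pairs_def)
        then have "\<exists>w. awalk (tail Q (hd p)) p w" using p(2)
        proof (induction p)
          case (Cons a p)
          show ?case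
          proof (cases "p = []")
            case True
            then show ?thesis using Cons.prems by (auto simp: awalk_Cons_iff' awalk_def)
          next
            case False
            then obtain w where "awalk (tail Q (hd p)) p w" "(a, hd p) \<in> allowed"
              using Cons by (auto simp: successively_Cons)
            then show ?thesis using Cons.prems by (auto simp: awalk_Cons_iff' allowed_def composable_pairs_def)
          qed
        qed simp
        then obtain w where w: "awalk (tail Q (hd p)) p w" by blast
        then have "(tail Q (hd p), p) \<in> N.path_classes"
          using p(2) successively_allowed[OF w] by (auto simp: classes quiver_paths_def)
        then show ?thesis using p(1) by force
      qed
      then have "Suc n \<in> (length \<circ> snd) ` N.path_classes" for n by (metis comp_apply imageI)
      then have "range Suc \<subseteq> (length \<circ> snd) ` N.path_classes" by blast
      moreover have "infinite (range Suc)" by (rule range_inj_infinite) simp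
      ultimately show False using fin finite_subset by blast
    qed
  next
    assume ac: "acyclic allowed"
    have "N.path_classes \<subseteq> verts Q \<times> {p. set p \<subseteq> arcs Q \<and> distinct p}"
    proof
      fix x assume "x \<in> N.path_classes"
      then obtain u p w where "x = (u, p)" "awalk u p w" "nonzero p"
        by (auto simp: classes quiver_paths_def)
      then show "x \<in> verts Q \<times> {p. set p \<subseteq> arcs Q \<and> distinct p}"
        using distinct_if_acyclic[OF ac] successively_allowed by (auto simp: awalk_def)
    qed
    then show "finite N.path_classes"
      by (rule finite_subset) (intro finite_cartesian_product finite_subset_distinct finite_verts finite_arcs)
  qed
  finally show ?thesis .
qed

lemma card_le_one_iff: "finite M \<Longrightarrow> card M \<le> 1 \<longleftrightarrow> (\<forall>x\<in>M. \<forall>y\<in>M. x = y)"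
  using card_le_Suc0_iff_eq[of M] by simp

text \<open>All reference to the field and to ideals disappears: conditions on pairs of arrows
  remain, with finite dimension turned into acyclicity.\<close>

lemma gentle_iff:
  "gentle TYPE('k::field) Q \<rho> \<longleftrightarrow>
     (\<forall>x \<in> verts Q. card {a \<in> arcs Q. tail Q a = x} \<le> 2 \<and> card {a \<in> arcs Q. head Q a = x} \<le> 2) \<and>
     (\<forall>a\<in>arcs Q. (\<forall>b b'. (a, b) \<in> \<rho> \<longrightarrow> (a, b') \<in> \<rho> \<longrightarrow> b = b') \<and>
        (\<forall>b b'. (a, b) \<in> allowed \<longrightarrow> (a, b') \<in> allowed \<longrightarrow> b = b') \<and>
        (\<forall>b b'. (b, a) \<in> \<rho> \<longrightarrow> (b', a) \<in> \<rho> \<longrightarrow> b = b') \<and>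
        (\<forall>b b'. (b, a) \<in> allowed \<longrightarrow> (b', a) \<in> allowed \<longrightarrow> b = b')) \<and>
     acyclic allowed"
proof -
  have zi: "(head Q a = tail Q b \<and> path_elem (tail Q a) [a, b] \<in> zero_ideal TYPE('k) Q \<rho>) \<longleftrightarrow> (a, b) \<in> \<rho>"
    "(head Q a = tail Q b \<and> path_elem (tail Q a) [a, b] \<notin> zero_ideal TYPE('k) Q \<rho>) \<longleftrightarrow> (a, b) \<in> allowed"
    if "a \<in> arcs Q" "b \<in> arcs Q" for a b
    using zero_ideal_iff[of a b, where ?'k = 'k] that \<rho>_composable by (auto simp: composable_pairs_def allowed_def)
  have in_arcs: "(a, b) \<in> \<rho> \<Longrightarrow> a \<in> arcs Q \<and> b \<in> arcs Q" "(a, b) \<in> allowed \<Longrightarrow> a \<in> arcs Q \<and> b \<in> arcs Q" for a b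
    using \<rho>_composable by (auto simp: allowed_def composable_pairs_def)
  have sets: "{b \<in> arcs Q. head Q a = tail Q b \<and> path_elem (tail Q a) [a, b] \<in> zero_ideal TYPE('k) Q \<rho>} = {b. (a, b) \<in> \<rho>}"
    "{b \<in> arcs Q. head Q a = tail Q b \<and> path_elem (tail Q a) [a, b] \<notin> zero_ideal TYPE('k) Q \<rho>} = {b. (a, b) \<in> allowed}"
    "{b \<in> arcs Q. head Q b = tail Q a \<and> path_elem (tail Q b) [b, a] \<in> zero_ideal TYPE('k) Q \<rho>} = {b. (b, a) \<in> \<rho>}"
    "{b \<in> arcs Q. head Q b = tail Q a \<and> path_elem (tail Q b) [b, a] \<notin> zero_ideal TYPE('k) Q \<rho>} = {b. (b, a) \<in> allowed}"
    if "a \<in> arcs Q" for a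
  proof -
    show "{b \<in> arcs Q. head Q a = tail Q b \<and> path_elem (tail Q a) [a, b] \<in> zero_ideal TYPE('k) Q \<rho>} = {b. (a, b) \<in> \<rho>}"
      by (rule Collect_cong) (use zi(1)[OF that] in_arcs(1)[of a] in meson)
    show "{b \<in> arcs Q. head Q a = tail Q b \<and> path_elem (tail Q a) [a, b] \<notin> zero_ideal TYPE('k) Q \<rho>} = {b. (a, b) \<in> allowed}"
      by (rule Collect_cong) (use zi(2)[OF that] in_arcs(2)[of a] in meson)
    show "{b \<in> arcs Q. head Q b = tail Q a \<and> path_elem (tail Q b) [b, a] \<in> zero_ideal TYPE('k) Q \<rho>} = {b. (b, a) \<in> \<rho>}"
      by (rule Collect_cong) (use zi(1)[OF _ that] in_arcs(1)[of _ a] in meson)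
    show "{b \<in> arcs Q. head Q b = tail Q a \<and> path_elem (tail Q b) [b, a] \<notin> zero_ideal TYPE('k) Q \<rho>} = {b. (b, a) \<in> allowed}"
      by (rule Collect_cong) (use zi(2)[OF _ that] in_arcs(2)[of _ a] in meson)
  qed
  have fin: "finite {b. (a, b) \<in> M}" "finite {b. (b, a) \<in> M}" if "M \<subseteq> composable_pairs Q" for a M
    using that by (auto intro!: finite_subset[OF _ finite_arcs] simp: composable_pairs_def)
  have fin: "finite {b. (a, b) \<in> \<rho>}" "finite {b. (a, b) \<in> allowed}" "finite {b. (b, a) \<in> \<rho>}" "finite {b. (b, a) \<in> allowed}" for a
    using fin[OF \<rho>_composable] fin[of allowed] by (auto simp: allowed_def)
  have "(\<forall>a \<in> arcs Q.
        card {b \<in> arcs Q. head Q a = tail Q b \<and> path_elem (tail Q a) [a, b] \<in> zero_ideal TYPE('k) Q \<rho>} \<le> 1 \<and>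
        card {b \<in> arcs Q. head Q a = tail Q b \<and> path_elem (tail Q a) [a, b] \<notin> zero_ideal TYPE('k) Q \<rho>} \<le> 1 \<and>
        card {b \<in> arcs Q. head Q b = tail Q a \<and> path_elem (tail Q b) [b, a] \<in> zero_ideal TYPE('k) Q \<rho>} \<le> 1 \<and>
        card {b \<in> arcs Q. head Q b = tail Q a \<and> path_elem (tail Q b) [b, a] \<notin> zero_ideal TYPE('k) Q \<rho>} \<le> 1) \<longleftrightarrow>
     (\<forall>a\<in>arcs Q. (\<forall>b b'. (a, b) \<in> \<rho> \<longrightarrow> (a, b') \<in> \<rho> \<longrightarrow> b = b') \<and>
        (\<forall>b b'. (a, b) \<in> allowed \<longrightarrow> (a, b') \<in> allowed \<longrightarrow> b = b') \<and>
        (\<forall>b b'. (b, a) \<in> \<rho> \<longrightarrow> (b', a) \<in> \<rho> \<longrightarrow> b = b') \<and>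
        (\<forall>b b'. (b, a) \<in> allowed \<longrightarrow> (b', a) \<in> allowed \<longrightarrow> b = b'))"
    by (rule ball_cong[OF refl]) (simp only: sets card_le_one_iff[OF fin(1)] card_le_one_iff[OF fin(2)]
        card_le_one_iff[OF fin(3)] card_le_one_iff[OF fin(4)] mem_Collect_eq Ball_def, blast)
  then show ?thesis
    unfolding gentle_def fin_dim_iff_acyclic using fin_digraph_axioms \<rho>_composable by simp
qed

end

section \<open>From skew-Brauer graphs to skew-gentle algebras\<close>

lemma aux_quiver_simps [simp]:
  "verts (aux_quiver Q Sp) = verts Q" "arcs (aux_quiver Q Sp) = arcs Q - Sp"
  "tail (aux_quiver Q Sp) = tail Q" "head (aux_quiver Q Sp) = head Q"
  by (simp_all add: aux_quiver_def)

lemma fin_digraph_aux_quiver: "fin_digraph Q \<Longrightarrow> fin_digraph (aux_quiver Q Sp)"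
proof -
  assume "fin_digraph Q"
  then interpret fin_digraph Q .
  show ?thesis by unfold_locales auto
qed

context skew_brauer_graph
begin

definition positions :: "'e \<Rightarrow> ('v \<times> nat) set" where
  "positions x = {(v, i). v \<in> vertices \<Gamma> \<and> i < V v \<and> cyc_at v i = x}"

lemma finite_positions: "finite (positions x)"
proof (rule finite_subset)
  show "positions x \<subseteq> (SIGMA v : vertices \<Gamma>. {..<V v})" by (auto simp: positions_def)
qed (simp add: finite_vertices)

text \<open>The positions of an edge are its half-edges; a loop has both at the same vertex.\<close>

lemma card_positions:
  assumes "x \<in> edges \<Gamma>" shows "card (positions x) = 2"
proof -
  have "positions x = (SIGMA v : vertices \<Gamma>. {i. i < V v \<and> cyc_at v i = x})"
    by (auto simp: positions_def)
  then have "card (positions x) = (\<Sum>v\<in>vertices \<Gamma>. card {i. i < V v \<and> cyc_at v i = x})"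
    by (simp add: finite_vertices)
  also have "\<dots> = (\<Sum>v\<in>vertices \<Gamma>. count (ends \<Gamma> x) v)"
  proof (rule sum.cong[OF refl])
    fix v assume v: "v \<in> vertices \<Gamma>"
    have "card {i. i < V v \<and> cyc_at v i = x} = count_list (cyc \<Gamma> v) x"
      unfolding count_list_eq_length_filter length_filter_conv_card val_eq_length[OF v]
      by (rule arg_cong[of _ _ card]) auto
    then show "card {i. i < V v \<and> cyc_at v i = x} = count (ends \<Gamma> x) v"
      using cyc_count[OF v assms] by simp
  qed
  also have "\<dots> = size (ends \<Gamma> x)"
    unfolding size_multiset_overloaded_eq using ends[OF assms]
    by (intro sum.mono_neutral_right) (auto simp: finite_vertices count_eq_zero_iff)
  finally show ?thesis using ends[OF assms] by simp
qed

lemma positions_three: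
  assumes "x \<in> edges \<Gamma>" "p \<in> positions x" "q \<in> positions x" "r \<in> positions x" "p \<noteq> q" "p \<noteq> r"
  shows "q = r"
proof (rule ccontr)
  assume "q \<noteq> r"
  then have "card {p, q, r} = 3" using assms by simp
  moreover have "card {p, q, r} \<le> card (positions x)"
    using assms by (intro card_mono finite_positions) auto
  ultimately show False using card_positions[OF assms(1)] by simp
qed

end

text \<open>At a special vertex every product of two ordinary arrows is put into
  \<open>\<rho>\<close>: an incoming arrow can already be continued by the special loop, and
  gentleness tolerates only one nonzero continuation. These pairs are dropped again in
  \<open>aux_relations\<close>.\<close>

lemma skew_gentleI:
  fixes \<Gamma> :: "('v, 'e) skew_brauer_graph" and Q :: "('x, 'a) pre_digraph"
  assumes fin: "fin_digraph Q"
    and cut: "cut_cover \<Gamma> (aux_quiver Q Sp) \<gamma> pos S (aux_relations Q \<rho> Sp)"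
    and Sp: "Sp \<subseteq> {f \<in> arcs Q. tail Q f = head Q f}" "inj_on (tail Q) Sp" "S = tail Q ` Sp"
    and \<rho>: "\<rho> = {(a, b) \<in> composable_pairs Q. a \<notin> Sp \<and> b \<notin> Sp \<and>
      (pos b \<noteq> next_arrow \<Gamma> (pos a) \<or> head Q a \<in> S)}"
  shows "skew_gentle TYPE('k::field) Q \<rho> Sp"
proof -
  interpret C: cut_cover \<Gamma> "aux_quiver Q Sp" \<gamma> pos S "aux_relations Q \<rho> Sp" by (rule cut)
  let ?\<rho> = "\<rho> \<union> {(f, f) | f. f \<in> Sp}"
  have comp: "?\<rho> \<subseteq> composable_pairs Q" using Sp(1) by (auto simp: \<rho> composable_pairs_def)
  interpret Q0: fin_digraph Q by (rule fin)
  interpret M: monomial_quiver Q ?\<rho> by unfold_locales (rule comp)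
  have loop: "f \<in> Sp \<Longrightarrow> f \<in> arcs Q \<and> head Q f = tail Q f \<and> tail Q f \<in> S" for f
    using Sp by auto
  have Sp_unique: "f \<in> Sp \<Longrightarrow> g \<in> Sp \<Longrightarrow> tail Q f = tail Q g \<Longrightarrow> f = g" for f g
    using Sp(2) by (auto simp: inj_on_def)
  have arrow: "fst (pos a) \<in> vertices \<Gamma>" "Suc (snd (pos a)) < val \<Gamma> (fst (pos a))"
    "next_arrow \<Gamma> (pos a) = (fst (pos a), Suc (snd (pos a)))"
    "\<gamma> (tail Q a) = cyc \<Gamma> (fst (pos a)) ! snd (pos a)"
    "\<gamma> (head Q a) = cyc \<Gamma> (fst (pos a)) ! Suc (snd (pos a))"
    if "a \<in> arcs Q" "a \<notin> Sp" for a
    using C.cut_arrow[of a] C.pos_tail[of a] C.pos_head[of a] that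
    by (auto simp: next_arrow_def split: prod.split)
  have pos_eq: "a = b" if "a \<in> arcs Q" "a \<notin> Sp" "b \<in> arcs Q" "b \<notin> Sp" "pos a = pos b" for a b
    using C.pos_inj that by (auto simp: inj_on_def)
  have next_eq: "a = b" if "a \<in> arcs Q" "a \<notin> Sp" "b \<in> arcs Q" "b \<notin> Sp" "next_arrow \<Gamma> (pos a) = next_arrow \<Gamma> (pos b)" for a b
    using pos_eq that arrow(3) by (auto simp: prod_eq_iff)
  have special: "\<gamma> x \<in> special_edges \<Gamma>" if "x \<in> S" for x
    using that C.\<gamma>_special[of x] loop Sp(3) Q0.tail_in_verts by auto
  have tail_unique: "a = b" if "a \<in> arcs Q" "a \<notin> Sp" "b \<in> arcs Q" "b \<notin> Sp" "tail Q a = tail Q b" "tail Q a \<in> S" for a b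
  proof -
    note A = arrow[OF that(1,2)] and B = arrow[OF that(3,4)]
    have v: "1 < val \<Gamma> (fst (pos a))" "1 < val \<Gamma> (fst (pos b))" using A(2) B(2) by linarith+
    note eqs = C.special_edge_position[OF special[OF that(6)] A(1) B(1) v Suc_lessD[OF A(2)] Suc_lessD[OF B(2)]
        A(4)[symmetric] B(4)[folded that(5), symmetric]]
    show ?thesis by (rule pos_eq[OF that(1-4) prod_eqI[OF eqs]])
  qed
  have head_unique: "a = b" if "a \<in> arcs Q" "a \<notin> Sp" "b \<in> arcs Q" "b \<notin> Sp" "head Q a = head Q b" "head Q a \<in> S" for a b
  proof -
    note A = arrow[OF that(1,2)] and B = arrow[OF that(3,4)]
    have v: "1 < val \<Gamma> (fst (pos a))" "1 < val \<Gamma> (fst (pos b))" using A(2) B(2) by linarith+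
    note eqs = C.special_edge_position[OF special[OF that(6)] A(1) B(1) v A(2) B(2)
        A(5)[symmetric] B(5)[folded that(5), symmetric]]
    show ?thesis using eqs by (intro next_eq[OF that(1-4)]) (simp add: A(3) B(3))
  qed
  have tail_pos: "pos a \<in> C.positions (\<gamma> (tail Q a))" if "a \<in> arcs Q" "a \<notin> Sp" for a
    using arrow[OF that] by (cases "pos a") (auto simp: C.positions_def)
  have head_pos: "next_arrow \<Gamma> (pos a) \<in> C.positions (\<gamma> (head Q a))" if "a \<in> arcs Q" "a \<notin> Sp" for a
    using arrow[OF that] by (auto simp: C.positions_def)
  have edge: "\<gamma> (tail Q a) \<in> edges \<Gamma>" "\<gamma> (head Q a) \<in> edges \<Gamma>" if "a \<in> arcs Q" for a
    using C.\<gamma>_edges that Q0.tail_in_verts Q0.head_in_verts by auto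
  have rel_iff: "(a, b) \<in> ?\<rho> \<longleftrightarrow> (if a \<in> Sp \<or> b \<in> Sp then a = b else pos b \<noteq> next_arrow \<Gamma> (pos a) \<or> head Q a \<in> S)"
    if "(a, b) \<in> composable_pairs Q" for a b
    using that by (auto simp: \<rho>)
  have \<rho>_D: "(a, b) \<in> composable_pairs Q" if "(a, b) \<in> ?\<rho>" for a b using that comp by blast
  have allowed_iff: "(a, b) \<in> M.allowed \<longleftrightarrow> (a, b) \<in> composable_pairs Q \<and>
     (if a \<in> Sp \<or> b \<in> Sp then a \<noteq> b else pos b = next_arrow \<Gamma> (pos a) \<and> head Q a \<notin> S)" for a b
    using rel_iff[of a b] by (auto simp: M.allowed_def)
  have cp: "(a, b) \<in> composable_pairs Q \<longleftrightarrow> a \<in> arcs Q \<and> b \<in> arcs Q \<and> head Q a = tail Q b" for a b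
    by (auto simp: composable_pairs_def)
  have r1: "b = b'" if ab: "(a, b) \<in> ?\<rho>" "(a, b') \<in> ?\<rho>" for a b b'
  proof -
    note c = \<rho>_D[OF ab(1)] \<rho>_D[OF ab(2)]
    note i = ab(1)[unfolded rel_iff[OF c(1)]] ab(2)[unfolded rel_iff[OF c(2)]]
    show ?thesis
    proof (cases "a \<in> Sp \<or> b \<in> Sp \<or> b' \<in> Sp")
      case True
      then show ?thesis using i by (auto split: if_splits)
    next
      case False
      show ?thesis
      proof (cases "head Q a \<in> S")
        case True
        then show ?thesis using tail_unique[of b b'] c False by (auto simp: cp)
      next
        case h: False
        \<comment> \<open>An edge has only two positions. One is where \<open>a\<close> arrives, so
          \<open>b\<close> and \<open>b'\<close> both start in the other.\<close>
        have "pos b = pos b'"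
        proof (rule C.positions_three[of "\<gamma> (head Q a)" "next_arrow \<Gamma> (pos a)"])
          show "\<gamma> (head Q a) \<in> edges \<Gamma>" "next_arrow \<Gamma> (pos a) \<in> C.positions (\<gamma> (head Q a))"
            "pos b \<in> C.positions (\<gamma> (head Q a))" "pos b' \<in> C.positions (\<gamma> (head Q a))"
            using c False edge head_pos[of a] tail_pos[of b] tail_pos[of b'] by (auto simp: cp)
        qed (use i False h in auto)
        then show ?thesis using pos_eq[of b b'] c False by (auto simp: cp)
      qed
    qed
  qed
  have r2: "b = b'" if ab: "(b, a) \<in> ?\<rho>" "(b', a) \<in> ?\<rho>" for a b b'
  proof -
    note c = \<rho>_D[OF ab(1)] \<rho>_D[OF ab(2)]
    note i = ab(1)[unfolded rel_iff[OF c(1)]] ab(2)[unfolded rel_iff[OF c(2)]]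
    show ?thesis
    proof (cases "a \<in> Sp \<or> b \<in> Sp \<or> b' \<in> Sp")
      case True
      then show ?thesis using i by (auto split: if_splits)
    next
      case False
      show ?thesis
      proof (cases "tail Q a \<in> S")
        case True
        then show ?thesis using head_unique[of b b'] c False by (auto simp: cp)
      next
        case h: False
        have "next_arrow \<Gamma> (pos b) = next_arrow \<Gamma> (pos b')"
        proof (rule C.positions_three[of "\<gamma> (tail Q a)" "pos a"])
          show "\<gamma> (tail Q a) \<in> edges \<Gamma>" "pos a \<in> C.positions (\<gamma> (tail Q a))"
            "next_arrow \<Gamma> (pos b) \<in> C.positions (\<gamma> (tail Q a))" "next_arrow \<Gamma> (pos b') \<in> C.positions (\<gamma> (tail Q a))"
            using c False edge tail_pos[of a] head_pos[of b] head_pos[of b'] by (auto simp: cp)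
        qed (use i False h c in \<open>auto simp: cp\<close>)
        then show ?thesis using next_eq[of b b'] c False by (auto simp: cp)
      qed
    qed
  qed
  \<comment> \<open>At a special vertex an ordinary arrow is continued by the loop, and the loop by
    the only ordinary arrow leaving; elsewhere the continuation is the next arrow of the special
    cycle.\<close>
  have a1: "b = b'" if ab: "(a, b) \<in> M.allowed" "(a, b') \<in> M.allowed" for a b b'
  proof -
    note i = ab[unfolded allowed_iff cp]
    show ?thesis
    proof (cases "a \<in> Sp")
      case True
      then have "b \<notin> Sp" "b' \<notin> Sp" using i loop Sp_unique by auto
      then show ?thesis using tail_unique[of b b'] i True loop[of a] by auto
    next
      case False
      show ?thesis
      proof (cases "b \<in> Sp \<or> b' \<in> Sp")
        case True
        then have "b \<in> Sp \<and> b' \<in> Sp" using i False loop[of b] loop[of b'] by (auto split: if_splits)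
        then show ?thesis using Sp_unique[of b b'] i by auto
      next
        case b: False
        then show ?thesis using i False pos_eq[of b b'] by auto
      qed
    qed
  qed
  have a2: "b = b'" if ab: "(b, a) \<in> M.allowed" "(b', a) \<in> M.allowed" for a b b'
  proof -
    note i = ab[unfolded allowed_iff cp]
    show ?thesis
    proof (cases "a \<in> Sp")
      case True
      then have "b \<notin> Sp" "b' \<notin> Sp" using i loop[of b] loop[of b'] Sp_unique[of a b] Sp_unique[of a b'] by auto
      then show ?thesis using head_unique[of b b'] i True loop[of a] by auto
    next
      case False
      show ?thesis
      proof (cases "b \<in> Sp \<or> b' \<in> Sp")
        case True
        then have "b \<in> Sp \<and> b' \<in> Sp" using i False loop[of b] loop[of b'] by (auto split: if_splits)
        then show ?thesis using Sp_unique[of b b'] i loop[of b] loop[of b'] by auto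
      next
        case b: False
        then show ?thesis using i False next_eq[of b b'] by auto
      qed
    qed
  qed
  \<comment> \<open>\<open>ep\<close> stands for \<open>tail Q\<close> or \<open>head Q\<close>. At
    a special vertex there are at most the loop and one ordinary arrow; elsewhere the arrows inject
    into the two positions of the edge.\<close>
  have degree: "card {a \<in> arcs Q. ep a = x} \<le> 2"
    if x: "x \<in> verts Q" and loop_end: "\<And>f. f \<in> Sp \<Longrightarrow> ep f = tail Q f"
      and unique: "\<And>a b. a \<in> arcs Q \<Longrightarrow> a \<notin> Sp \<Longrightarrow> b \<in> arcs Q \<Longrightarrow> b \<notin> Sp \<Longrightarrow> ep a = ep b \<Longrightarrow> ep a \<in> S \<Longrightarrow> a = b"
      and inj: "inj_on p (arcs Q - Sp)" and p: "\<And>a. a \<in> arcs Q - Sp \<Longrightarrow> p a \<in> C.positions (\<gamma> (ep a))"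
    for x ep and p :: "'a \<Rightarrow> 'v \<times> nat"
  proof (cases "x \<in> S")
    case True
    have eq: "{a \<in> arcs Q. ep a = x} = {a \<in> arcs Q - Sp. ep a = x} \<union> {f \<in> Sp. ep f = x}"
      using loop by auto
    have "card {a \<in> arcs Q - Sp. ep a = x} \<le> 1"
      using unique True by (subst M.card_le_one_iff) (auto simp: Q0.finite_arcs)
    moreover have "card {f \<in> Sp. ep f = x} \<le> 1"
    proof (subst M.card_le_one_iff)
      show "finite {f \<in> Sp. ep f = x}" using loop by (intro finite_subset[OF _ Q0.finite_arcs]) auto
    qed (use Sp_unique loop_end in auto)
    ultimately show ?thesis
      unfolding eq using card_Un_le[of "{a \<in> arcs Q - Sp. ep a = x}" "{f \<in> Sp. ep f = x}"] by linarith
  next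
    case False
    then have "{a \<in> arcs Q. ep a = x} \<subseteq> arcs Q - Sp" using loop loop_end by auto
    then have "card {a \<in> arcs Q. ep a = x} \<le> card (C.positions (\<gamma> x))"
      using p inj by (intro card_inj_on_le[of p]) (auto intro: inj_on_subset C.finite_positions)
    then show ?thesis using C.card_positions[of "\<gamma> x"] C.\<gamma>_edges[of x] x by simp
  qed
  have deg: "card {a \<in> arcs Q. tail Q a = x} \<le> 2 \<and> card {a \<in> arcs Q. head Q a = x} \<le> 2" if "x \<in> verts Q" for x
  proof
    show "card {a \<in> arcs Q. tail Q a = x} \<le> 2"
      by (rule degree[OF that, of "tail Q" pos]) (use tail_unique tail_pos pos_eq in \<open>auto simp: inj_on_def\<close>)
    show "card {a \<in> arcs Q. head Q a = x} \<le> 2"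
      by (rule degree[OF that, of "head Q" "next_arrow \<Gamma> \<circ> pos"])
         (use head_unique head_pos next_eq loop in \<open>auto simp: inj_on_def\<close>)
  qed
  have acyclic: "acyclic M.allowed"
  proof -
    \<comment> \<open>Requiring valency greater than one leaves only the position of a special edge
      at its ordinary end.\<close>
    define ok where "ok x p \<longleftrightarrow> fst p \<in> vertices \<Gamma> \<and> 1 < val \<Gamma> (fst p) \<and> snd p < val \<Gamma> (fst p) \<and> cyc \<Gamma> (fst p) ! snd p = \<gamma> x" for x p
    \<comment> \<open>An ordinary arrow in position \<open>i\<close> gets the odd number
      \<open>2 i + 1\<close>, and the loop at the special edge in position \<open>i\<close> the
      number \<open>2 i\<close>, between the arrow before it and the arrow after it.\<close>
    define rank where "rank a = (if a \<in> Sp then 2 * snd (SOME p. ok (tail Q a) p) else Suc (2 * snd (pos a)))" for a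
    have ok_some: "(SOME p. ok x p) = p" if "ok x p" "x \<in> S" for x p
    proof -
      have unique: "q = p" if "ok x q" for q
        using C.special_edge_position[OF special[OF \<open>x \<in> S\<close>], of "fst q" "fst p" "snd q" "snd p"] that \<open>ok x p\<close>
        by (auto simp: ok_def prod_eq_iff)
      show ?thesis by (rule some_equality) (use that(1) unique in blast)+
    qed
    have rank: "rank a < rank b" if ab: "(a, b) \<in> M.allowed" for a b
    proof -
      note i = ab[unfolded allowed_iff cp]
      consider "a \<in> Sp" "b \<notin> Sp" | "a \<notin> Sp" "b \<in> Sp" | "a \<notin> Sp" "b \<notin> Sp"
        using i loop[of a] Sp_unique[of a b] by auto
      then show ?thesis
      proof cases
        case 1
        have "ok (tail Q a) (pos b)" using arrow[of b] 1 i loop[of a] by (auto simp: ok_def)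
        then show ?thesis using ok_some[of "tail Q a" "pos b"] 1 loop[of a] by (simp add: rank_def)
      next
        case 2
        have "ok (tail Q b) (fst (pos a), Suc (snd (pos a)))" using arrow[of a] 2 i by (auto simp: ok_def)
        then show ?thesis using ok_some[of "tail Q b" "(fst (pos a), Suc (snd (pos a)))"] 2 loop[of b] by (simp add: rank_def)
      next
        case 3
        then show ?thesis using i arrow(3)[of a] by (simp add: rank_def)
      qed
    qed
    have "rank a < rank b" if "(a, b) \<in> M.allowed\<^sup>+" for a b
      using that by (induction rule: trancl_induct) (use rank less_trans in blast)+
    then show ?thesis unfolding acyclic_def by blast
  qed
  have "gentle TYPE('k) Q ?\<rho>"
    unfolding M.gentle_iff
  proof (intro conjI ballI)
    fix x assume "x \<in> verts Q"
    then show "card {a \<in> arcs Q. tail Q a = x} \<le> 2" "card {a \<in> arcs Q. head Q a = x} \<le> 2"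
      using deg by simp_all
  next
    fix a
    show "\<forall>b b'. (a, b) \<in> ?\<rho> \<longrightarrow> (a, b') \<in> ?\<rho> \<longrightarrow> b = b'" by (intro allI impI) (erule (1) r1)
    show "\<forall>b b'. (a, b) \<in> M.allowed \<longrightarrow> (a, b') \<in> M.allowed \<longrightarrow> b = b'" by (intro allI impI) (erule (1) a1)
    show "\<forall>b b'. (b, a) \<in> ?\<rho> \<longrightarrow> (b', a) \<in> ?\<rho> \<longrightarrow> b = b'" by (intro allI impI) (erule (1) r2)
    show "\<forall>b b'. (b, a) \<in> M.allowed \<longrightarrow> (b', a) \<in> M.allowed \<longrightarrow> b = b'" by (intro allI impI) (erule (1) a2)
  qed (rule acyclic)
  then show ?thesis using Sp(1) comp by (auto simp: skew_gentle_def)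
qed

context skew_brauer_graph
begin

text \<open>\<open>Q\<close> has the edges of \<open>\<Gamma>\<close> as vertices, the arrows
  \<open>A0\<close> left after cutting, and a special loop for each special edge. In the admissible
  presentation the loops survive only as the marking of the vertices to be split.\<close>

theorem cut_to_skew_gentle:
  assumes one: "multiplicity_one \<Gamma>"
  shows "\<exists>(Q :: (nat, nat) pre_digraph) \<rho> Sp. skew_gentle TYPE('k::field) Q \<rho> Sp \<and>
     algebra_iso (trivial_extension (admissible_presentation Q \<rho> Sp :: ('k, _) module)) (skew_brauer_graph_algebra \<Gamma>)"
proof -
  define A0 where "A0 = {(v, i). v \<in> vertices \<Gamma> \<and> Suc i < V v}"
  define A where "A = Inl ` A0 \<union> Inr ` special_edges \<Gamma>"
  have "A0 \<subseteq> (SIGMA v : vertices \<Gamma>. {..<V v})" by (auto simp: A0_def)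
  then have fin_A0: "finite A0" by (rule finite_subset) (simp add: finite_vertices)
  have sp: "special_edges \<Gamma> \<subseteq> edges \<Gamma>" by (auto simp: special_edges_def)
  then have fin_A: "finite A" using fin_A0 finite_subset[OF sp finite_edges] by (simp add: A_def)
  \<comment> \<open>Edges and arrows are numbered, since the witness has to live over the fixed type
    \<open>nat\<close>.\<close>
  obtain f :: "'e \<Rightarrow> nat" where f: "inj_on f (edges \<Gamma>)" using finite_imp_inj_to_nat_seg[OF finite_edges] by blast
  obtain h :: "('v \<times> nat) + 'e \<Rightarrow> nat" where h: "inj_on h A" using finite_imp_inj_to_nat_seg[OF fin_A] by blast
  define \<gamma> where "\<gamma> = inv_into (edges \<Gamma>) f"
  define dec where "dec = inv_into A h"
  have \<gamma>f [simp]: "\<gamma> (f x) = x" if "x \<in> edges \<Gamma>" for x using f that by (simp add: \<gamma>_def)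
  have dech [simp]: "dec (h a) = a" if "a \<in> A" for a using h that by (simp add: dec_def)
  have f_eq: "f x = f y \<longleftrightarrow> x = y" if "x \<in> edges \<Gamma>" "y \<in> edges \<Gamma>" for x y
    using f that by (auto simp: inj_on_def)
  \<comment> \<open>Special loops have no position; \<open>pos\<close> is consulted on ordinary
    arrows only.\<close>
  define pos where "pos a = (case dec a of Inl p \<Rightarrow> p | Inr x \<Rightarrow> undefined)" for a
  define Q :: "(nat, nat) pre_digraph" where
    "Q = \<lparr>verts = f ` edges \<Gamma>, arcs = h ` A,
      tail = (\<lambda>a. f (case dec a of Inl p \<Rightarrow> cyc_at (fst p) (snd p) | Inr x \<Rightarrow> x)),
      head = (\<lambda>a. f (case dec a of Inl p \<Rightarrow> cyc_at (fst p) (Suc (snd p)) | Inr x \<Rightarrow> x))\<rparr>"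
  define Sp where "Sp = h ` Inr ` special_edges \<Gamma>"
  define S where "S = tail Q ` Sp"
  define \<rho> where "\<rho> = {(a, b) \<in> composable_pairs Q. a \<notin> Sp \<and> b \<notin> Sp \<and>
      (pos b \<noteq> next_arrow \<Gamma> (pos a) \<or> head Q a \<in> S)}"
  have Inl: "Inl p \<in> A" "fst p \<in> vertices \<Gamma>" "Suc (snd p) < V (fst p)" if "p \<in> A0" for p
    using that by (auto simp: A_def A0_def)
  have Inr: "Inr x \<in> A" "x \<in> edges \<Gamma>" if "x \<in> special_edges \<Gamma>" for x
    using that sp by (auto simp: A_def)
  have pos_h: "pos (h (Inl p)) = p" if "p \<in> A0" for p using Inl(1)[OF that] by (simp add: pos_def)
  have tail_Inl: "tail Q (h (Inl p)) = f (cyc_at (fst p) (snd p))"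
    and head_Inl: "head Q (h (Inl p)) = f (cyc_at (fst p) (Suc (snd p)))" if "p \<in> A0" for p
    using Inl(1)[OF that] by (simp_all add: Q_def)
  have tail_Inr: "tail Q (h (Inr x)) = f x" and head_Inr: "head Q (h (Inr x)) = f x" if "x \<in> special_edges \<Gamma>" for x
    using Inr(1)[OF that] by (simp_all add: Q_def)
  have S_eq: "S = f ` special_edges \<Gamma>" using tail_Inr by (auto simp: S_def Sp_def image_iff)
  have arcs_Q: "arcs Q = h ` Inl ` A0 \<union> Sp" by (auto simp: Q_def A_def Sp_def)
  have "h (Inl p) \<notin> Sp" if "p \<in> A0" for p
    using h Inl(1)[OF that] Inr(1) by (auto simp: Sp_def inj_on_def)
  then have aux_arcs: "arcs Q - Sp = h ` Inl ` A0" unfolding arcs_Q by auto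
  have fin_Q: "fin_digraph Q"
  proof
    show "finite (verts Q)" "finite (arcs Q)" using finite_edges fin_A by (simp_all add: Q_def)
    fix a assume "a \<in> arcs Q"
    then consider p where "p \<in> A0" "a = h (Inl p)" | x where "x \<in> special_edges \<Gamma>" "a = h (Inr x)"
      unfolding arcs_Q Sp_def by auto
    then have "tail Q a \<in> f ` edges \<Gamma> \<and> head Q a \<in> f ` edges \<Gamma>"
    proof cases
      case 1
      then show ?thesis
        using tail_Inl[OF 1(1)] head_Inl[OF 1(1)] at_edges[OF Inl(2)[OF 1(1)], of "snd p"]
          at_edges[OF Inl(2)[OF 1(1)] Inl(3)[OF 1(1)]] Inl(3)[OF 1(1)] by simp
    next
      case 2
      then show ?thesis using tail_Inr head_Inr Inr by auto
    qed
    then show "tail Q a \<in> verts Q" "head Q a \<in> verts Q" by (auto simp: Q_def)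
  qed
  have verts_Q: "verts Q = f ` edges \<Gamma>" by (simp add: Q_def)
  have cut: "cut_cover \<Gamma> (aux_quiver Q Sp) \<gamma> pos S (aux_relations Q \<rho> Sp)"
  proof (intro cut_cover.intro brauer_cover.intro cut_cover_axioms.intro brauer_cover_axioms.intro
      skew_brauer_graph_axioms fin_digraph_aux_quiver fin_Q one; unfold aux_quiver_simps verts_Q aux_arcs)
    show "\<gamma> x \<in> edges \<Gamma>" if "x \<in> f ` edges \<Gamma>" for x using that by auto
    show "inj_on \<gamma> (f ` edges \<Gamma>)" by (auto simp: inj_on_def)
    show "(x \<in> S) = (\<gamma> x \<in> special_edges \<Gamma>)" if "x \<in> f ` edges \<Gamma>" for x
      using that sp f_eq by (auto simp: S_eq)
    show "\<gamma> ` f ` edges \<Gamma> = edges \<Gamma>" by (force simp: image_image)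
    show "pos ` h ` Inl ` A0 = {(v, i). v \<in> vertices \<Gamma> \<and> Suc i < V v}"
      using pos_h by (force simp: image_image A0_def)
    show "inj_on pos (h ` Inl ` A0)" using pos_h by (auto simp: inj_on_def)
    fix a assume "a \<in> h ` Inl ` A0"
    then obtain p where p: "p \<in> A0" "a = h (Inl p)" by auto
    show "fst (pos a) \<in> vertices \<Gamma> \<and> snd (pos a) < V (fst (pos a))" using p pos_h Inl[of p] by auto
    show "\<gamma> (tail Q a) = cyc_at (fst (pos a)) (snd (pos a))"
      using p pos_h Inl[of p] tail_Inl at_edges by simp
    show "\<gamma> (head Q a) = cyc_at (fst (pos a)) (Suc (snd (pos a)) mod V (fst (pos a)))"
      using p pos_h Inl[of p] head_Inl at_edges by simp
    fix b assume b: "b \<in> h ` Inl ` A0" and c: "head Q a = tail Q b"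
    have "a \<in> arcs Q - Sp" "b \<in> arcs Q - Sp" using p b unfolding aux_arcs by auto
    then show "((a, b) \<in> aux_relations Q \<rho> Sp) = (pos b \<noteq> next_arrow \<Gamma> (pos a) \<and> head Q a \<notin> S)"
      using c by (auto simp: aux_relations_def \<rho>_def special_verts_def S_def composable_pairs_def)
  qed
  interpret C: cut_cover \<Gamma> "aux_quiver Q Sp" \<gamma> pos S "aux_relations Q \<rho> Sp" by (rule cut)
  have "skew_gentle TYPE('k) Q \<rho> Sp"
  proof (rule skew_gentleI[OF fin_Q cut])
    show "Sp \<subseteq> {f \<in> arcs Q. tail Q f = head Q f}" using tail_Inr head_Inr unfolding arcs_Q by (auto simp: Sp_def)
    show "inj_on (tail Q) Sp"
      using tail_Inr f_eq Inr(2) by (auto simp: Sp_def inj_on_def)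
  qed (simp_all add: S_def \<rho>_def)
  moreover have "algebra_iso (trivial_extension (admissible_presentation Q \<rho> Sp :: ('k, _) module)) (skew_brauer_graph_algebra \<Gamma>)"
    using C.trivial_extension_iso_brauer by (simp add: admissible_presentation_def Let_def special_verts_def S_def)
  ultimately show ?thesis by blast
qed

end

section \<open>From skew-gentle algebras to skew-Brauer graphs\<close>

text \<open>An injective partial map without cycles splits a finite set into disjoint chains, each
  named by its first element. For the half-edges of a gentle quiver this yields vertices together
  with an ordering at each of them.\<close>

locale chains =
  fixes H :: "'h set" and \<sigma> :: "('h \<times> 'h) set"
  assumes finite_H: "finite H" and \<sigma>_subset: "\<sigma> \<subseteq> H \<times> H"
    and single_valued: "(h, h1) \<in> \<sigma> \<Longrightarrow> (h, h2) \<in> \<sigma> \<Longrightarrow> h1 = h2"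
    and injective: "(h1, h) \<in> \<sigma> \<Longrightarrow> (h2, h) \<in> \<sigma> \<Longrightarrow> h1 = h2"
    and acyclic: "acyclic \<sigma>"
begin

lemma finite_\<sigma>: "finite \<sigma>"
  using \<sigma>_subset finite_H by (meson finite_SigmaI finite_subset)

lemma wf_\<sigma>: "wf \<sigma>" "wf (\<sigma>\<inverse>)"
  using finite_acyclic_wf[OF finite_\<sigma> acyclic] finite_acyclic_wf_converse[OF finite_\<sigma> acyclic] by auto

definition roots :: "'h set" where "roots = H - Range \<sigma>"

text \<open>Going forward ends because \<open>\<sigma>\<close> is finite and acyclic, so that its
  converse is well-founded.\<close>

lemma chain_exists: "\<exists>c. c \<noteq> [] \<and> hd c = h \<and> successively (\<lambda>x y. (x, y) \<in> \<sigma>) c \<and> last c \<notin> Domain \<sigma>"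
proof (induction h rule: wf_induct_rule[OF wf_\<sigma>(2)])
  case (1 h)
  show ?case
  proof (cases "h \<in> Domain \<sigma>")
    case True
    then obtain h' where h': "(h, h') \<in> \<sigma>" by blast
    then obtain c where "c \<noteq> []" "hd c = h'" "successively (\<lambda>x y. (x, y) \<in> \<sigma>) c" "last c \<notin> Domain \<sigma>"
      using 1[of h'] by auto
    then show ?thesis using h' by (intro exI[of _ "h # c"]) (auto simp: successively_Cons)
  next
    case False
    then show ?thesis by (intro exI[of _ "[h]"]) auto
  qed
qed

definition chain :: "'h \<Rightarrow> 'h list" where
  "chain h = (SOME c. c \<noteq> [] \<and> hd c = h \<and> successively (\<lambda>x y. (x, y) \<in> \<sigma>) c \<and> last c \<notin> Domain \<sigma>)"

lemma chain: "chain h \<noteq> []" "hd (chain h) = h" "successively (\<lambda>x y. (x, y) \<in> \<sigma>) (chain h)" "last (chain h) \<notin> Domain \<sigma>"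
  using someI_ex[OF chain_exists[of h]] by (simp_all add: chain_def)

lemma successively_nth: "successively P xs \<Longrightarrow> Suc i < length xs \<Longrightarrow> P (xs ! i) (xs ! Suc i)"
proof (induction xs arbitrary: i rule: induct_list012)
  case (3 x y zs)
  then show ?case by (cases i) auto
qed auto

lemma chain_step: "Suc i < length (chain h) \<Longrightarrow> (chain h ! i, chain h ! Suc i) \<in> \<sigma>"
  using successively_nth[OF chain(3)] .

lemma chain_0: "chain h ! 0 = h" "0 < length (chain h)"
  using chain(1,2)[of h] by (simp_all add: hd_conv_nth)

lemma chain_next:
  assumes "i < length (chain h)" "(chain h ! i, y) \<in> \<sigma>"
  shows "Suc i < length (chain h)" "chain h ! Suc i = y"
proof -
  show "Suc i < length (chain h)"
  proof (rule ccontr)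
    assume "\<not> Suc i < length (chain h)"
    then have "i = length (chain h) - 1" using assms(1) by simp
    then have "chain h ! i = last (chain h)" using chain(1)[of h] by (simp add: last_conv_nth)
    then show False using chain(4)[of h] assms(2) by auto
  qed
  then show "chain h ! Suc i = y" using chain_step assms(2) single_valued by blast
qed

lemma chain_subset: "h \<in> H \<Longrightarrow> i < length (chain h) \<Longrightarrow> chain h ! i \<in> H"
  using chain_0 chain_step[of _ h] \<sigma>_subset by (cases i) auto

text \<open>Going backward ends as well, by well-foundedness of \<open>\<sigma>\<close>, and it can
  only end at a root.\<close>

lemma chain_cover:
  assumes "h \<in> H" shows "\<exists>r i. r \<in> roots \<and> i < length (chain r) \<and> chain r ! i = h"
  using assms
proof (induction h rule: wf_induct_rule[OF wf_\<sigma>(1)])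
  case (1 h)
  show ?case
  proof (cases "h \<in> Range \<sigma>")
    case True
    then obtain h' where h': "(h', h) \<in> \<sigma>" by blast
    then obtain r i where r: "r \<in> roots" "i < length (chain r)" "chain r ! i = h'" using 1 \<sigma>_subset by blast
    then show ?thesis using chain_next[OF r(2)] h' by blast
  next
    case False
    then have "h \<in> roots" using 1 by (simp add: roots_def)
    then show ?thesis using chain_0 by blast
  qed
qed

text \<open>Injectivity allows stepping back in both chains at once until one of them is at its
  root; a root has no predecessor, so the other is at its root too.\<close>

lemma chain_unique:
  assumes "r \<in> roots" "r' \<in> roots" "i < length (chain r)" "j < length (chain r')" "chain r ! i = chain r' ! j"
  shows "r = r' \<and> i = j"
  using assms(3-5)
proof (induction i arbitrary: j)
  case 0
  show ?case
  proof (cases j)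
    case (Suc j')
    then have "r \<in> Range \<sigma>" using 0 chain_step[of j' r'] chain_0[of r] by (metis RangeI)
    then show ?thesis using assms(1) by (simp add: roots_def)
  qed (use 0 chain_0 in simp)
next
  case (Suc i)
  show ?case
  proof (cases j)
    case 0
    then have "r' \<in> Range \<sigma>" using Suc.prems chain_step[of i r] chain_0[of r'] by (metis RangeI)
    then show ?thesis using assms(2) by (simp add: roots_def)
  next
    case (Suc j')
    then have "chain r ! i = chain r' ! j'"
      using chain_step[of i r] chain_step[of j' r'] Suc.prems injective by metis
    then show ?thesis using Suc.IH[of j'] Suc.prems Suc by simp
  qed
qed

lemma distinct_chain: "r \<in> roots \<Longrightarrow> distinct (chain r)"
  using chain_unique[of r r] by (auto simp: distinct_conv_nth)

definition place :: "'h \<Rightarrow> 'h \<times> nat" where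
  "place h = (SOME p. fst p \<in> roots \<and> snd p < length (chain (fst p)) \<and> chain (fst p) ! snd p = h)"

lemma place:
  assumes "h \<in> H"
  shows "fst (place h) \<in> roots" "snd (place h) < length (chain (fst (place h)))" "chain (fst (place h)) ! snd (place h) = h"
proof -
  obtain r i where "r \<in> roots \<and> i < length (chain r) \<and> chain r ! i = h" using chain_cover[OF assms] by blast
  then have "\<exists>p. fst p \<in> roots \<and> snd p < length (chain (fst p)) \<and> chain (fst p) ! snd p = h"
    by (intro exI[of _ "(r, i)"]) simp
  from someI_ex[OF this] show "fst (place h) \<in> roots" "snd (place h) < length (chain (fst (place h)))"
    "chain (fst (place h)) ! snd (place h) = h"
    by (simp_all add: place_def)
qed

lemma place_eqI:
  assumes "r \<in> roots" "i < length (chain r)" "chain r ! i = h" shows "place h = (r, i)"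
proof -
  have "h \<in> H" using assms chain_subset roots_def by blast
  then show ?thesis using place[OF \<open>h \<in> H\<close>] chain_unique[OF _ assms(1) _ assms(2)] assms(3) by (simp add: prod_eq_iff)
qed

lemma place_next:
  assumes "(h, h') \<in> \<sigma>" shows "place h' = (fst (place h), Suc (snd (place h)))"
    "Suc (snd (place h)) < length (chain (fst (place h)))"
proof -
  have "h \<in> H" using assms \<sigma>_subset by blast
  note p = place[OF this]
  have "(chain (fst (place h)) ! snd (place h), h') \<in> \<sigma>" using assms p(3) by simp
  note n = chain_next[OF p(2) this]
  show "Suc (snd (place h)) < length (chain (fst (place h)))" by (rule n)
  show "place h' = (fst (place h), Suc (snd (place h)))" by (rule place_eqI[OF p(1) n])
qed

lemma in_chain_iff: "r \<in> roots \<Longrightarrow> h \<in> H \<Longrightarrow> h \<in> set (chain r) \<longleftrightarrow> fst (place h) = r"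
  using place_eqI[of r _ h] place[of h] by (auto simp: in_set_conv_nth)

text \<open>Meant for the free half-edges over special loops, whose chains become vertices of
  valency one.\<close>

lemma isolated_chain:
  assumes "h \<in> H" "h \<notin> Range \<sigma>" "h \<notin> Domain \<sigma>" shows "h \<in> roots" "chain h = [h]"
proof -
  show "h \<in> roots" using assms by (simp add: roots_def)
  have "\<not> Suc 0 < length (chain h)" using chain_step[of 0 h] chain_0[of h] assms(3) by (metis DomainI)
  then have "length (chain h) = 1" using chain_0(2)[of h] by linarith
  then show "chain h = [h]" using chain_0(1)[of h] by (cases "chain h") auto
qed

end

lemma card_le_two_eq:
  assumes "card M \<le> 2" "finite M" "a \<in> M" "b \<in> M" "c \<in> M" "b \<noteq> a" "c \<noteq> a" shows "b = c"
proof (rule ccontr)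
  assume "b \<noteq> c"
  then have "card {a, b, c} = 3" using assms by simp
  moreover have "card {a, b, c} \<le> card M" using assms by (intro card_mono) auto
  ultimately show False using assms(1) by simp
qed

text \<open>At each vertex it must be decided which half-edge an arrow enters or leaves, so that
  \<open>b\<close> leaves the half-edge entered by \<open>a\<close> exactly when \<open>a b\<close>
  is no zero relation of the auxiliary gentle algebra. Gentleness makes this possible vertex by
  vertex. Reading a chain cyclically adds the step from its last half-edge to its first, which is
  the one that \<open>cut_cover\<close> leaves out.\<close>

theorem skew_gentle_to_brauer:
  fixes Q :: "('x, 'a) pre_digraph"
  assumes sg: "skew_gentle TYPE('k::field) Q \<rho> Sp"
  shows "\<exists>\<Gamma> :: (nat, nat) skew_brauer_graph. skew_brauer_graph \<Gamma> \<and> multiplicity_one \<Gamma> \<and>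
     algebra_iso (trivial_extension (admissible_presentation Q \<rho> Sp :: ('k, _) module)) (skew_brauer_graph_algebra \<Gamma>)"
proof -
  let ?\<rho> = "\<rho> \<union> {(f, f) | f. f \<in> Sp}"
  have gentle: "gentle TYPE('k) Q ?\<rho>" and Sp: "Sp \<subseteq> {f \<in> arcs Q. tail Q f = head Q f}"
    and \<rho>: "\<rho> \<subseteq> composable_pairs Q"
    using sg by (auto simp: skew_gentle_def)
  then have fin: "fin_digraph Q" and comp: "?\<rho> \<subseteq> composable_pairs Q" by (auto simp: gentle_def)
  interpret Q: fin_digraph Q by (rule fin)
  interpret M: monomial_quiver Q ?\<rho> by unfold_locales (rule comp)
  define S where "S = special_verts Q Sp"
  define A where "A = arcs Q - Sp"
  have g: "(\<forall>x \<in> verts Q. card {a \<in> arcs Q. tail Q a = x} \<le> 2 \<and> card {a \<in> arcs Q. head Q a = x} \<le> 2) \<and>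
     (\<forall>a\<in>arcs Q. (\<forall>b b'. (a, b) \<in> ?\<rho> \<longrightarrow> (a, b') \<in> ?\<rho> \<longrightarrow> b = b') \<and>
        (\<forall>b b'. (a, b) \<in> M.allowed \<longrightarrow> (a, b') \<in> M.allowed \<longrightarrow> b = b') \<and>
        (\<forall>b b'. (b, a) \<in> ?\<rho> \<longrightarrow> (b', a) \<in> ?\<rho> \<longrightarrow> b = b') \<and>
        (\<forall>b b'. (b, a) \<in> M.allowed \<longrightarrow> (b', a) \<in> M.allowed \<longrightarrow> b = b')) \<and>
     acyclic M.allowed"
    using gentle unfolding M.gentle_iff .
  have cp: "(a, b) \<in> composable_pairs Q \<longleftrightarrow> a \<in> arcs Q \<and> b \<in> arcs Q \<and> head Q a = tail Q b" for a b
    by (auto simp: composable_pairs_def)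
  have inQ: "a \<in> arcs Q \<and> b \<in> arcs Q" if "(a, b) \<in> composable_pairs Q" for a b using that cp by simp
  have allowed_cp: "(a, b) \<in> M.allowed \<Longrightarrow> (a, b) \<in> composable_pairs Q" for a b by (simp add: M.allowed_def)
  have r1: "b = b'" if "(a, b) \<in> ?\<rho>" "(a, b') \<in> ?\<rho>" for a b b'
    using g inQ[of a b] comp that by blast
  have r2: "b = b'" if "(b, a) \<in> ?\<rho>" "(b', a) \<in> ?\<rho>" for a b b'
    using g inQ[of b a] comp that by blast
  have a1: "b = b'" if "(a, b) \<in> M.allowed" "(a, b') \<in> M.allowed" for a b b'
    using g inQ[of a b] allowed_cp[of a b] that by blast
  have a2: "b = b'" if "(b, a) \<in> M.allowed" "(b', a) \<in> M.allowed" for a b b'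
    using g inQ[of b a] allowed_cp[of b a] that by blast
  have acyc: "acyclic M.allowed" using g by blast
  have loop: "f \<in> arcs Q" "head Q f = tail Q f" "tail Q f \<in> S" "(f, f) \<in> ?\<rho>" if "f \<in> Sp" for f
    using that Sp by (auto simp: S_def special_verts_def)
  have S_D: "\<exists>f. f \<in> Sp \<and> tail Q f = x" if "x \<in> S" for x using that by (auto simp: S_def special_verts_def)
  \<comment> \<open>\<open>f f\<close> is already a zero relation, so gentleness leaves
    \<open>a f\<close> and \<open>f b\<close> nonzero for all ordinary arrows; hence at most one of
    them enters and at most one leaves a special vertex.\<close>
  have into_loop: "(a, f) \<in> M.allowed" if "f \<in> Sp" "a \<in> A" "head Q a = tail Q f" for a f
    using that loop[OF that(1)] r2[of a f f] by (auto simp: M.allowed_def cp A_def)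
  have out_of_loop: "(f, b) \<in> M.allowed" if "f \<in> Sp" "b \<in> A" "tail Q b = tail Q f" for b f
    using that loop[OF that(1)] r1[of f b f] by (auto simp: M.allowed_def cp A_def)
  have special_in: "a = a'" if "a \<in> A" "a' \<in> A" "head Q a = head Q a'" "head Q a \<in> S" for a a'
  proof -
    note h = that
    obtain f where "f \<in> Sp" "tail Q f = head Q a" using S_D[OF h(4)] by blast
    then show ?thesis using into_loop[of f a] into_loop[of f a'] h by (intro a2[of a f a']) simp_all
  qed
  have special_out: "b = b'" if "b \<in> A" "b' \<in> A" "tail Q b = tail Q b'" "tail Q b \<in> S" for b b'
  proof -
    note h = that
    obtain f where "f \<in> Sp" "tail Q f = tail Q b" using S_D[OF h(4)] by blast
    then show ?thesis using out_of_loop[of f b] out_of_loop[of f b'] h by (intro a1[of f b b']) simp_all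
  qed
  \<comment> \<open>The surviving compositions of the auxiliary algebra: at special vertices the
    pairs of \<open>\<rho>\<close> are dropped, so there every composable pair counts.\<close>
  define nxt where "nxt = {(a, b). a \<in> A \<and> b \<in> A \<and> head Q a = tail Q b \<and> (head Q a \<in> S \<or> (a, b) \<notin> \<rho>)}"
  have nxt_allowed: "(a, b) \<in> nxt \<longleftrightarrow> (a, b) \<in> M.allowed" and not_nxt: "(a, b) \<notin> nxt \<longleftrightarrow> (a, b) \<in> ?\<rho>"
    if "a \<in> A" "b \<in> A" "head Q a = tail Q b" "head Q a \<notin> S" for a b
    using that by (auto simp: nxt_def M.allowed_def cp A_def)
  \<comment> \<open>A step across a special vertex is replaced by the detour \<open>a\<close>,
    \<open>f\<close>, \<open>b\<close> through the loop, so a cycle of \<open>nxt\<close> would give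
    a cycle of allowed pairs.\<close>
  have sub: "nxt \<subseteq> M.allowed\<^sup>+"
  proof
    fix z assume "z \<in> nxt"
    then obtain a b where z: "z = (a, b)" "a \<in> A" "b \<in> A" "head Q a = tail Q b" "(a, b) \<in> nxt" by (auto simp: nxt_def)
    show "z \<in> M.allowed\<^sup>+"
    proof (cases "head Q a \<in> S")
      case True
      then obtain f where "f \<in> Sp" "tail Q f = head Q a" using S_D by blast
      then have "(a, f) \<in> M.allowed" "(f, b) \<in> M.allowed" using into_loop[of f a] out_of_loop[of f b] z by auto
      then show ?thesis unfolding z(1) by (meson r_into_trancl trancl_into_trancl)
    next
      case False
      then show ?thesis using nxt_allowed z by blast
    qed
  qed
  have "(a, b) \<in> M.allowed\<^sup>+" if "(a, b) \<in> nxt\<^sup>+" for a b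
    using that
  proof (induction rule: trancl_induct)
    case (base y)
    then show ?case by (rule subsetD[OF sub])
  next
    case (step y z)
    show ?case by (rule trancl_trans[OF step(3) subsetD[OF sub step(2)]])
  qed
  then have acyc_nxt: "acyclic nxt" using acyc unfolding acyclic_def by blast
  \<comment> \<open>At the vertex \<open>x\<close>, \<open>s b\<close> is the half-edge that
    \<open>b\<close> leaves and \<open>t a\<close> the one that \<open>a\<close> enters.\<close>
  have local: "\<exists>s t. (\<forall>a\<in>A. \<forall>b\<in>A. tail Q a = x \<longrightarrow> tail Q b = x \<longrightarrow> s a = s b \<longrightarrow> a = b) \<and>
      (\<forall>a\<in>A. \<forall>b\<in>A. head Q a = x \<longrightarrow> head Q b = x \<longrightarrow> t a = t b \<longrightarrow> a = b) \<and>
      (\<forall>a\<in>A. \<forall>b\<in>A. head Q a = x \<longrightarrow> tail Q b = x \<longrightarrow> (t a = s b \<longleftrightarrow> (a, b) \<in> nxt)) \<and>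
      (x \<in> S \<longrightarrow> (\<forall>a. \<not> s a \<and> \<not> t a))" (is "\<exists>s t. ?P s t") if x: "x \<in> verts Q" for x
  proof (cases "x \<in> S")
    case True
    \<comment> \<open>The half-edge \<open>False\<close> takes the single arrow in either direction,
      and \<open>True\<close> stays free to become the special end.\<close>
    have w: "?P (\<lambda>_. False) (\<lambda>_. False)"
      using True special_in special_out by (auto simp: nxt_def)
    show ?thesis by (rule exI[where x = "\<lambda>_. False"], rule exI[where x = "\<lambda>_. False"]) (rule w)
  next
    case xS: False
    have card2: "b = c" if "ep = tail Q \<or> ep = head Q" "a \<in> A" "b \<in> A" "c \<in> A" "ep a = x" "ep b = x" "ep c = x" "b \<noteq> a" "c \<noteq> a"
      for ep and a b c
    proof (rule card_le_two_eq[of "{a \<in> arcs Q. ep a = x}" a])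
      show "card {a \<in> arcs Q. ep a = x} \<le> 2" using that(1) g x by auto
    qed (use that in \<open>auto simp: A_def\<close>)
    show ?thesis
    proof (cases "\<exists>b0. b0 \<in> A \<and> tail Q b0 = x")
      case True
      then obtain b0 where b0: "b0 \<in> A" "tail Q b0 = x" by blast
      \<comment> \<open>\<open>b0\<close> leaves the half-edge \<open>True\<close> and any other
        outgoing arrow leaves \<open>False\<close>; an arrow enters \<open>True\<close> exactly if
        it can be followed by \<open>b0\<close>.\<close>
      have w: "?P (\<lambda>b. b = b0) (\<lambda>a. (a, b0) \<in> nxt)"
      proof (intro conjI ballI impI)
        fix a b assume ab: "a \<in> A" "b \<in> A" "tail Q a = x" "tail Q b = x" "(a = b0) = (b = b0)"
        show "a = b"
        proof (cases "a = b0")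
          case False
          then show ?thesis using card2[of "tail Q" b0 a b] ab b0 by auto
        qed (use ab in auto)
      next
        fix a b assume ab: "a \<in> A" "b \<in> A" "head Q a = x" "head Q b = x" "((a, b0) \<in> nxt) = ((b, b0) \<in> nxt)"
        show "a = b"
        proof (cases "(a, b0) \<in> nxt")
          case True
          then show ?thesis using nxt_allowed[of a b0] nxt_allowed[of b b0] ab b0 xS a2 by auto
        next
          case False
          then have "(a, b0) \<in> ?\<rho>" "(b, b0) \<in> ?\<rho>" using not_nxt[of a b0] not_nxt[of b b0] ab b0 xS by simp_all
          then show ?thesis by (rule r2)
        qed
      next
        fix a b assume ab: "a \<in> A" "b \<in> A" "head Q a = x" "tail Q b = x"
        \<comment> \<open>Faced with two outgoing arrows, \<open>a\<close> has exactly one nonzero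
          and one zero continuation by gentleness.\<close>
        show "((a, b0) \<in> nxt) = (b = b0) \<longleftrightarrow> (a, b) \<in> nxt"
        proof (cases "b = b0")
          case False
          have "\<not> ((a, b) \<in> nxt \<and> (a, b0) \<in> nxt)"
            using nxt_allowed[of a b] nxt_allowed[of a b0] a1[of a b b0] ab b0 xS False by auto
          moreover have "(a, b) \<in> nxt \<or> (a, b0) \<in> nxt"
          proof (rule ccontr)
            assume "\<not> ?thesis"
            then have "(a, b) \<in> ?\<rho>" "(a, b0) \<in> ?\<rho>" using not_nxt[of a b] not_nxt[of a b0] ab b0 xS by simp_all
            then have "b = b0" by (rule r1)
            then show False using False by simp
          qed
          ultimately show ?thesis using False by blast
        qed simp
      qed (use xS in auto)
      show ?thesis by (rule exI[where x = "\<lambda>b. b = b0"], rule exI[where x = "\<lambda>a. (a, b0) \<in> nxt"]) (rule w)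
    next
      case none: False
      \<comment> \<open>No ordinary arrow leaves \<open>x\<close>, so it suffices to tell the at
        most two incoming ones apart by singling one out.\<close>
      define a0 where "a0 = (SOME a. a \<in> A \<and> head Q a = x)"
      have a0: "a0 \<in> A \<and> head Q a0 = x" if "a \<in> A" "head Q a = x" for a
        unfolding a0_def by (rule someI[of _ a]) (use that in simp)
      have w: "?P (\<lambda>_. False) (\<lambda>a. a = a0)"
      proof (intro conjI ballI impI)
        fix a b assume ab: "a \<in> A" "b \<in> A" "head Q a = x" "head Q b = x" "(a = a0) = (b = a0)"
        show "a = b"
        proof (cases "a = a0")
          case False
          then show ?thesis using card2[of "head Q" a0 a b] ab a0[of a] by auto
        qed (use ab in auto)
      qed (use none xS in auto)
      show ?thesis by (rule exI[where x = "\<lambda>_. False"], rule exI[where x = "\<lambda>a. a = a0"]) (rule w)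
    qed
  qed
  have "\<forall>x\<in>verts Q. \<exists>p. (\<forall>a\<in>A. \<forall>b\<in>A. tail Q a = x \<longrightarrow> tail Q b = x \<longrightarrow> fst p a = fst p b \<longrightarrow> a = b) \<and>
      (\<forall>a\<in>A. \<forall>b\<in>A. head Q a = x \<longrightarrow> head Q b = x \<longrightarrow> snd p a = snd p b \<longrightarrow> a = b) \<and>
      (\<forall>a\<in>A. \<forall>b\<in>A. head Q a = x \<longrightarrow> tail Q b = x \<longrightarrow> (snd p a = fst p b \<longleftrightarrow> (a, b) \<in> nxt)) \<and>
      (x \<in> S \<longrightarrow> (\<forall>a. \<not> fst p a \<and> \<not> snd p a))"
    using local by (simp add: split_paired_Ex)
  from bchoice[OF this] obtain P where P: "\<forall>x\<in>verts Q. (\<forall>a\<in>A. \<forall>b\<in>A. tail Q a = x \<longrightarrow> tail Q b = x \<longrightarrow> fst (P x) a = fst (P x) b \<longrightarrow> a = b) \<and>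
      (\<forall>a\<in>A. \<forall>b\<in>A. head Q a = x \<longrightarrow> head Q b = x \<longrightarrow> snd (P x) a = snd (P x) b \<longrightarrow> a = b) \<and>
      (\<forall>a\<in>A. \<forall>b\<in>A. head Q a = x \<longrightarrow> tail Q b = x \<longrightarrow> (snd (P x) a = fst (P x) b \<longleftrightarrow> (a, b) \<in> nxt)) \<and>
      (x \<in> S \<longrightarrow> (\<forall>a. \<not> fst (P x) a \<and> \<not> snd (P x) a))" by (rule exE)
  define src where "src a = (tail Q a, fst (P (tail Q a)) a)" for a
  define tgt where "tgt a = (head Q a, snd (P (head Q a)) a)" for a
  have Av: "a \<in> A \<Longrightarrow> tail Q a \<in> verts Q \<and> head Q a \<in> verts Q" for a by (simp add: A_def)
  have src_inj: "a = b" if ab: "a \<in> A" "b \<in> A" "src a = src b" for a b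
  proof -
    have "tail Q a = tail Q b" "fst (P (tail Q a)) a = fst (P (tail Q a)) b" using ab(3) by (auto simp: src_def)
    then show ?thesis using bspec[OF P, of "tail Q a"] Av[OF ab(1)] ab(1,2) by metis
  qed
  have tgt_inj: "a = b" if ab: "a \<in> A" "b \<in> A" "tgt a = tgt b" for a b
  proof -
    have "head Q a = head Q b" "snd (P (head Q a)) a = snd (P (head Q a)) b" using ab(3) by (auto simp: tgt_def)
    then show ?thesis using bspec[OF P, of "head Q a"] Av[OF ab(1)] ab(1,2) by metis
  qed
  have tgt_src: "tgt a = src b \<longleftrightarrow> (a, b) \<in> nxt" if ab: "a \<in> A" "b \<in> A" for a b
  proof (cases "head Q a = tail Q b")
    case True
    have "(snd (P (head Q a)) a = fst (P (head Q a)) b) = ((a, b) \<in> nxt)"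
      using bspec[OF P, of "head Q a"] Av[OF ab(1)] ab True by metis
    then show ?thesis using True by (simp add: tgt_def src_def)
  qed (auto simp: tgt_def src_def nxt_def)
  have special_half: "src a \<noteq> (x, True)" "tgt a \<noteq> (x, True)" if "x \<in> S" "a \<in> A" for x a
    using P that Av[OF that(2)] by (auto simp: src_def tgt_def)
  define H where "H = verts Q \<times> (UNIV :: bool set)"
  define \<sigma> where "\<sigma> = (\<lambda>a. (src a, tgt a)) ` A"
  have \<sigma>I: "a \<in> A \<Longrightarrow> (src a, tgt a) \<in> \<sigma>" for a by (simp add: \<sigma>_def)
  interpret C: chains H \<sigma>
  proof
    show "finite H" by (simp add: H_def)
    show "\<sigma> \<subseteq> H \<times> H" using Av by (auto simp: \<sigma>_def H_def src_def tgt_def)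
    show "h1 = h2" if "(h, h1) \<in> \<sigma>" "(h, h2) \<in> \<sigma>" for h h1 h2 using that src_inj by (auto simp: \<sigma>_def)
    show "h1 = h2" if "(h1, h) \<in> \<sigma>" "(h2, h) \<in> \<sigma>" for h h1 h2 using that tgt_inj by (auto simp: \<sigma>_def)
    \<comment> \<open>A sequence of half-edge steps is a sequence of arrows whose consecutive pairs
      lie in \<open>nxt\<close>, so a closed one contradicts acyclicity of
      \<open>nxt\<close>.\<close>
    have *: "\<exists>a b. a \<in> A \<and> b \<in> A \<and> src a = h \<and> tgt b = h' \<and> (a = b \<or> (a, b) \<in> nxt\<^sup>+)" if "(h, h') \<in> \<sigma>\<^sup>+" for h h'
      using that
    proof (induction rule: trancl_induct)
      case (base y)
      then show ?case by (auto simp: \<sigma>_def)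
    next
      case (step y z)
      then obtain a b c where abc: "a \<in> A" "b \<in> A" "c \<in> A" "src a = h" "tgt b = y" "a = b \<or> (a, b) \<in> nxt\<^sup>+" "src c = y" "tgt c = z"
        by (auto simp: \<sigma>_def)
      then have "(b, c) \<in> nxt" using tgt_src[of b c] by simp
      then have "(a, c) \<in> nxt\<^sup>+" using abc(6) by auto
      then show ?case using abc by blast
    qed
    show "acyclic \<sigma>"
      unfolding acyclic_def
    proof (rule allI, rule notI)
      fix h assume "(h, h) \<in> \<sigma>\<^sup>+"
      then obtain a b where ab: "a \<in> A" "b \<in> A" "src a = h" "tgt b = h" "a = b \<or> (a, b) \<in> nxt\<^sup>+" using * by blast
      then have "(b, a) \<in> nxt" using tgt_src[of b a] by simp
      then have "(b, b) \<in> nxt\<^sup>+" using ab(5) by auto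
      then show False using acyc_nxt by (simp add: acyclic_def)
    qed
  qed
  obtain e :: "'x \<times> bool \<Rightarrow> nat" where e: "inj_on e H" using finite_imp_inj_to_nat_seg[OF C.finite_H] by blast
  obtain \<gamma> :: "'x \<Rightarrow> nat" where \<gamma>: "inj_on \<gamma> (verts Q)" using finite_imp_inj_to_nat_seg[OF Q.finite_verts] by blast
  define ei where "ei = inv_into H e"
  define gi where "gi = inv_into (verts Q) \<gamma>"
  have ei [simp]: "ei (e h) = h" if "h \<in> H" for h using e that by (simp add: ei_def)
  have gi [simp]: "gi (\<gamma> x) = x" if "x \<in> verts Q" for x using \<gamma> that by (simp add: gi_def)
  have e_eq: "e h = e h' \<longleftrightarrow> h = h'" if "h \<in> H" "h' \<in> H" for h h' using e that by (auto simp: inj_on_def)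
  have roots_H: "r \<in> H" if "r \<in> C.roots" for r using that by (simp add: C.roots_def)
  have root_H: "fst (C.place h) \<in> H" "fst (C.place h) \<in> C.roots" if "h \<in> H" for h using C.place(1)[OF that] roots_H by auto
  have half: "(x, b) \<in> H" if "x \<in> verts Q" for x and b :: bool using that by (simp add: H_def)
  \<comment> \<open>The vertex of the graph to which the half-edge \<open>(x, b)\<close> belongs,
    coded by the first half-edge of its chain.\<close>
  define root where "root x b = e (fst (C.place (x, b)))" for x and b :: bool
  define \<Gamma> :: "(nat, nat) skew_brauer_graph" where
    "\<Gamma> = \<lparr>vertices = e ` C.roots, edges = \<gamma> ` verts Q,
      ends = (\<lambda>y. {#root (gi y) True, root (gi y) False#}), mlt = (\<lambda>_. 1),
      cyc = (\<lambda>v. map (\<gamma> \<circ> fst) (C.chain (ei v))), special = (\<lambda>x. e (x, True)) ` S\<rparr>"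
  have [simp]: "vertices \<Gamma> = e ` C.roots" "edges \<Gamma> = \<gamma> ` verts Q"
    "ends \<Gamma> y = {#root (gi y) True, root (gi y) False#}" "mlt \<Gamma> v = 1"
    "cyc \<Gamma> v = map (\<gamma> \<circ> fst) (C.chain (ei v))" "special \<Gamma> = (\<lambda>x. e (x, True)) ` S" for y v
    by (simp_all add: \<Gamma>_def)
  have S_verts: "x \<in> verts Q" if "x \<in> S" for x using S_D[OF that] loop Q.tail_in_verts by blast
  have special_root: "(x, True) \<in> C.roots" "C.chain (x, True) = [(x, True)]" if "x \<in> S" for x
  proof -
    note sh = special_half[OF that]
    have "\<exists>a. a \<in> A \<and> tgt a = h" if "h \<in> Range \<sigma>" for h using that by (auto simp: \<sigma>_def)
    then have "(x, True) \<notin> Range \<sigma>" using sh(2) by blast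
    moreover have "\<exists>a. a \<in> A \<and> src a = h" if "h \<in> Domain \<sigma>" for h using that by (auto simp: \<sigma>_def)
    then have "(x, True) \<notin> Domain \<sigma>" using sh(1) by blast
    ultimately show "(x, True) \<in> C.roots" "C.chain (x, True) = [(x, True)]"
      using C.isolated_chain half S_verts[OF that] by auto
  qed
  have special_place: "C.place (x, True) = ((x, True), 0)" if "x \<in> S" for x
    using C.place_eqI[of "(x, True)" 0 "(x, True)"] special_root[OF that] by simp
  have special_root_only: "h = (x, True)" if "x \<in> S" "h \<in> H" "fst (C.place h) = (x, True)" for x h
    using C.place[OF that(2)] special_root[OF that(1)] that(3) by simp
  have chain_H: "h \<in> H" if "r \<in> C.roots" "h \<in> set (C.chain r)" for r h
  proof -
    from that(2) obtain i where i: "i < length (C.chain r)" "C.chain r ! i = h" unfolding in_set_conv_nth by blast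
    show ?thesis using C.chain_subset[OF roots_H[OF \<open>r \<in> C.roots\<close>] i(1)] i(2) by simp
  qed
  \<comment> \<open>The edge \<open>x\<close> occurs in a chain once for each of its two half-edges
    on it; the case of both on one chain is that of a loop.\<close>
  have count: "count_list (map (\<gamma> \<circ> fst) (C.chain r)) (\<gamma> x) = count {#root x True, root x False#} (e r)"
    if r: "r \<in> C.roots" and x: "x \<in> verts Q" for r x
  proof -
    have "count_list (map (\<gamma> \<circ> fst) (C.chain r)) (\<gamma> x) = length (filter (\<lambda>h. \<gamma> x = \<gamma> (fst h)) (C.chain r))"
      by (simp add: count_list_eq_length_filter filter_map comp_def)
    also have "\<dots> = card {h \<in> set (C.chain r). \<gamma> x = \<gamma> (fst h)}"
      using distinct_card[OF distinct_filter[OF C.distinct_chain[OF r]], of "\<lambda>h. \<gamma> x = \<gamma> (fst h)"] by simp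
    also have "{h \<in> set (C.chain r). \<gamma> x = \<gamma> (fst h)} = (\<lambda>b. (x, b)) ` {b. root x b = e r}"
    proof (intro equalityI subsetI)
      fix h assume h: "h \<in> {h \<in> set (C.chain r). \<gamma> x = \<gamma> (fst h)}"
      then have hH: "h \<in> H" using chain_H r by blast
      then have "fst h = x" using h x \<gamma> by (auto simp: H_def inj_on_def)
      then show "h \<in> (\<lambda>b. (x, b)) ` {b. root x b = e r}"
        using h C.in_chain_iff[OF r hH] by (cases h) (auto simp: root_def)
    next
      fix h assume "h \<in> (\<lambda>b. (x, b)) ` {b. root x b = e r}"
      then obtain b where b: "h = (x, b)" "root x b = e r" by blast
      have "fst (C.place (x, b)) = r" using b(2) e_eq[OF root_H(1)[OF half[OF x]] roots_H[OF r]] by (simp add: root_def)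
      then show "h \<in> {h \<in> set (C.chain r). \<gamma> x = \<gamma> (fst h)}"
        using C.in_chain_iff[OF r half[OF x]] b(1) by simp
    qed
    also have "card ((\<lambda>b. (x, b)) ` {b. root x b = e r}) = card {b. root x b = e r}"
      by (rule card_image) (simp add: inj_on_def)
    also have "{b. root x b = e r} = (if root x True = e r then {True} else {}) \<union> (if root x False = e r then {False} else {})"
    proof -
      have "b \<in> {b. root x b = e r} \<longleftrightarrow> b \<in> (if root x True = e r then {True} else {}) \<union> (if root x False = e r then {False} else {})" for b
        by (cases b) auto
      then show ?thesis by blast
    qed
    also have "card \<dots> = count {#root x True, root x False#} (e r)" by simp
    finally show ?thesis .
  qed
  have brauer: "brauer_graph \<Gamma>"
  proof
    show "finite (vertices \<Gamma>)" using C.finite_H by (simp add: C.roots_def)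
    fix v assume "v \<in> vertices \<Gamma>"
    then obtain r where r: "r \<in> C.roots" "v = e r" by auto
    have "fst h \<in> verts Q" if "h \<in> set (C.chain r)" for h
      using chain_H[OF r(1) that] unfolding H_def by (cases h) simp
    then show "set (cyc \<Gamma> v) \<subseteq> edges \<Gamma>" using r(2) roots_H[OF r(1)] by auto
    fix y assume "y \<in> edges \<Gamma>"
    then obtain x where "x \<in> verts Q" "y = \<gamma> x" by auto
    then show "count_list (cyc \<Gamma> v) y = count (ends \<Gamma> y) v" using count[OF r(1)] r roots_H by simp
  qed (use root_H half in \<open>auto simp: root_def\<close>)
  have skew: "skew_brauer_graph \<Gamma>"
  proof (rule skew_brauer_graph.intro[OF brauer], unfold_locales)
    show "special \<Gamma> \<subseteq> vertices \<Gamma>" using special_root by auto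
    fix v assume "v \<in> special \<Gamma>"
    then obtain x where x: "x \<in> S" "v = e (x, True)" by auto
    note xv = S_verts[OF x(1)]
    \<comment> \<open>The chain of a special half-edge consists of it alone, so the opposite
      half-edge of \<open>x\<close> belongs to a vertex that is not special.\<close>
    have f1: "root x False \<in> vertices \<Gamma> - special \<Gamma>"
    proof -
      have "root x False \<noteq> e (y, True)" if "y \<in> S" for y
        using special_root_only[OF that half[OF xv, of False]] e_eq[OF root_H(1)[OF half[OF xv]] half[OF S_verts[OF that]]]
        by (auto simp: root_def)
      then show ?thesis using root_H half[OF xv] by (auto simp: root_def)
    qed
    have f2: "ends \<Gamma> (\<gamma> x) = {#v, root x False#}" using xv special_place[OF x(1)] x(2) by (simp add: root_def)
    have f3: "cyc \<Gamma> v = [\<gamma> x]" using x special_root[OF x(1)] half[OF xv] by simp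
    have f4: "\<gamma> x \<in> edges \<Gamma>" using xv by simp
    show "mlt \<Gamma> v = 1 \<and> (\<exists>x\<in>edges \<Gamma>. cyc \<Gamma> v = [x] \<and> (\<exists>w\<in>vertices \<Gamma> - special \<Gamma>. ends \<Gamma> x = {#v, w#}))"
      by (intro conjI bexI[of _ "\<gamma> x"] bexI[of _ "root x False"]) (simp, rule f3, rule f2, rule f1, rule f4)
  qed
  have one: "multiplicity_one \<Gamma>" by (simp add: multiplicity_one_def)
  interpret G: skew_brauer_graph \<Gamma> by (rule skew)
  have val: "val \<Gamma> (e r) = length (C.chain r)" if "r \<in> C.roots" for r
    using G.val_eq_length[of "e r"] that roots_H[OF that] by simp
  have special_edges: "special_edges \<Gamma> = \<gamma> ` S"
  proof (intro equalityI subsetI)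
    fix y assume "y \<in> special_edges \<Gamma>"
    then obtain x z b where xz: "x \<in> verts Q" "y = \<gamma> x" "z \<in> S" "e (z, True) = root x b" by (auto simp: special_edges_def)
    have "fst (C.place (x, b)) = (z, True)"
      using xz(4) e_eq[OF half[OF S_verts[OF xz(3)]] root_H(1)[OF half[OF xz(1)]]] by (simp add: root_def)
    then have "(x, b) = (z, True)" by (rule special_root_only[OF xz(3) half[OF xz(1)]])
    then show "y \<in> \<gamma> ` S" using xz by simp
  next
    fix y assume "y \<in> \<gamma> ` S"
    then obtain x where x: "x \<in> S" "y = \<gamma> x" by auto
    then have "e (x, True) \<in># ends \<Gamma> y" using special_place[OF x(1)] S_verts by (simp add: root_def)
    then show "y \<in> special_edges \<Gamma>" using x S_verts by (auto simp: special_edges_def)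
  qed
  \<comment> \<open>An arrow sits at the place of the half-edge it leaves; the half-edge it enters
    is the next place on the same chain.\<close>
  define pos where "pos a = (e (fst (C.place (src a))), snd (C.place (src a)))" for a
  have srcH: "src a \<in> H" "tgt a \<in> H" if "a \<in> A" for a using that Av by (auto simp: src_def tgt_def H_def)
  have pos: "fst (pos a) \<in> vertices \<Gamma>" "Suc (snd (pos a)) < val \<Gamma> (fst (pos a))"
    "\<gamma> (tail Q a) = cyc \<Gamma> (fst (pos a)) ! snd (pos a)" "\<gamma> (head Q a) = cyc \<Gamma> (fst (pos a)) ! Suc (snd (pos a))"
    "next_arrow \<Gamma> (pos a) = (e (fst (C.place (tgt a))), snd (C.place (tgt a)))" if a: "a \<in> A" for a
  proof -
    note p = C.place[OF srcH(1)[OF a]] and n = C.place_next[OF \<sigma>I[OF a]]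
    note q = C.place[OF srcH(2)[OF a]]
    have v: "val \<Gamma> (fst (pos a)) = length (C.chain (fst (C.place (src a))))" using val[OF p(1)] by (simp add: pos_def)
    show "fst (pos a) \<in> vertices \<Gamma>" using p(1) by (simp add: pos_def)
    show suc: "Suc (snd (pos a)) < val \<Gamma> (fst (pos a))" using n(2) v by (simp add: pos_def)
    show "\<gamma> (tail Q a) = cyc \<Gamma> (fst (pos a)) ! snd (pos a)"
      using p roots_H[OF p(1)] by (simp add: pos_def) (simp add: src_def)
    show "\<gamma> (head Q a) = cyc \<Gamma> (fst (pos a)) ! Suc (snd (pos a))"
      using q n roots_H[OF p(1)] by (simp add: pos_def) (simp add: tgt_def)
    show "next_arrow \<Gamma> (pos a) = (e (fst (C.place (tgt a))), snd (C.place (tgt a)))"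
      using suc n(1) by (simp add: next_arrow_def pos_def)
  qed
  have place_inj: "h = h'" if "h \<in> H" "h' \<in> H" "(e (fst (C.place h)), snd (C.place h)) = (e (fst (C.place h')), snd (C.place h'))" for h h'
  proof -
    have place_eq: "fst (C.place h) = fst (C.place h')" "snd (C.place h) = snd (C.place h')"
      using that(3) e_eq[OF root_H(1)[OF that(1)] root_H(1)[OF that(2)]] by simp_all
    have "h = C.chain (fst (C.place h)) ! snd (C.place h)" by (rule C.place(3)[OF that(1), symmetric])
    also have "\<dots> = C.chain (fst (C.place h')) ! snd (C.place h')" by (simp only: place_eq)
    also have "\<dots> = h'" by (rule C.place(3)[OF that(2)])
    finally show ?thesis .
  qed
  have inj_pos: "inj_on pos A"
  proof (rule inj_onI)
    fix a b assume ab: "a \<in> A" "b \<in> A" "pos a = pos b"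
    then have "src a = src b" using place_inj[OF srcH(1) srcH(1)] by (simp add: pos_def)
    then show "a = b" using src_inj ab by blast
  qed
  have pos_A: "pos ` A = {(v, i). v \<in> vertices \<Gamma> \<and> Suc i < val \<Gamma> v}"
  proof (intro equalityI subsetI)
    fix p assume "p \<in> pos ` A"
    then obtain a where a: "a \<in> A" "p = pos a" by blast
    then show "p \<in> {(v, i). v \<in> vertices \<Gamma> \<and> Suc i < val \<Gamma> v}" using pos(1,2)[OF a(1)] by (cases p) auto
  next
    fix p assume "p \<in> {(v, i). v \<in> vertices \<Gamma> \<and> Suc i < val \<Gamma> v}"
    then obtain r i where r: "r \<in> C.roots" "p = (e r, i)" "Suc i < length (C.chain r)" using val by auto
    \<comment> \<open>Every step of a chain comes from an arrow, while the last place of a chain is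
      the source of none; this is the position required to be empty.\<close>
    then have "(C.chain r ! i, C.chain r ! Suc i) \<in> \<sigma>" using C.chain_step by blast
    then obtain a where a: "a \<in> A" "src a = C.chain r ! i" by (auto simp: \<sigma>_def)
    have "C.place (src a) = (r, i)" using C.place_eqI[OF r(1), of i "src a"] r(3) a(2) by simp
    then have "pos a = p" using r(2) by (simp add: pos_def)
    then show "p \<in> pos ` A" using a(1) by blast
  qed
  have cut: "cut_cover \<Gamma> (aux_quiver Q Sp) \<gamma> pos S (aux_relations Q \<rho> Sp)"
  proof (intro cut_cover.intro brauer_cover.intro cut_cover_axioms.intro brauer_cover_axioms.intro
      skew fin_digraph_aux_quiver fin one; unfold aux_quiver_simps A_def[symmetric])
    show "inj_on \<gamma> (verts Q)" by (rule \<gamma>)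
    show "(x \<in> S) = (\<gamma> x \<in> special_edges \<Gamma>)" if "x \<in> verts Q" for x
      using that S_verts \<gamma> by (auto simp: special_edges inj_on_def)
    show "inj_on pos A" by (rule inj_pos)
    show "pos ` A = {(v, i). v \<in> vertices \<Gamma> \<and> Suc i < val \<Gamma> v}" by (rule pos_A)
    fix a assume a: "a \<in> A"
    show "fst (pos a) \<in> vertices \<Gamma> \<and> snd (pos a) < val \<Gamma> (fst (pos a))" using pos(1,2)[OF a] by simp
    show "\<gamma> (tail Q a) = cyc \<Gamma> (fst (pos a)) ! snd (pos a)" by (rule pos(3)[OF a])
    show "\<gamma> (head Q a) = cyc \<Gamma> (fst (pos a)) ! (Suc (snd (pos a)) mod val \<Gamma> (fst (pos a)))"
      using pos(2,4)[OF a] by simp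
    fix b assume b: "b \<in> A" and ab: "head Q a = tail Q b"
    have "pos b = next_arrow \<Gamma> (pos a) \<longleftrightarrow> src b = tgt a"
      using pos(5)[OF a] place_inj[OF srcH(1)[OF b] srcH(2)[OF a]] by (auto simp: pos_def)
    also have "\<dots> \<longleftrightarrow> (a, b) \<in> nxt" using tgt_src[OF a b] by auto
    finally show "((a, b) \<in> aux_relations Q \<rho> Sp) = (pos b \<noteq> next_arrow \<Gamma> (pos a) \<and> head Q a \<notin> S)"
      using a b ab by (auto simp: aux_relations_def nxt_def S_def)
  qed simp_all
  have "algebra_iso (trivial_extension (admissible_presentation Q \<rho> Sp :: ('k, _) module)) (skew_brauer_graph_algebra \<Gamma>)"
    using cut_cover.trivial_extension_iso_brauer[OF cut]
    by (simp add: admissible_presentation_def Let_def S_def)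
  then show ?thesis using skew one by blast
qed

theorem theoremA:
  assumes "CHAR('k::alg_closed_field) \<noteq> 2"
  shows "(\<forall>\<Gamma> :: ('v, 'e) skew_brauer_graph. skew_brauer_graph \<Gamma> \<longrightarrow>
            (let B = (skew_brauer_graph_algebra \<Gamma> :: ('k, _) module)
             in K_algebra B \<and> fin_dim B \<and> symmetric_algebra B)) \<and>
         (\<forall>(Q :: ('x, 'a) pre_digraph) \<rho> Sp. skew_gentle TYPE('k) Q \<rho> Sp \<longrightarrow>
            (\<exists>\<Gamma> :: (nat, nat) skew_brauer_graph. skew_brauer_graph \<Gamma> \<and> multiplicity_one \<Gamma> \<and>
               algebra_iso
                 (trivial_extension (admissible_presentation Q \<rho> Sp :: ('k, _) module))
                 (skew_brauer_graph_algebra \<Gamma>))) \<and>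
         (\<forall>\<Gamma> :: ('v, 'e) skew_brauer_graph. skew_brauer_graph \<Gamma> \<and> multiplicity_one \<Gamma> \<longrightarrow>
            (\<exists>(Q :: (nat, nat) pre_digraph) \<rho> Sp. skew_gentle TYPE('k) Q \<rho> Sp \<and>
               algebra_iso
                 (trivial_extension (admissible_presentation Q \<rho> Sp :: ('k, _) module))
                 (skew_brauer_graph_algebra \<Gamma>)))"
proof (intro conjI allI impI)
  fix \<Gamma> :: "('v, 'e) skew_brauer_graph" assume "skew_brauer_graph \<Gamma>"
  then have "brauer_relations \<Gamma>" by (rule brauer_relations.intro)
  then show "let B = (skew_brauer_graph_algebra \<Gamma> :: ('k, _) module)
      in K_algebra B \<and> fin_dim B \<and> symmetric_algebra B"
    unfolding Let_def by (intro conjI brauer_relations.skew_brauer_graph_algebra_symmetric)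
next
  fix Q :: "('x, 'a) pre_digraph" and \<rho> Sp assume "skew_gentle TYPE('k) Q \<rho> Sp"
  then show "\<exists>\<Gamma> :: (nat, nat) skew_brauer_graph. skew_brauer_graph \<Gamma> \<and> multiplicity_one \<Gamma> \<and>
      algebra_iso (trivial_extension (admissible_presentation Q \<rho> Sp :: ('k, _) module))
        (skew_brauer_graph_algebra \<Gamma>)"
    by (rule skew_gentle_to_brauer)
next
  fix \<Gamma> :: "('v, 'e) skew_brauer_graph" assume "skew_brauer_graph \<Gamma> \<and> multiplicity_one \<Gamma>"
  then show "\<exists>(Q :: (nat, nat) pre_digraph) \<rho> Sp. skew_gentle TYPE('k) Q \<rho> Sp \<and>
      algebra_iso (trivial_extension (admissible_presentation Q \<rho> Sp :: ('k, _) module))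
        (skew_brauer_graph_algebra \<Gamma>)"
    using skew_brauer_graph.cut_to_skew_gentle by blast
qed

end
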